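(* Let $\omega\in\mathbb{R}\setminus\{0\}$ and let $f$ be an analytic $2\pi$-periodic function, $f(\psi)=\sum_{\nu\in\mathbb{Z}}e^{i\nu\psi}f_\nu$, with average $f_0=\alpha>0$. For real $\varepsilon$ with $|\varepsilon|$ small enough, let $x(t)$ be the only periodic solution of $$\varepsilon\ddot x+\dot x+\varepsilon x^2=\varepsilon f(\omega t)$$ which admits a formal expansion $\sum_{k\ge0}\varepsilon^kx^{(k)}(t)$ in powers of $\varepsilon$; it has period $2\pi/\omega$ and is given by the resummed series described in the context. Then $x(t)$ is Borel-summable (in $\varepsilon$) at the origin. Here Borel summability means the following. For $R>0$ small enough let $\mathcal{C}_R=\{\varepsilon\in\mathbb{C}:|\mathrm{Re}\,\varepsilon^{-1}|>R^{-1}\}$, and let $A,B$ be the constants, uniform in $N$ and in $\varepsilon$, of the asymptotic expansion $$x(t)=\sum_{k=0}^{N-1}\varepsilon^kx^{(k)}(t)+\mathfrak{R}_N(\varepsilon),\qquad|\mathfrak{R}_N(\varepsilon)|\le AB^NN!\,|\varepsilon|^N,$$ valid in $\mathcal{C}_R$. Then the function $$\mathfrak{B}(t;\varepsilon)=\sum_{k=0}^\infty\frac1{k!}\varepsilon^kx^{(k)}(t)$$ (the Borel transform of $x(t)$) converges for $|\varepsilon|<B$ and has an analytic continuation to $\mathcal{S}_B=\{\varepsilon:\mathrm{dist}(\varepsilon,\mathbb{R}_+)<B\}$, satisfying for some constant $K$ the bound $|\mathfrak{B}(t;\varepsilon)|\le Ke^{|\varepsilon|/R}$ uniformly in every $\mathcal{S}_{B'}$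 with $B'<B$; and $x(t)$ can be represented as the absolutely convergent integral $$x(t)=\frac1\varepsilon\int_0^\infty e^{-s/\varepsilon}\,\mathfrak{B}(t;s)\,ds$$ for all $\varepsilon\in\mathcal{C}_R$.
   Context: Formal series. The coefficients are $x^{(k)}(t)=\sum_{\nu\in\mathbb{Z}}e^{i\nu\omega t}x^{(k)}_\nu$, where $x^{(0)}_\nu=0$ for $\nu\ne0$, $x^{(0)}_0=c_0=\sqrt\alpha$; for $\nu\neq0$, $x^{(1)}_\nu=f_\nu/(i\omega\nu)$ and, for $k\ge2$, $$x^{(k)}_\nu=-(i\omega\nu)x^{(k-1)}_\nu-\frac{1}{i\omega\nu}\sum_{k_1+k_2=k-1}\ \sum_{\nu_1+\nu_2=\nu}x^{(k_1)}_{\nu_1}x^{(k_2)}_{\nu_2};$$ and $x^{(1)}_0=0$, $x^{(k)}_0=-\frac{1}{2c_0}\sum_{k'=1}^{k-1}\sum_{\nu\in\mathbb{Z}}x^{(k-k')}_{\nu}x^{(k')}_{-\nu}$ for $k\ge2$. Solution (resummed series). Define, depending on $\varepsilon$, $x^{[k]}(t)=\sum_{\nu\in\mathbb{Z}}e^{i\nu\omega t}x^{[k]}_\nu$, where $x^{[0]}_\nu=0$ for $\nu\neq0$, $x^{[0]}_0=c_0=\sqrt\alpha$; for $\nu\ne0$, $x^{[1]}_\nu=\dfrac{\varepsilon f_\nu}{i\omega\nu(1+i\varepsilon\omega\nu)}$ and, for $k\ge2$, $$x^{[k]}_\nu=-\frac{\varepsilon}{i\omega\nu(1+i\varepsilon\omega\nu)}\sum_{k_1+k_2=k-1}\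 \sum_{\nu_1+\nu_2=\nu}x^{[k_1]}_{\nu_1}x^{[k_2]}_{\nu_2};$$ and $x^{[1]}_0=0$, $x^{[k]}_0=-\frac1{2c_0}\sum_{k'=1}^{k-1}\sum_{\nu\in\mathbb{Z}}x^{[k-k']}_\nu x^{[k']}_{-\nu}$ for $k\ge2$. For $\varepsilon$ real and small, and for $\varepsilon\in\mathcal{C}_R$ with $R$ small, the series $x(t)=\sum_{k\ge0}x^{[k]}(t)$ converges, and this is the solution in question. The set $\mathcal{C}_R$ is the union of the two discs of radius $R/2$ with centers $\pm R/2$.
   Formalization: The Borel transform's radius and strip half-width are 1/B instead of B, and for ε in the left disc of C_R the Laplace integral runs from 0 to −∞, with continuation and bound on the reflected strip, since the integral over the positive half-line diverges there (e.g. f constant). *)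

theory Defs
  imports "HOL-Complex_Analysis.Complex_Analysis"
begin

definition real_analytic :: "(real \<Rightarrow> real) \<Rightarrow> bool" where
  "real_analytic f \<longleftrightarrow>
     (\<forall>x0. \<exists>r>0. \<exists>a. \<forall>x. \<bar>x - x0\<bar> < r \<longrightarrow> (\<lambda>n. a n * (x - x0) ^ n) sums f x)"

definition fourier_coeff :: "(real \<Rightarrow> real) \<Rightarrow> int \<Rightarrow> complex" where
  "fourier_coeff f \<nu> =
     integral {0..2 * pi} (\<lambda>\<psi>. exp (- (\<i> * of_int \<nu> * of_real \<psi>)) * of_real (f \<psi>)) / of_real (2 * pi)"

text \<open>Below, \<open>c\<close> stands for $c_0 = \sqrt\alpha$ and \<open>F \<nu>\<close> for $f_\nu$. The inner sums over
  $\nu_1 + \nu_2 = \nu$ run over all \<open>\<nu>\<^sub>1 :: int\<close> with $\nu_2 = \nu - \nu_1$.\<close>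

definition fourier_conv :: "(int \<Rightarrow> complex) \<Rightarrow> (int \<Rightarrow> complex) \<Rightarrow> int \<Rightarrow> complex" where
  "fourier_conv u v \<nu> = (\<Sum>\<^sub>\<infinity>\<nu>\<^sub>1\<in>UNIV. u \<nu>\<^sub>1 * v (\<nu> - \<nu>\<^sub>1))"

context
  notes sum.cong [fundef_cong]
begin

function formal_coeff :: "real \<Rightarrow> real \<Rightarrow> (int \<Rightarrow> complex) \<Rightarrow> nat \<Rightarrow> int \<Rightarrow> complex" where
  "formal_coeff c \<omega> F 0 = (\<lambda>\<nu>. if \<nu> = 0 then of_real c else 0)"
| "formal_coeff c \<omega> F (Suc 0) = (\<lambda>\<nu>. if \<nu> = 0 then 0 else F \<nu> / (\<i> * of_real \<omega> * of_int \<nu>))"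
| "formal_coeff c \<omega> F (Suc (Suc n)) = (\<lambda>\<nu>.
     if \<nu> = 0 then
       - (1 / (2 * of_real c)) * (\<Sum>k'\<in>{1..Suc n}.
            fourier_conv (formal_coeff c \<omega> F (Suc (Suc n) - k')) (formal_coeff c \<omega> F k') 0)
     else
       - (\<i> * of_real \<omega> * of_int \<nu>) * formal_coeff c \<omega> F (Suc n) \<nu>
       - 1 / (\<i> * of_real \<omega> * of_int \<nu>) * (\<Sum>k\<^sub>1\<in>{0..Suc n}.
            fourier_conv (formal_coeff c \<omega> F k\<^sub>1) (formal_coeff c \<omega> F (Suc n - k\<^sub>1)) \<nu>))"
  by pat_completeness auto
termination by (relation "Wellfounded.measure (\<lambda>(c, \<omega>, F, k). k)") auto

function resummed_coeff ::
    "real \<Rightarrow> real \<Rightarrow> (int \<Rightarrow> complex) \<Rightarrow> complex \<Rightarrow> nat \<Rightarrow> int \<Rightarrow> complex" where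
  "resummed_coeff c \<omega> F \<epsilon> 0 = (\<lambda>\<nu>. if \<nu> = 0 then of_real c else 0)"
| "resummed_coeff c \<omega> F \<epsilon> (Suc 0) = (\<lambda>\<nu>. if \<nu> = 0 then 0 else
     \<epsilon> * F \<nu> / (\<i> * of_real \<omega> * of_int \<nu> * (1 + \<i> * \<epsilon> * of_real \<omega> * of_int \<nu>)))"
| "resummed_coeff c \<omega> F \<epsilon> (Suc (Suc n)) = (\<lambda>\<nu>.
     if \<nu> = 0 then
       - (1 / (2 * of_real c)) * (\<Sum>k'\<in>{1..Suc n}.
            fourier_conv (resummed_coeff c \<omega> F \<epsilon> (Suc (Suc n) - k')) (resummed_coeff c \<omega> F \<epsilon> k') 0)
     else
       - (\<epsilon> / (\<i> * of_real \<omega> * of_int \<nu> * (1 + \<i> * \<epsilon> * of_real \<omega> * of_int \<nu>))) * (\<Sum>k\<^sub>1\<in>{0..Suc n}.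
            fourier_conv (resummed_coeff c \<omega> F \<epsilon> k\<^sub>1) (resummed_coeff c \<omega> F \<epsilon> (Suc n - k\<^sub>1)) \<nu>))"
  by pat_completeness auto
termination by (relation "Wellfounded.measure (\<lambda>(c, \<omega>, F, \<epsilon>, k). k)") auto

end

definition fourier_series :: "real \<Rightarrow> (int \<Rightarrow> complex) \<Rightarrow> real \<Rightarrow> complex" where
  "fourier_series \<omega> u t = (\<Sum>\<^sub>\<infinity>\<nu>\<in>UNIV. exp (\<i> * of_int \<nu> * of_real \<omega> * of_real t) * u \<nu>)"

definition formal_term :: "real \<Rightarrow> real \<Rightarrow> (real \<Rightarrow> real) \<Rightarrow> nat \<Rightarrow> real \<Rightarrow> complex" where
  "formal_term \<alpha> \<omega> f k = fourier_series \<omega> (formal_coeff (sqrt \<alpha>) \<omega> (fourier_coeff f) k)"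

definition resummed_term ::
    "real \<Rightarrow> real \<Rightarrow> (real \<Rightarrow> real) \<Rightarrow> complex \<Rightarrow> nat \<Rightarrow> real \<Rightarrow> complex" where
  "resummed_term \<alpha> \<omega> f \<epsilon> k = fourier_series \<omega> (resummed_coeff (sqrt \<alpha>) \<omega> (fourier_coeff f) \<epsilon> k)"

definition resummed_solution ::
    "real \<Rightarrow> real \<Rightarrow> (real \<Rightarrow> real) \<Rightarrow> complex \<Rightarrow> real \<Rightarrow> complex" where
  "resummed_solution \<alpha> \<omega> f \<epsilon> t = (\<Sum>k. resummed_term \<alpha> \<omega> f \<epsilon> k t)"

definition solves_ode :: "real \<Rightarrow> (real \<Rightarrow> real) \<Rightarrow> real \<Rightarrow> (real \<Rightarrow> real) \<Rightarrow> bool" where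
  "solves_ode \<omega> f \<epsilon> y \<longleftrightarrow> (\<exists>y' y''.
     (\<forall>t. (y has_real_derivative y' t) (at t)) \<and>
     (\<forall>t. (y' has_real_derivative y'' t) (at t)) \<and>
     (\<forall>t. \<epsilon> * y'' t + y' t + \<epsilon> * (y t)\<^sup>2 = \<epsilon> * f (\<omega> * t)))"

text \<open>A family \<open>y \<epsilon>\<close> of periodic solutions, for small real \<open>\<epsilon> \<noteq> 0\<close>, admitting the formal
  expansion $\sum_k \varepsilon^k x^{(k)}(t)$, in the sense of an asymptotic expansion uniform
  in \<open>t\<close>. The equation is also formally solved by a series starting at $-\sqrt\alpha$;
  the expansion with coefficients \<open>formal_term\<close> selects $x^{(0)} = \sqrt\alpha$.\<close>

definition expandable_periodic_solution ::
    "real \<Rightarrow> real \<Rightarrow> (real \<Rightarrow> real) \<Rightarrow> (real \<Rightarrow> real \<Rightarrow> real) \<Rightarrow> bool" where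
  "expandable_periodic_solution \<alpha> \<omega> f y \<longleftrightarrow>
     (\<exists>\<epsilon>0>0. \<forall>\<epsilon>. \<epsilon> \<noteq> 0 \<and> \<bar>\<epsilon>\<bar> < \<epsilon>0 \<longrightarrow>
        solves_ode \<omega> f \<epsilon> (y \<epsilon>) \<and> (\<exists>P>0. \<forall>t. y \<epsilon> (t + P) = y \<epsilon> t)) \<and>
     (\<forall>N. \<exists>C. \<exists>\<epsilon>0>0. \<forall>\<epsilon> t. \<epsilon> \<noteq> 0 \<and> \<bar>\<epsilon>\<bar> < \<epsilon>0 \<longrightarrow>
        cmod (of_real (y \<epsilon> t) - (\<Sum>k<N. of_real \<epsilon> ^ k * formal_term \<alpha> \<omega> f k t)) \<le> C * \<bar>\<epsilon>\<bar> ^ N)"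

definition only_expandable_periodic_solution ::
    "real \<Rightarrow> real \<Rightarrow> (real \<Rightarrow> real) \<Rightarrow> (real \<Rightarrow> real \<Rightarrow> real) \<Rightarrow> bool" where
  "only_expandable_periodic_solution \<alpha> \<omega> f x \<longleftrightarrow>
     expandable_periodic_solution \<alpha> \<omega> f x \<and>
     (\<forall>y. expandable_periodic_solution \<alpha> \<omega> f y \<longrightarrow>
        (\<exists>\<epsilon>0>0. \<forall>\<epsilon>. \<epsilon> \<noteq> 0 \<and> \<bar>\<epsilon>\<bar> < \<epsilon>0 \<longrightarrow> y \<epsilon> = x \<epsilon>))"

text \<open>\<open>\<epsilon> = 0\<close> is excluded because \<open>1 / 0 = 0\<close>.\<close>

definition two_discs :: "real \<Rightarrow> complex set" where
  "two_discs R = {\<epsilon>. \<bar>Re (1 / \<epsilon>)\<bar> > 1 / R}"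

definition half_strip :: "real \<Rightarrow> complex set" where
  "half_strip \<rho> = {\<epsilon>. infdist \<epsilon> (complex_of_real ` {0..}) < \<rho>}"

text \<open>In the next definitions \<open>a k t\<close> are the coefficients of a formal power series in \<open>\<epsilon>\<close>
  and \<open>X \<epsilon> t\<close> is the function to be represented.\<close>

definition gevrey_bound ::
    "real \<Rightarrow> real \<Rightarrow> real \<Rightarrow> (nat \<Rightarrow> real \<Rightarrow> complex) \<Rightarrow> (complex \<Rightarrow> real \<Rightarrow> complex) \<Rightarrow> bool" where
  "gevrey_bound R A B a X \<longleftrightarrow> (\<forall>N. \<forall>\<epsilon>\<in>two_discs R. \<forall>t.
     cmod (X \<epsilon> t - (\<Sum>k<N. \<epsilon> ^ k * a k t)) \<le> A * B ^ N * fact N * cmod \<epsilon> ^ N)"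

text \<open>The bound $|\mathfrak R_N| \le A B^N N!\,|\varepsilon|^N$ yields $|a_k| \le A B^k k!$, hence
  radius of convergence and strip half-width \<open>1 / B\<close> for the Borel transform. On the
  right disc the Laplace integral runs over the positive half-line. On the left disc
  \<open>exp (- s / \<epsilon>)\<close> grows along that half-line, so the integral runs from \<open>0\<close> to \<open>-\<infinity>\<close>; this
  requires the continuation on the reflected strip as well, and the substitution
  \<open>s \<mapsto> - s\<close> gives the formula below.\<close>

definition borel_representation ::
    "real \<Rightarrow> real \<Rightarrow> (nat \<Rightarrow> real \<Rightarrow> complex) \<Rightarrow> (complex \<Rightarrow> real \<Rightarrow> complex) \<Rightarrow> bool" where
  "borel_representation R B a X \<longleftrightarrow>
     (\<forall>t \<epsilon>. cmod \<epsilon> < 1 / B \<longrightarrow> summable (\<lambda>k. 1 / fact k * \<epsilon> ^ k * a k t)) \<and>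
     (\<exists>G :: real \<Rightarrow> complex \<Rightarrow> complex.
        (\<forall>t \<epsilon>. cmod \<epsilon> < 1 / B \<longrightarrow> G t \<epsilon> = (\<Sum>k. 1 / fact k * \<epsilon> ^ k * a k t)) \<and>
        (\<forall>t. G t holomorphic_on half_strip (1 / B) \<union> uminus ` half_strip (1 / B)) \<and>
        (\<forall>B'<1 / B. \<exists>K. \<forall>t. \<forall>\<epsilon>\<in>half_strip B' \<union> uminus ` half_strip B'.
           cmod (G t \<epsilon>) \<le> K * exp (cmod \<epsilon> / R)) \<and>
        (\<forall>t. \<forall>\<epsilon>\<in>two_discs R. Re \<epsilon> > 0 \<longrightarrow>
           (\<lambda>s. exp (- (of_real s / \<epsilon>)) * G t (of_real s)) absolutely_integrable_on {0..} \<and>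
           X \<epsilon> t = 1 / \<epsilon> * integral {0..} (\<lambda>s. exp (- (of_real s / \<epsilon>)) * G t (of_real s))) \<and>
        (\<forall>t. \<forall>\<epsilon>\<in>two_discs R. Re \<epsilon> < 0 \<longrightarrow>
           (\<lambda>s. exp (of_real s / \<epsilon>) * G t (- of_real s)) absolutely_integrable_on {0..} \<and>
           X \<epsilon> t = - (1 / \<epsilon>) * integral {0..} (\<lambda>s. exp (of_real s / \<epsilon>) * G t (- of_real s))))"

end

theory Submission
  imports Defs
begin

text \<open>In Fourier space the equation for the modes $\nu \neq 0$ reads
  $i\omega\nu(1 + i\varepsilon\omega\nu)x_\nu = \varepsilon(f_\nu - (x * x)_\nu)$, and
  $\varepsilon/(1 + i\varepsilon\omega\nu) = 1/(\varepsilon^{-1} + i\omega\nu)$ has modulus at most $R$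
  on $\mathcal{C}_R$ and on the real interval of radius $R$. In a weighted $\ell^1$ algebra of Fourier
  coefficients the resummed series is therefore majorized by a contraction and converges uniformly.

  The remainders $r_N$, divided by $\varepsilon^N$, satisfy the recursion of the formal coefficients
  with one factor $x^{(k)}$ of each product replaced by a remainder. Each step costs one derivative
  $i\omega\nu$; spreading the loss of analyticity over $N$ equal steps makes the $k$-th
  term of order $(BN)^k$, and $N^N \le e^N N!$ gives the Gevrey bound uniformly on $\mathcal{C}_R$.

  Gevrey bounds on a disc tangent to the imaginary axis imply Borel summability (Nevanlinna, Sokal): with
  $R_{m+1} = x - \sum_{k \le m} a_k\varepsilon^k$, the functions
  $b_m(s) = a_m + \frac{1}{2\pi i}\oint e^{s/\varepsilon}\varepsilon^{-m-1}R_{m+1}(\varepsilon)\,d\varepsilon$ over the tangent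
  circle of radius $r/2$, $r < R$, are the successive derivatives of the Borel transform on the half-line, which gives the
  Taylor coefficients there, and Fubini with Cauchy's formula inverts the transform.

  Two solutions with the same expansion are close to $\sqrt\alpha > 0$, so that their difference solves a damped
  oscillator equation with nearly constant positive stiffness; being bounded on the whole line, it vanishes.\<close>

section \<open>Circle integrals as Bochner integrals\<close>

text \<open>The obstacle is that 0 lies on the boundary of the discs, so no Cauchy estimate is
  available there. Inversion turns the tangent circle of radius r/2 into the line Re(1/\<epsilon>) =
  1/r, on which exp(s/\<epsilon>) has constant modulus; once the terms up to a_m are subtracted, the
  integrand of b_m stays bounded at the tangency point, and Fubini and Cauchy's formula apply. The
  radius must stay below R because nothing is known on the boundary of the large disc; as the
  continuation does not depend on r, letting r tend to R recovers the growth rate 1/R. For the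
  remainders, division of the mode equation by \<epsilon> turns the factor 1 +
  i\<epsilon>\<omega>\<nu> into a derivative, so no denominator depends on \<epsilon> and the
  estimate is uniform. The price is an implicit equation for the zero mode: the remainder of order N
  occurs on both sides, on the right multiplied by x - c. That x - c has weighted norm at most c/2
  allows it to be absorbed; the numerical constants c/8, 1/8, 3c/2 are chosen to leave room for
  this.\<close>

abbreviation unit_lborel :: "real measure" where
  "unit_lborel \<equiv> restrict_space lborel {0..1}"

text \<open>One turn of the circle is parametrized by [0,1] as in \<open>circlepath\<close>. The
  Bochner integral over \<open>unit_lborel\<close>, of total mass 1, gives access to Fubini and
  dominated convergence.\<close>

definition turn :: "real \<Rightarrow> complex" where
  "turn \<theta> = exp (2 * of_real pi * \<i> * of_real \<theta>)"

lemma norm_turn [simp]: "norm (turn \<theta>) = 1"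
  by (simp add: turn_def norm_exp_eq_Re)

lemma turn_nonzero [simp]: "turn \<theta> \<noteq> 0"
  by (simp add: turn_def)

lemma continuous_on_turn [continuous_intros]: "continuous_on S turn"
  unfolding turn_def by (intro continuous_intros)

lemma borel_measurable_turn [measurable]: "turn \<in> borel_measurable borel"
  by (intro borel_measurable_continuous_onI continuous_on_turn)

lemma turn_eq_minus_1: "turn (1/2) = -1"
  by (simp add: turn_def mult.commute)

lemma turn_ne_minus_1:
  assumes "\<theta> \<in> {0..1}" "\<theta> \<noteq> 1/2" shows "turn \<theta> \<noteq> -1"
proof
  assume "turn \<theta> = -1"
  hence "turn \<theta> = turn (1/2)" by (simp add: turn_eq_minus_1)
  then obtain n :: int where n: "2 * of_real pi * \<i> * of_real \<theta> = 2 * of_real pi * \<i> * of_real (1/2) + (of_int (2 * n) * pi) * \<i>"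
    unfolding turn_def exp_eq by blast
  have "Im (2 * of_real pi * \<i> * of_real \<theta>) = Im (2 * of_real pi * \<i> * of_real (1/2) + (of_int (2 * n) * pi) * \<i>)"
    using n by (rule arg_cong)
  hence "pi * \<theta> = pi * (1/2 + of_int n)" by (simp add: algebra_simps)
  hence "\<theta> = 1/2 + of_int n" by simp
  with assms show False by (cases "n \<ge> 1"; cases "n \<le> -1") auto
qed

lemma finite_measure_unit_lborel: "finite_measure unit_lborel"
  by (rule finite_measureI) (simp add: emeasure_restrict_space space_restrict_space)

lemma measure_unit_lborel: "measure unit_lborel (space unit_lborel) = 1"
  by (simp add: measure_restrict_space space_restrict_space)

text \<open>The excluded parameter 1/2 is where \<open>turn\<close> equals -1, that is where a
  circle tangent to the imaginary axis at 0 passes through 0.\<close>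

lemma AE_unit_lborel:
  assumes "\<And>\<theta>. \<theta> \<in> {0..1} \<Longrightarrow> \<theta> \<noteq> 1/2 \<Longrightarrow> P \<theta>"
  shows "AE \<theta> in unit_lborel. P \<theta>"
proof -
  have "AE \<theta> in lborel. \<theta> \<noteq> (1/2 :: real)" by (rule AE_lborel_singleton)
  hence "AE \<theta> in lborel. \<theta> \<in> {0..1} \<longrightarrow> P \<theta>" by eventually_elim (use assms in blast)
  thus ?thesis by (subst AE_restrict_space_iff) auto
qed

lemma integrable_unit_lborel:
  fixes f :: "real \<Rightarrow> complex"
  assumes [measurable]: "f \<in> borel_measurable unit_lborel"
    and "\<And>\<theta>. \<theta> \<in> {0..1} \<Longrightarrow> norm (f \<theta>) \<le> K"
  shows "integrable unit_lborel f"
  using assms by (intro finite_measure.integrable_const_bound[OF finite_measure_unit_lborel, of _ K])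
    (auto simp: space_restrict_space intro!: AE_I2)

lemma norm_integral_unit_lborel_le:
  fixes f :: "real \<Rightarrow> complex"
  assumes "f \<in> borel_measurable unit_lborel"
    and "\<And>\<theta>. \<theta> \<in> {0..1} \<Longrightarrow> norm (f \<theta>) \<le> K"
  shows "norm (integral\<^sup>L unit_lborel f) \<le> K"
proof -
  interpret finite_measure unit_lborel by (rule finite_measure_unit_lborel)
  have "norm (integral\<^sup>L unit_lborel f) \<le> (\<integral>\<theta>. norm (f \<theta>) \<partial>unit_lborel)"
    by (rule integral_norm_bound)
  also have "\<dots> \<le> (\<integral>\<theta>. K \<partial>unit_lborel)"
    using integrable_unit_lborel[OF assms] assms(2)
    by (intro integral_mono) (auto simp: space_restrict_space)
  also have "\<dots> = K" using measure_unit_lborel by simp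
  finally show ?thesis .
qed

lemma circlepath_turn: "circlepath z r \<theta> = z + of_real r * turn \<theta>"
  by (simp add: circlepath turn_def)

text \<open>The speed of \<open>circlepath\<close> is 2 pi i r \<open>turn \<theta>\<close>, which
  accounts for the normalization by 2 pi i.\<close>

lemma contour_integral_circlepath_unit_lborel:
  assumes "(g has_contour_integral I) (circlepath z r)"
    and "continuous_on {0..1} (\<lambda>\<theta>. g (z + of_real r * turn \<theta>))"
  shows "(\<integral>\<theta>. of_real r * turn \<theta> * g (z + of_real r * turn \<theta>) \<partial>unit_lborel) = I / (2 * of_real pi * \<i>)"
proof -
  let ?h = "\<lambda>\<theta>. of_real r * turn \<theta> * g (z + of_real r * turn \<theta>)"
  have "((\<lambda>\<theta>. g (circlepath z r \<theta>) * vector_derivative (circlepath z r) (at \<theta> within {0..1})) has_integral I) {0..1}"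
    using assms(1) by (simp add: has_contour_integral_def)
  hence "((\<lambda>\<theta>. (2 * of_real pi * \<i>) * ?h \<theta>) has_integral I) {0..1}"
    by (rule has_integral_eq[rotated])
       (simp add: vector_derivative_circlepath01 circlepath_turn turn_def)
  hence hI: "(?h has_integral I / (2 * of_real pi * \<i>)) {0..1}"
    using has_integral_mult_right_iff[of "2 * of_real pi * \<i>" ?h I "{0..1}"] by simp
  have "continuous_on {0..1} ?h" by (intro continuous_intros assms(2))
  hence si: "set_integrable lborel {0..1} ?h" by (rule borel_integrable_atLeastAtMost')
  have "(\<integral>\<theta>. ?h \<theta> \<partial>unit_lborel) = (LINT \<theta>:{0..1}|lborel. ?h \<theta>)"
    by (simp add: integral_restrict_space set_lebesgue_integral_def)
  also have "\<dots> = integral {0..1} ?h" using set_borel_integral_eq_integral(2)[OF si] .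
  also have "\<dots> = I / (2 * of_real pi * \<i>)" using hI by (rule integral_unique)
  finally show ?thesis .
qed

text \<open>Continuity on the closed disc is all that is asked at the boundary: the functions
  \<open>q m\<close> below are only known to be continuous at the boundary point 0.\<close>

lemma Cauchy_formula_unit_lborel:
  assumes g: "continuous_on (cball z r) g" "g holomorphic_on ball z r" and w: "w \<in> ball z r"
  shows "(\<integral>\<theta>. of_real r * turn \<theta> * (g (z + of_real r * turn \<theta>) / (z + of_real r * turn \<theta> - w)) \<partial>unit_lborel) = g w"
proof -
  have r: "r > 0" using w by (metis ball_eq_empty empty_iff not_le)
  have "((\<lambda>u. g u / (u - w)) has_contour_integral 2 * of_real pi * \<i> * g w) (circlepath z r)"
    using Cauchy_integral_circlepath[OF g] w by (simp add: dist_norm norm_minus_commute)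
  moreover have "continuous_on {0..1} (\<lambda>\<theta>. g (z + of_real r * turn \<theta>) / (z + of_real r * turn \<theta> - w))"
  proof (intro continuous_intros continuous_on_compose2[OF g(1)] ballI)
    show "(\<lambda>\<theta>. z + of_real r * turn \<theta>) ` {0..1} \<subseteq> cball z r"
      using r by (auto simp: dist_norm norm_mult)
    show "z + of_real r * turn \<theta> - w \<noteq> 0" for \<theta>
    proof
      assume "z + of_real r * turn \<theta> - w = 0"
      hence "w = z + of_real r * turn \<theta>" by (simp add: algebra_simps)
      thus False using w r by (simp add: dist_norm norm_mult)
    qed
  qed
  ultimately show ?thesis
    by (subst contour_integral_circlepath_unit_lborel) auto
qed

text \<open>Cauchy's formula at the centre for \<open>g u * (u - z)\<close>, which vanishes
  there.\<close>

lemma Cauchy_theorem_unit_lborel: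
  assumes g: "continuous_on (cball z r) g" "g holomorphic_on ball z r" and r: "r > 0"
  shows "(\<integral>\<theta>. of_real r * turn \<theta> * g (z + of_real r * turn \<theta>) \<partial>unit_lborel) = 0"
proof -
  have "(\<integral>\<theta>. of_real r * turn \<theta> * ((g (z + of_real r * turn \<theta>) * (z + of_real r * turn \<theta> - z))
      / (z + of_real r * turn \<theta> - z)) \<partial>unit_lborel) = g z * (z - z)"
    using r by (intro Cauchy_formula_unit_lborel[of z r "\<lambda>u. g u * (u - z)" z] continuous_intros holomorphic_intros g) auto
  thus ?thesis using r by simp
qed

text \<open>Inversion maps the closed disc of radius 1 around 1, without 0, to the half-plane Re
  \<ge> 1/2.\<close>

lemma Re_inverse_one_plus_ge:
  assumes "norm v \<le> 1" "v \<noteq> -1" shows "Re (1 / (1 + v)) \<ge> 1/2"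
proof -
  have "1 + v \<noteq> 0" using assms(2) by (metis add.inverse_unique)
  hence p: "(1 + Re v)\<^sup>2 + (Im v)\<^sup>2 > 0" using cmod_power2[of "1 + v"] by (metis zero_less_norm_iff zero_less_power plus_complex.sel one_complex.sel add_0)
  have "(norm v)\<^sup>2 \<le> 1" using assms(1) by (simp add: power_le_one)
  hence "(Re v)\<^sup>2 + (Im v)\<^sup>2 \<le> 1" by (simp add: cmod_power2)
  hence "(1 + Re v)\<^sup>2 + (Im v)\<^sup>2 \<le> 2 * (1 + Re v)" by (simp add: power2_eq_square algebra_simps)
  hence "1/2 \<le> (1 + Re v) / ((1 + Re v)\<^sup>2 + (Im v)\<^sup>2)" using p by (simp add: le_divide_eq)
  thus ?thesis by (simp add: Re_divide)
qed

text \<open>On the circle, \<open>exp (c / (1 + z))\<close> has an essential singularity; it is bounded on the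
  exterior, where its residue at infinity gives \<open>c\<close>. The exterior is mapped to the unit disc
  by \<open>v = 1 / z\<close>.\<close>
lemma integral_exp_circle:
  assumes c: "(c::real) \<ge> 0"
  shows "(\<integral>\<theta>. turn \<theta> * exp (of_real c / (1 + turn \<theta>)) \<partial>unit_lborel) = of_real c"
proof -
  define f where "f = (\<lambda>v::complex. exp (of_real c * v / (1 + v)))"
  \<comment> \<open>The shift by 2 keeps \<open>\<rho> n\<close> at least 1/2, so that dividing by
    it costs at most a factor 2 in the dominating function.\<close>
  define \<rho> where "\<rho> = (\<lambda>n. 1 - 1 / real (n + 2))"
  have \<rho>: "0 < \<rho> n" "\<rho> n < 1" for n by (auto simp: \<rho>_def field_simps)
  have nz: "1 + v \<noteq> 0" if "norm v < 1" for v :: complex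
    using that by (metis add.inverse_unique norm_minus_cancel norm_one order_less_irrefl)
  have hol: "f holomorphic_on ball 0 1"
    unfolding f_def by (intro holomorphic_intros) (use nz in auto)
  have "(f has_field_derivative of_real c) (at 0)"
    unfolding f_def by (auto intro!: derivative_eq_intros)
  hence df: "deriv f 0 = of_real c" by (rule DERIV_imp_deriv)
  \<comment> \<open>Re (v/(1+v)) = 1 - Re (1/(1+v)) is at most 1/2. At v = -1 the quotient is 0 by
    the convention for division by zero, and the bound persists since c \<ge> 0.\<close>
  have bound: "norm (f v) \<le> exp (c / 2)" if "norm v \<le> 1" for v
  proof (cases "v = -1")
    case False
    hence n0: "1 + v \<noteq> 0" by (metis add.inverse_unique)
    have "of_real c * v / (1 + v) = of_real c * (1 - 1 / (1 + v))"
      using n0 by (simp add: field_simps)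
    hence "Re (of_real c * v / (1 + v)) = c * (1 - Re (1 / (1 + v)))"
      by (simp del: Re_divide_of_real)
    also have "\<dots> \<le> c * (1/2)"
      using Re_inverse_one_plus_ge[OF that False] c by (intro mult_left_mono) auto
    finally show ?thesis by (simp add: f_def)
  qed (use c in \<open>simp add: f_def\<close>)
  \<comment> \<open>Cauchy's formula for f'(0) = c on circles inside the disc of holomorphy;
    dominated convergence then lets the radii increase to 1.\<close>
  have eq: "(\<integral>\<theta>. f (of_real (\<rho> n) * turn \<theta>) / (of_real (\<rho> n) * turn \<theta>) \<partial>unit_lborel) = of_real c" for n
  proof -
    have hol': "f holomorphic_on cball 0 (\<rho> n)"
      using hol by (rule holomorphic_on_subset) (use \<rho>[of n] in auto)
    have "((\<lambda>u. f u / (u - 0) ^ Suc 1) has_contour_integral (2 * of_real pi) * \<i> / fact 1 * (deriv ^^ 1) f 0)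
        (circlepath 0 (\<rho> n))"
      using Cauchy_has_contour_integral_higher_derivative_circlepath[of 0 "\<rho> n" f 0 1] \<rho>[of n]
        holomorphic_on_imp_continuous_on[OF hol'] holomorphic_on_subset[OF hol' ball_subset_cball]
      by simp
    moreover have "continuous_on {0..1} (\<lambda>\<theta>. f (0 + of_real (\<rho> n) * turn \<theta>) / (0 + of_real (\<rho> n) * turn \<theta> - 0) ^ Suc 1)"
      using \<rho>[of n] by (intro continuous_intros continuous_on_compose2[OF holomorphic_on_imp_continuous_on[OF hol']])
        (auto simp: norm_mult)
    ultimately have "(\<integral>\<theta>. of_real (\<rho> n) * turn \<theta> * (f (0 + of_real (\<rho> n) * turn \<theta>) / (0 + of_real (\<rho> n) * turn \<theta> - 0) ^ Suc 1) \<partial>unit_lborel)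
       = (2 * of_real pi) * \<i> / fact 1 * (deriv ^^ 1) f 0 / (2 * of_real pi * \<i>)"
      by (rule contour_integral_circlepath_unit_lborel)
    thus ?thesis using \<rho>[of n] df by (simp add: power2_eq_square)
  qed
  have [measurable]: "f \<in> borel_measurable borel" unfolding f_def by measurable
  have \<rho>_lim: "\<rho> \<longlonglongrightarrow> 1"
  proof -
    have "(\<lambda>n. 1 - inverse (real (Suc (Suc n)))) \<longlonglongrightarrow> 1 - 0"
      by (intro tendsto_intros LIMSEQ_Suc[OF LIMSEQ_inverse_real_of_nat])
    thus ?thesis by (simp add: \<rho>_def inverse_eq_divide add.commute)
  qed
  have "(\<lambda>n. \<integral>\<theta>. f (of_real (\<rho> n) * turn \<theta>) / (of_real (\<rho> n) * turn \<theta>) \<partial>unit_lborel) \<longlonglongrightarrow>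
     (\<integral>\<theta>. f (turn \<theta>) / turn \<theta> \<partial>unit_lborel)"
  proof (rule integral_dominated_convergence[where w = "\<lambda>_. 2 * exp (c/2)"])
    show "integrable unit_lborel (\<lambda>_. 2 * exp (c/2))"
      using finite_measure.integrable_const[OF finite_measure_unit_lborel] by blast
    show "(\<lambda>\<theta>. f (turn \<theta>) / turn \<theta>) \<in> borel_measurable unit_lborel"
      "(\<lambda>\<theta>. f (of_real (\<rho> n) * turn \<theta>) / (of_real (\<rho> n) * turn \<theta>)) \<in> borel_measurable unit_lborel" for n
      by (intro measurable_restrict_space1; measurable)+
    show "AE \<theta> in unit_lborel. (\<lambda>n. f (of_real (\<rho> n) * turn \<theta>) / (of_real (\<rho> n) * turn \<theta>)) \<longlonglongrightarrow> f (turn \<theta>) / turn \<theta>"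
    proof (rule AE_unit_lborel)
      fix \<theta> :: real assume "\<theta> \<in> {0..1}" "\<theta> \<noteq> 1/2"
      hence "1 + turn \<theta> \<noteq> 0" using turn_ne_minus_1 by (metis add.inverse_unique)
      hence "isCont f (turn \<theta>)" unfolding f_def by (intro continuous_intros) auto
      moreover have l: "(\<lambda>n. of_real (\<rho> n) * turn \<theta>) \<longlonglongrightarrow> of_real 1 * turn \<theta>"
        by (intro tendsto_intros \<rho>_lim)
      ultimately have "(\<lambda>n. f (of_real (\<rho> n) * turn \<theta>)) \<longlonglongrightarrow> f (turn \<theta>)"
        by (auto intro: isCont_tendsto_compose)
      thus "(\<lambda>n. f (of_real (\<rho> n) * turn \<theta>) / (of_real (\<rho> n) * turn \<theta>)) \<longlonglongrightarrow> f (turn \<theta>) / turn \<theta>"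
        using l by (intro tendsto_divide) auto
    qed
    show "AE \<theta> in unit_lborel. norm (f (of_real (\<rho> n) * turn \<theta>) / (of_real (\<rho> n) * turn \<theta>)) \<le> 2 * exp (c/2)" for n
    proof (rule AE_I2)
      fix \<theta>
      have "\<rho> n \<ge> 1/2" by (simp add: \<rho>_def field_simps)
      hence "1 / \<rho> n \<le> 2" using \<rho>[of n] by (simp add: field_simps)
      moreover have "norm (f (of_real (\<rho> n) * turn \<theta>)) \<le> exp (c/2)"
        by (rule bound) (use \<rho>[of n] in \<open>simp add: norm_mult\<close>)
      ultimately have "(1 / \<rho> n) * norm (f (of_real (\<rho> n) * turn \<theta>)) \<le> 2 * exp (c/2)"
        using \<rho>[of n] by (intro mult_mono) auto
      thus "norm (f (of_real (\<rho> n) * turn \<theta>) / (of_real (\<rho> n) * turn \<theta>)) \<le> 2 * exp (c/2)"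
        using \<rho>[of n] by (simp add: norm_divide norm_mult)
    qed
  qed
  hence lim: "(\<integral>\<theta>. f (turn \<theta>) / turn \<theta> \<partial>unit_lborel) = of_real c"
    unfolding eq using LIMSEQ_unique tendsto_const by blast
  \<comment> \<open>On the unit circle conjugation is inversion, so v = cnj (turn \<theta>)
    satisfies v/(1+v) = 1/(1 + turn \<theta>). As c is real, the wanted integral is the conjugate of
    the computed one.\<close>
  have "turn \<theta> * exp (of_real c / (1 + turn \<theta>)) = cnj (f (turn \<theta>) / turn \<theta>)" for \<theta>
  proof -
    have "turn \<theta> * cnj (turn \<theta>) = 1" by (simp add: complex_norm_square[symmetric])
    hence i: "cnj (turn \<theta>) = inverse (turn \<theta>)" by (metis inverse_unique)
    have "cnj (turn \<theta>) / (1 + cnj (turn \<theta>)) = 1 / (1 + turn \<theta>)"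
      unfolding i by (cases "1 + turn \<theta> = 0") (auto simp: field_simps add_eq_0_iff)
    hence "of_real c * cnj (turn \<theta>) / (1 + cnj (turn \<theta>)) = of_real c / (1 + turn \<theta>)"
      by (metis times_divide_eq_right mult.right_neutral)
    hence "cnj (f (turn \<theta>)) = exp (of_real c / (1 + turn \<theta>))" by (simp add: f_def exp_cnj)
    hence "cnj (f (turn \<theta>) / turn \<theta>) = exp (of_real c / (1 + turn \<theta>)) / inverse (turn \<theta>)" by (simp add: i)
    thus ?thesis by (simp add: divide_inverse mult.commute)
  qed
  hence "(\<integral>\<theta>. turn \<theta> * exp (of_real c / (1 + turn \<theta>)) \<partial>unit_lborel) = (\<integral>\<theta>. cnj (f (turn \<theta>) / turn \<theta>) \<partial>unit_lborel)"
    by simp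
  also have "\<dots> = cnj (of_real c)" unfolding lim[symmetric] by (simp only: Bochner_Integration.integral_cnj)
  finally show ?thesis by simp
qed

section \<open>The Borel transform as a circle integral\<close>

lemma mem_tangent_ball_iff: "r > 0 \<Longrightarrow> z \<in> ball (of_real (r/2)) (r/2) \<longleftrightarrow> (norm z)\<^sup>2 < r * Re z" (is "_ \<Longrightarrow> ?L1")
  and mem_tangent_cball_iff: "r > 0 \<Longrightarrow> z \<in> cball (of_real (r/2)) (r/2) \<longleftrightarrow> (norm z)\<^sup>2 \<le> r * Re z" (is "_ \<Longrightarrow> ?L2")
proof -
  assume that: "r > 0"
  have eq: "(norm (of_real (r/2) - z))\<^sup>2 = (norm z)\<^sup>2 - r * Re z + (r/2)\<^sup>2"
    unfolding cmod_power2 by (simp add: power2_eq_square field_simps)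
  have "norm (of_real (r/2) - z) < r/2 \<longleftrightarrow> (norm (of_real (r/2) - z))\<^sup>2 < (r/2)\<^sup>2"
    using that by (metis abs_of_pos half_gt_zero norm_ge_zero power2_less_imp_less power_strict_mono pos2 less_imp_le)
  thus "z \<in> ball (of_real (r/2)) (r/2) \<longleftrightarrow> (norm z)\<^sup>2 < r * Re z" unfolding eq by (simp add: dist_norm)
next
  assume that: "r > 0"
  have eq: "(norm (of_real (r/2) - z))\<^sup>2 = (norm z)\<^sup>2 - r * Re z + (r/2)\<^sup>2"
    unfolding cmod_power2 by (simp add: power2_eq_square field_simps)
  have "norm (of_real (r/2) - z) \<le> r/2 \<longleftrightarrow> (norm (of_real (r/2) - z))\<^sup>2 \<le> (r/2)\<^sup>2"
    using that by (metis half_gt_zero norm_ge_zero power2_le_imp_le power_mono less_imp_le)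
  thus "z \<in> cball (of_real (r/2)) (r/2) \<longleftrightarrow> (norm z)\<^sup>2 \<le> r * Re z" unfolding eq by (simp add: dist_norm)
qed

text \<open>The two circles touch only at 0. Hence a function known on the larger open disc can be
  integrated over the smaller circle, with the single exceptional point 0.\<close>

lemma tangent_cball_subset:
  fixes z :: complex
  assumes "0 < r" "r < R" "z \<in> cball (of_real (r/2)) (r/2)" "z \<noteq> 0"
  shows "z \<in> ball (of_real (R/2)) (R/2)"
proof -
  have "(norm z)\<^sup>2 \<le> r * Re z" using assms mem_tangent_cball_iff by blast
  moreover have "(norm z)\<^sup>2 > 0" using assms by simp
  ultimately have "Re z > 0" using assms by (smt (verit) zero_less_mult_pos)
  hence "r * Re z < R * Re z" using assms by simp
  hence "(norm z)\<^sup>2 < R * Re z" using \<open>(norm z)\<^sup>2 \<le> r * Re z\<close> by linarith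
  thus ?thesis using assms mem_tangent_ball_iff by auto
qed

lemma zero_notin_tangent_ball: "(0::complex) \<notin> ball (of_real (r/2)) (r/2)"
  by (auto simp: dist_norm norm_divide)

text \<open>The time t is frozen and only the right-hand disc is considered; the left-hand disc is
  reached later by reflection.\<close>

locale gevrey_expansion =
  fixes R A \<sigma> :: real and a :: "nat \<Rightarrow> complex" and F :: "complex \<Rightarrow> complex"
  assumes R_pos: "R > 0" and A_pos: "A > 0" and \<sigma>_pos: "\<sigma> > 0"
    and holomorphic: "F holomorphic_on ball (of_real (R/2)) (R/2)"
    and remainder_bound: "\<And>N \<epsilon>. \<epsilon> \<in> ball (of_real (R/2)) (R/2) \<Longrightarrow>
      norm (F \<epsilon> - (\<Sum>k<N. \<epsilon> ^ k * a k)) \<le> A * \<sigma> ^ N * fact N * norm \<epsilon> ^ N"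
begin

text \<open>The value at 0 is the limit of the quotient within the disc. With it
  \<open>q_step\<close> holds at 0 as well, and \<open>q m\<close> becomes continuous on the smaller
  closed discs.\<close>

definition q :: "nat \<Rightarrow> complex \<Rightarrow> complex" where
  "q m \<epsilon> = (if \<epsilon> = 0 then a (Suc m) else (F \<epsilon> - (\<Sum>k<Suc m. \<epsilon> ^ k * a k)) / \<epsilon> ^ Suc m)"

definition Q :: "nat \<Rightarrow> real" where
  "Q m = A * \<sigma> ^ Suc m * fact (Suc m)"

lemma Q_pos: "Q m > 0"
  using A_pos \<sigma>_pos by (simp add: Q_def del: fact_Suc)

lemma q_step: "q m \<epsilon> = a (Suc m) + \<epsilon> * q (Suc m) \<epsilon>"
  by (simp add: q_def field_simps)

lemma F_eq: "\<epsilon> \<noteq> 0 \<Longrightarrow> F \<epsilon> = a 0 + \<epsilon> * q 0 \<epsilon>"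
  by (simp add: q_def)

lemma norm_q_le:
  assumes "\<epsilon> \<in> ball (of_real (R/2)) (R/2)" shows "norm (q m \<epsilon>) \<le> Q m"
proof -
  have nz: "\<epsilon> \<noteq> 0" using assms zero_notin_tangent_ball by blast
  show ?thesis using remainder_bound[OF assms, of "Suc m"] nz
    by (simp add: q_def Q_def norm_divide norm_power divide_le_eq del: sum.lessThan_Suc fact_Suc power_Suc)
qed

text \<open>\<epsilon>^m a_m is the difference of two consecutive remainders; after division by
  \<epsilon>^m the later one is O(\<epsilon>) and disappears as \<epsilon> tends to 0.\<close>

lemma norm_a_le: "norm (a m) \<le> A * \<sigma> ^ m * fact m"
proof (rule field_le_epsilon)
  fix e :: real assume e: "e > 0"
  \<comment> \<open>Real points of (0, R) lie in the disc; the second entry makes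
    \<open>Q m * norm \<epsilon>\<close> at most e.\<close>
  define \<epsilon> where "\<epsilon> = complex_of_real (min (R/2) (e / Q m))"
  have pos: "min (R/2) (e / Q m) > 0" using R_pos e Q_pos by simp
  have ne: "norm \<epsilon> = min (R/2) (e / Q m)" unfolding \<epsilon>_def norm_of_real using pos by linarith
  have "min (R/2) (e / Q m) * min (R/2) (e / Q m) < R * min (R/2) (e / Q m)"
    using pos R_pos by (intro mult_strict_right_mono) auto
  hence in_ball: "\<epsilon> \<in> ball (of_real (R/2)) (R/2)"
    unfolding mem_tangent_ball_iff[OF R_pos] ne by (simp add: \<epsilon>_def power2_eq_square)
  have nz: "\<epsilon> \<noteq> 0" using ne pos by force
  have "\<epsilon> ^ m * a m = (F \<epsilon> - (\<Sum>k<m. \<epsilon> ^ k * a k)) - (F \<epsilon> - (\<Sum>k<Suc m. \<epsilon> ^ k * a k))" by simp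
  hence "norm (\<epsilon> ^ m * a m) \<le> norm (F \<epsilon> - (\<Sum>k<m. \<epsilon> ^ k * a k)) + norm (F \<epsilon> - (\<Sum>k<Suc m. \<epsilon> ^ k * a k))"
    by (metis norm_triangle_ineq4)
  also have "\<dots> \<le> A * \<sigma> ^ m * fact m * norm \<epsilon> ^ m + Q m * norm \<epsilon> ^ Suc m"
    unfolding Q_def by (intro add_mono remainder_bound in_ball)
  also have "\<dots> = norm \<epsilon> ^ m * (A * \<sigma> ^ m * fact m + Q m * norm \<epsilon>)" by (simp add: algebra_simps)
  finally have "norm \<epsilon> ^ m * norm (a m) \<le> norm \<epsilon> ^ m * (A * \<sigma> ^ m * fact m + Q m * norm \<epsilon>)"
    by (simp add: norm_mult norm_power)
  hence "norm (a m) \<le> A * \<sigma> ^ m * fact m + Q m * norm \<epsilon>" using nz by (simp add: mult_le_cancel_left)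
  also have "Q m * norm \<epsilon> \<le> Q m * (e / Q m)" unfolding ne using Q_pos[of m] by (intro mult_left_mono) auto
  also have "\<dots> = e" using Q_pos[of m] by simp
  finally show "norm (a m) \<le> A * \<sigma> ^ m * fact m + e" by simp
qed

lemma norm_q_le_cball:
  assumes "0 < r" "r < R" "\<epsilon> \<in> cball (of_real (r/2)) (r/2)" shows "norm (q m \<epsilon>) \<le> Q m"
proof (cases "\<epsilon> = 0")
  case True
  thus ?thesis using norm_a_le[of "Suc m"] unfolding q_def Q_def by simp
next
  case False
  thus ?thesis using tangent_cball_subset[OF assms] norm_q_le by blast
qed

lemma q_holomorphic: "q m holomorphic_on ball (of_real (R/2)) (R/2)"
proof -
  have "(\<lambda>\<epsilon>. (F \<epsilon> - (\<Sum>k<Suc m. \<epsilon> ^ k * a k)) / \<epsilon> ^ Suc m) holomorphic_on ball (of_real (R/2)) (R/2)"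
    by (intro holomorphic_intros holomorphic) (use zero_notin_tangent_ball in auto)
  thus ?thesis
    by (rule holomorphic_transform) (use zero_notin_tangent_ball in \<open>auto simp: q_def\<close>)
qed

lemma tangent_ball_subset:
  "0 < r \<Longrightarrow> r < R \<Longrightarrow> ball (of_real (r/2)) (r/2) \<subseteq> ball (of_real (R/2) :: complex) (R/2)"
  using tangent_cball_subset zero_notin_tangent_ball ball_subset_cball by blast

lemma q_continuous:
  assumes "0 < r" "r < R" shows "continuous_on (cball (of_real (r/2)) (r/2)) (q m)"
  unfolding continuous_on_eq_continuous_within
proof
  fix \<epsilon> assume \<epsilon>: "\<epsilon> \<in> cball (complex_of_real (r/2)) (r/2)"
  show "continuous (at \<epsilon> within cball (complex_of_real (r/2)) (r/2)) (q m)"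
  proof (cases "\<epsilon> = 0")
    case False
    hence "\<epsilon> \<in> ball (of_real (R/2)) (R/2)" using tangent_cball_subset assms \<epsilon> by blast
    hence "isCont (q m) \<epsilon>"
      using holomorphic_on_imp_continuous_on[OF q_holomorphic] continuous_on_eq_continuous_at[OF open_ball] by blast
    thus ?thesis by (rule continuous_at_imp_continuous_at_within)
  next
    case True
    \<comment> \<open>By \<open>q_step\<close> the difference is u times \<open>q (Suc m) u\<close>,
      and \<open>q (Suc m)\<close> is bounded on the closed disc.\<close>
    have "((\<lambda>u. q m u - q m 0) \<longlongrightarrow> 0) (at 0 within cball (complex_of_real (r/2)) (r/2))"
    proof (rule Lim_null_comparison)
      show "\<forall>\<^sub>F u in at 0 within cball (of_real (r/2)) (r/2). norm (q m u - q m 0) \<le> norm u * Q (Suc m)"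
      proof (rule eventually_at_topological[THEN iffD2], intro exI[of _ UNIV] conjI ballI impI)
        fix u :: complex assume "u \<in> cball (of_real (r/2)) (r/2)"
        hence "norm (u * q (Suc m) u) \<le> norm u * Q (Suc m)"
          unfolding norm_mult by (intro mult_left_mono norm_q_le_cball[OF assms]) auto
        thus "norm (q m u - q m 0) \<le> norm u * Q (Suc m)"
          using q_step[of m u] by (simp add: q_def)
      qed auto
      show "((\<lambda>u. norm u * Q (Suc m)) \<longlongrightarrow> 0) (at 0 within cball (complex_of_real (r/2)) (r/2))"
        by (rule tendsto_eq_intros refl | simp)+
    qed
    thus ?thesis using True by (simp add: continuous_within LIM_zero_iff)
  qed
qed

definition circ :: "real \<Rightarrow> real \<Rightarrow> complex" where
  "circ r \<theta> = of_real (r/2) + of_real (r/2) * turn \<theta>"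

lemma circ_in_cball: "r > 0 \<Longrightarrow> circ r \<theta> \<in> cball (of_real (r/2)) (r/2)"
  by (simp add: circ_def dist_norm norm_mult norm_divide)

lemma circ_eq: "circ r \<theta> = of_real (r/2) * (1 + turn \<theta>)"
  by (simp add: circ_def algebra_simps)

lemma circ_nonzero: "r > 0 \<Longrightarrow> \<theta> \<in> {0..1} \<Longrightarrow> \<theta> \<noteq> 1/2 \<Longrightarrow> circ r \<theta> \<noteq> 0"
  using turn_ne_minus_1[of \<theta>] by (simp add: circ_eq add_eq_0_iff)

text \<open>The circle has the equation |z|^2 = r Re z, and Re (1/z) = Re z / |z|^2.\<close>

lemma Re_inverse_circ: "r > 0 \<Longrightarrow> circ r \<theta> \<noteq> 0 \<Longrightarrow> Re (1 / circ r \<theta>) = 1 / r"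
proof -
  assume r: "r > 0" and nz: "circ r \<theta> \<noteq> 0"
  have n: "(Re (turn \<theta>))\<^sup>2 + (Im (turn \<theta>))\<^sup>2 = 1"
    using norm_turn[of \<theta>] by (metis cmod_power2 one_power2)
  have e: "(norm (circ r \<theta>))\<^sup>2 = r * Re (circ r \<theta>)"
  proof -
    have "(norm (circ r \<theta>))\<^sup>2 = (r/2)\<^sup>2 * ((Re (turn \<theta>))\<^sup>2 + (Im (turn \<theta>))\<^sup>2 + 2 * Re (turn \<theta>) + 1)"
      unfolding cmod_power2 by (simp add: circ_def power2_eq_square algebra_simps add_divide_distrib)
    thus ?thesis unfolding n by (simp add: circ_def power2_eq_square algebra_simps)
  qed
  moreover have "(norm (circ r \<theta>))\<^sup>2 > 0" using nz by simp
  ultimately have "Re (circ r \<theta>) \<noteq> 0" by auto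
  thus ?thesis using e r by (simp add: Re_divide cmod_power2[symmetric])
qed

lemma circ_measurable [measurable]: "circ r \<in> borel_measurable borel"
  unfolding circ_def by measurable

lemma q_circ_measurable:
  assumes "0 < r" "r < R" shows "(\<lambda>\<theta>. q m (circ r \<theta>)) \<in> borel_measurable borel"
proof (intro borel_measurable_continuous_onI continuous_on_compose2[OF q_continuous[OF assms]])
  show "continuous_on UNIV (circ r)" unfolding circ_def by (intro continuous_intros)
qed (use circ_in_cball[OF assms(1)] in auto)

text \<open>Formally the m-th derivative of the inverse Laplace transform of \<epsilon> F, with
  d\<epsilon>/(2 pi i) = (r/2) \<open>turn \<theta>\<close> d\<theta>. The terms a_k with k \<le> m
  are kept out of the integral because \<epsilon>^(k-m-1) is unbounded at 0; formally the one with k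
  = m contributes a_m and those with k < m contribute nothing.\<close>

definition b :: "real \<Rightarrow> nat \<Rightarrow> real \<Rightarrow> complex" where
  "b r m s = a m + (\<integral>\<theta>. of_real (r/2) * turn \<theta> * (exp (of_real s / circ r \<theta>) * q m (circ r \<theta>)) \<partial>unit_lborel)"

lemma norm_exp_circ:
  assumes "r > 0" "s \<ge> 0" shows "norm (exp (of_real s / circ r \<theta>)) \<le> exp (s / r)"
proof (cases "circ r \<theta> = 0")
  case False
  have "of_real s / circ r \<theta> = of_real s * (1 / circ r \<theta>)" by simp
  hence "Re (of_real s / circ r \<theta>) = s * Re (1 / circ r \<theta>)" by (metis Re_complex_of_real Im_complex_of_real mult_zero_left diff_zero times_complex.sel(1))
  thus ?thesis using Re_inverse_circ[OF assms(1) False] by simp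
qed (use assms in simp)

lemma integrand_bound:
  assumes "0 < r" "r < R" "s \<ge> 0"
  shows "norm (of_real (r/2) * turn \<theta> * (exp (of_real s / circ r \<theta>) * q m (circ r \<theta>))) \<le> r/2 * (exp (s/r) * Q m)"
proof -
  have "norm (exp (of_real s / circ r \<theta>)) * norm (q m (circ r \<theta>)) \<le> exp (s/r) * Q m"
    by (intro mult_mono norm_exp_circ norm_q_le_cball[OF assms(1,2)] circ_in_cball) (use assms in auto)
  thus ?thesis using assms by (simp add: norm_mult norm_divide)
qed

lemma norm_b_le:
  assumes "0 < r" "r < R" "s \<ge> 0"
  shows "norm (b r m s - a m) \<le> r/2 * (exp (s/r) * Q m)"
proof -
  have [measurable]: "(\<lambda>\<theta>. q m (circ r \<theta>)) \<in> borel_measurable borel" using assms q_circ_measurable by blast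
  show ?thesis unfolding b_def add_diff_cancel_left'
    by (rule norm_integral_unit_lborel_le[OF _ integrand_bound[OF assms]], rule measurable_restrict_space1) measurable
qed

lemma integral_q: "0 < r \<Longrightarrow> r < R \<Longrightarrow> (\<integral>\<theta>. of_real (r/2) * turn \<theta> * q m (circ r \<theta>) \<partial>unit_lborel) = 0"
  unfolding circ_def
  by (intro Cauchy_theorem_unit_lborel q_continuous holomorphic_on_subset[OF q_holomorphic] tangent_ball_subset) auto

lemma integral_1: "(\<integral>\<theta>. of_real (r/2) * turn \<theta> \<partial>unit_lborel) = 0" if "0 < r"
  using Cauchy_theorem_unit_lborel[of "of_real (r/2)" "r/2" "\<lambda>_. 1"] that by simp

text \<open>This is the classical inverse Laplace transform of p^(-2), with p = 1/\<epsilon>. On the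
  circle s/\<epsilon> = (2s/r)/(1 + \<open>turn \<theta>\<close>), which reduces it to
  \<open>integral_exp_circle\<close>.\<close>

lemma integral_exp_circ: 
  assumes "0 < r" "s \<ge> 0"
  shows "(\<integral>\<theta>. of_real (r/2) * turn \<theta> * exp (of_real s / circ r \<theta>) \<partial>unit_lborel) = of_real s"
proof -
  have "of_real s / circ r \<theta> = of_real (2 * s / r) / (1 + turn \<theta>)" for \<theta>
    using assms by (simp add: circ_eq field_simps)
  hence "(\<integral>\<theta>. of_real (r/2) * turn \<theta> * exp (of_real s / circ r \<theta>) \<partial>unit_lborel) =
     (\<integral>\<theta>. of_real (r/2) * (turn \<theta> * exp (of_real (2 * s / r) / (1 + turn \<theta>))) \<partial>unit_lborel)" by (simp add: mult.assoc)
  also have "\<dots> = of_real (r/2) * of_real (2 * s / r)"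
    unfolding integral_mult_right_zero by (subst integral_exp_circle) (use assms in auto)
  also have "\<dots> = of_real s" using assms by simp
  finally show ?thesis .
qed

lemma integral_exp_linear:
  assumes "z \<noteq> 0" "s \<ge> 0"
  shows "(\<integral>u. exp (of_real u * z) \<partial>restrict_space lborel {0..s}) = (exp (of_real s * z) - 1) / (z::complex)"
proof -
  have c: "continuous_on {0..s} (\<lambda>u. exp (of_real u * z))" by (intro continuous_intros)
  have si: "set_integrable lborel {0..s} (\<lambda>u. exp (of_real u * z))"
    by (rule borel_integrable_atLeastAtMost'[OF c])
  have "((\<lambda>u. exp (of_real u * z)) has_integral (exp (of_real s * z) / z - exp (of_real 0 * z) / z)) {0..s}"
    by (rule fundamental_theorem_of_calculus[OF assms(2)])
       (auto intro!: derivative_eq_intros has_vector_derivative_real_field simp: assms)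
  hence "integral {0..s} (\<lambda>u. exp (of_real u * z)) = (exp (of_real s * z) - 1) / z"
    by (simp add: integral_unique diff_divide_distrib)
  thus ?thesis using set_borel_integral_eq_integral(2)[OF si]
    by (simp add: integral_restrict_space set_lebesgue_integral_def)
qed

text \<open>Fubini on [0,s] times the circle. It serves two values of w: w = 0 shows that
  \<open>b r m\<close> is an antiderivative of \<open>b r (Suc m)\<close>, and w = 1/\<epsilon>
  leads to the Laplace transform.\<close>

lemma b_laplace_finite:
  assumes r: "0 < r" "r < R" and s: "s \<ge> 0"
    and w: "\<And>\<theta>. circ r \<theta> \<noteq> 0 \<Longrightarrow> 1 / circ r \<theta> \<noteq> w"
  shows "((\<lambda>u. exp (- (of_real u * w)) * (b r m u - a m)) has_integral
    (\<integral>\<theta>. of_real (r/2) * turn \<theta> * (q m (circ r \<theta>) *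
       ((exp (of_real s * (1 / circ r \<theta> - w)) - 1) / (1 / circ r \<theta> - w))) \<partial>unit_lborel)) {0..s}"
proof -
  let ?J = "\<lambda>\<theta>. of_real (r/2) * turn \<theta> * (q m (circ r \<theta>) *
       ((exp (of_real s * (1 / circ r \<theta> - w)) - 1) / (1 / circ r \<theta> - w)))"
  let ?N = "restrict_space lborel {0..s}"
  let ?M = unit_lborel
  \<comment> \<open>Merging the two exponentials makes the inner integral over u elementary.\<close>
  define g where "g = (\<lambda>u \<theta>. of_real (r/2) * turn \<theta> * (q m (circ r \<theta>) * exp (of_real u * (1 / circ r \<theta> - w))))"
  interpret N: finite_measure ?N
    by (rule finite_measureI) (use s in \<open>simp add: emeasure_restrict_space space_restrict_space\<close>)
  interpret M: finite_measure ?M by (rule finite_measure_unit_lborel)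
  interpret P: pair_sigma_finite ?N ?M by unfold_locales
  have [measurable]: "(\<lambda>\<theta>. q m (circ r \<theta>)) \<in> borel_measurable borel" using r q_circ_measurable by blast
  have [measurable]: "fst \<in> borel_measurable (?N \<Otimes>\<^sub>M ?M)" "snd \<in> borel_measurable (?N \<Otimes>\<^sub>M ?M)"
    by (rule measurable_compose[OF measurable_fst] measurable_compose[OF measurable_snd], rule measurable_restrict_space1, simp)+
  have exp_le: "norm (exp (- (of_real u * w))) \<le> exp (s * norm w)" if "u \<in> {0..s}" for u
  proof -
    have "- (u * Re w) \<le> u * norm w" using that abs_Re_le_cmod[of w] by (metis abs_le_D2 atLeastAtMost_iff mult_left_mono mult_minus_right)
    also have "\<dots> \<le> s * norm w" using that by (intro mult_right_mono) auto
    finally show ?thesis by simp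
  qed
  have g_eq: "g u \<theta> = exp (- (of_real u * w)) * (of_real (r/2) * turn \<theta> * (exp (of_real u / circ r \<theta>) * q m (circ r \<theta>)))" for u \<theta>
    by (simp add: g_def algebra_simps exp_diff exp_minus field_simps)
  have g_bound: "norm (g u \<theta>) \<le> exp (s * norm w) * (r/2 * (exp (s/r) * Q m))" if "u \<in> {0..s}" for u \<theta>
  proof -
    have "r/2 * (exp (u/r) * Q m) \<le> r/2 * (exp (s/r) * Q m)"
      using that r Q_pos[of m] by (intro mult_left_mono mult_right_mono) (auto simp: divide_right_mono)
    thus ?thesis unfolding g_eq norm_mult[of "exp (- (of_real u * w))"]
      using that integrand_bound[OF r, of u \<theta> m] by (intro mult_mono exp_le) (auto intro: order_trans)
  qed
  have g_meas: "(\<lambda>(u, \<theta>). g u \<theta>) \<in> borel_measurable (?N \<Otimes>\<^sub>M ?M)"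
  proof -
    have "(\<lambda>x. of_real (r/2) * turn (snd x) * (q m (circ r (snd x)) * exp (of_real (fst x) * (1 / circ r (snd x) - w)))) \<in> borel_measurable (?N \<Otimes>\<^sub>M ?M)"
      by measurable
    thus ?thesis by (simp add: g_def case_prod_beta)
  qed
  have int: "integrable (?N \<Otimes>\<^sub>M ?M) (\<lambda>(u, \<theta>). g u \<theta>)"
  proof (rule finite_measure.integrable_const_bound)
    show "finite_measure (?N \<Otimes>\<^sub>M ?M)" by (rule finite_measure_pair_measure) unfold_locales
    show "AE x in ?N \<Otimes>\<^sub>M ?M. norm (case x of (u, \<theta>) \<Rightarrow> g u \<theta>) \<le> exp (s * norm w) * (r/2 * (exp (s/r) * Q m))"
    proof (rule AE_I2)
      fix x assume "x \<in> space (?N \<Otimes>\<^sub>M ?M)"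
      hence "fst x \<in> {0..s}" by (simp add: space_pair_measure space_restrict_space mem_Times_iff)
      thus "norm (case x of (u, \<theta>) \<Rightarrow> g u \<theta>) \<le> exp (s * norm w) * (r/2 * (exp (s/r) * Q m))"
        unfolding case_prod_beta by (rule g_bound)
    qed
  qed (rule g_meas)
  have inner: "(\<integral>\<theta>. g u \<theta> \<partial>?M) = exp (- (of_real u * w)) * (b r m u - a m)" for u
    unfolding g_eq b_def by simp
  have "integrable ?N (\<lambda>u. \<integral>\<theta>. g u \<theta> \<partial>?M)"
    using P.integrable_fst'[OF int] by simp
  hence si: "set_integrable lborel {0..s} (\<lambda>u. exp (- (of_real u * w)) * (b r m u - a m))"
    unfolding inner by (simp add: set_integrable_def integrable_restrict_space)
  have "integral {0..s} (\<lambda>u. exp (- (of_real u * w)) * (b r m u - a m)) = (\<integral>u. (\<integral>\<theta>. g u \<theta> \<partial>?M) \<partial>?N)"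
    unfolding inner using set_borel_integral_eq_integral(2)[OF si]
    by (simp add: integral_restrict_space set_lebesgue_integral_def)
  also have "\<dots> = (\<integral>\<theta>. (\<integral>u. g u \<theta> \<partial>?N) \<partial>?M)" using P.Fubini_integral[OF int] by simp
  also have "\<dots> = (\<integral>\<theta>. ?J \<theta> \<partial>?M)"
  proof (rule integral_cong_AE)
    show "(\<lambda>\<theta>. \<integral>u. g u \<theta> \<partial>?N) \<in> borel_measurable ?M"
      using P.integrable_snd[OF int] by simp
    show "(\<lambda>\<theta>. ?J \<theta>) \<in> borel_measurable ?M"
      by (rule measurable_restrict_space1) measurable
    show "AE \<theta> in ?M. (\<integral>u. g u \<theta> \<partial>?N) = ?J \<theta>"
    proof (rule AE_unit_lborel)
      fix \<theta> :: real assume "\<theta> \<in> {0..1}" "\<theta> \<noteq> 1/2"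
      hence "1 / circ r \<theta> - w \<noteq> 0" using w[of \<theta>] circ_nonzero[OF r(1), of \<theta>] by simp
      thus "(\<integral>u. g u \<theta> \<partial>?N) = ?J \<theta>"
        unfolding g_def integral_mult_right_zero by (subst integral_exp_linear) (use s in auto)
    qed
  qed
  finally show ?thesis
    using has_integral_integral[THEN iffD1, OF set_borel_integral_eq_integral(1)[OF si]] by (simp only:)
qed

lemma b_has_integral:
  assumes r: "0 < r" "r < R" and s: "s \<ge> 0"
  shows "(b r (Suc m) has_integral (b r m s - a m)) {0..s}"
proof -
  have [measurable]: "(\<lambda>\<theta>. q m (circ r \<theta>)) \<in> borel_measurable borel" for m using r q_circ_measurable by blast
  let ?k = "\<lambda>\<theta>. of_real (r/2) * turn \<theta>"
  \<comment> \<open>With w = 0 the kernel is (exp(s/\<epsilon>) - 1) \<epsilon>, and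
    \<open>q_step\<close> turns \<epsilon> q (m+1) into q m - a (m+1). Of the four resulting
    integrals two vanish by Cauchy's theorem; \<open>integral_exp_circ\<close> yields a (m+1) s,
    which cancels against the integral of the constant term of \<open>b r (Suc m)\<close>.\<close>
  have eq: "?k \<theta> * (q (Suc m) (circ r \<theta>) * ((exp (of_real s * (1 / circ r \<theta> - 0)) - 1) / (1 / circ r \<theta> - 0)))
    = (?k \<theta> * (exp (of_real s / circ r \<theta>) * q m (circ r \<theta>)) - ?k \<theta> * q m (circ r \<theta>))
      - (a (Suc m) * (?k \<theta> * exp (of_real s / circ r \<theta>)) - a (Suc m) * ?k \<theta>)" for \<theta>
  proof -
    have "q (Suc m) (circ r \<theta>) * ((exp (of_real s * (1 / circ r \<theta> - 0)) - 1) / (1 / circ r \<theta> - 0))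
      = (exp (of_real s / circ r \<theta>) - 1) * (circ r \<theta> * q (Suc m) (circ r \<theta>))" by simp
    also have "circ r \<theta> * q (Suc m) (circ r \<theta>) = q m (circ r \<theta>) - a (Suc m)"
      using q_step[of m "circ r \<theta>"] by simp
    finally show ?thesis by (simp only:) (simp add: algebra_simps)
  qed
  have i1: "integrable unit_lborel (\<lambda>\<theta>. ?k \<theta> * (exp (of_real s / circ r \<theta>) * q m (circ r \<theta>)))"
    by (rule integrable_unit_lborel[OF _ integrand_bound[OF r s]]) (rule measurable_restrict_space1, measurable)
  have "norm (?k \<theta> * q m (circ r \<theta>)) \<le> r/2 * Q m" for \<theta>
    using integrand_bound[OF r order_refl, of \<theta> m] by simp
  hence i2: "integrable unit_lborel (\<lambda>\<theta>. ?k \<theta> * q m (circ r \<theta>))"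
    by (rule integrable_unit_lborel[rotated]) (rule measurable_restrict_space1, measurable)
  have i3: "integrable unit_lborel (\<lambda>\<theta>. ?k \<theta> * exp (of_real s / circ r \<theta>))"
    using norm_exp_circ[OF r(1) s] r
    by (intro integrable_unit_lborel[of _ "r/2 * exp (s/r)"] measurable_restrict_space1) (measurable, auto simp: norm_mult norm_divide)
  have i4: "integrable unit_lborel ?k"
    using r by (intro integrable_unit_lborel[of _ "r/2"] measurable_restrict_space1) (measurable, auto simp: norm_mult norm_divide)
  have "((\<lambda>u. exp (- (of_real u * 0)) * (b r (Suc m) u - a (Suc m))) has_integral
    (\<integral>\<theta>. (?k \<theta> * (exp (of_real s / circ r \<theta>) * q m (circ r \<theta>)) - ?k \<theta> * q m (circ r \<theta>))
      - (a (Suc m) * (?k \<theta> * exp (of_real s / circ r \<theta>)) - a (Suc m) * ?k \<theta>) \<partial>unit_lborel)) {0..s}"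
    unfolding eq[symmetric] by (rule b_laplace_finite[OF r s]) auto
  also have "(\<integral>\<theta>. (?k \<theta> * (exp (of_real s / circ r \<theta>) * q m (circ r \<theta>)) - ?k \<theta> * q m (circ r \<theta>))
      - (a (Suc m) * (?k \<theta> * exp (of_real s / circ r \<theta>)) - a (Suc m) * ?k \<theta>) \<partial>unit_lborel)
    = ((b r m s - a m) - 0) - (a (Suc m) * of_real s - a (Suc m) * 0)"
  proof -
    have "(\<integral>\<theta>. ?k \<theta> * (exp (of_real s / circ r \<theta>) * q m (circ r \<theta>)) \<partial>unit_lborel) = b r m s - a m"
      by (simp add: b_def)
    thus ?thesis
      using integral_q[OF r, of m] integral_exp_circ[OF r(1) s] integral_1[OF r(1)]
      by (simp only: Bochner_Integration.integral_diff i1 i2 i3 i4 Bochner_Integration.integrable_diff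
          integrable_mult_right integral_mult_right_zero)
  qed
  finally have "((\<lambda>u. (b r (Suc m) u - a (Suc m)) + a (Suc m)) has_integral
     ((b r m s - a m) - a (Suc m) * of_real s) + (Henstock_Kurzweil_Integration.content {0..s} *\<^sub>R a (Suc m))) {0..s}"
    by (intro has_integral_add has_integral_const_real) simp
  thus ?thesis using s by (simp add: scaleR_conv_of_real mult.commute)
qed

end

section \<open>Analytic continuation to the half-strip\<close>

context gevrey_expansion begin

lemma b_0: "0 < r \<Longrightarrow> r < R \<Longrightarrow> b r m 0 = a m"
  using b_has_integral[of r 0 m] has_integral_unique[OF _ has_integral_refl(2)[of "b r (Suc m)" 0]]
  by (metis atLeastAtMost_singleton eq_iff_diff_eq_0 order_refl)

text \<open>Continuity of \<open>b r (Suc m)\<close>, needed for the fundamental theorem, comes from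
  its own representation as an integral one level higher.\<close>

lemma b_has_vector_derivative:
  assumes r: "0 < r" "r < R" and "s \<in> {0..T}"
  shows "(b r m has_vector_derivative b r (Suc m) s) (at s within {0..T})"
proof -
  have eq: "b r m u = a m + integral {0..u} (b r (Suc m))" if "u \<in> {0..T}" for u m
    using b_has_integral[OF r, of u m] that by (simp add: integral_unique)
  have T: "T \<ge> 0" using assms by auto
  have "continuous_on {0..T} (\<lambda>u. a (Suc m) + integral {0..u} (b r (Suc (Suc m))))"
    using b_has_integral[OF r T, of "Suc m"]
    by (intro continuous_intros indefinite_integral_continuous_1) (simp add: has_integral_integrable)
  hence "continuous_on {0..T} (b r (Suc m))" by (rule continuous_on_eq) (simp add: eq)
  hence "((\<lambda>u. integral {0..u} (b r (Suc m))) has_vector_derivative b r (Suc m) s) (at s within {0..T})"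
    using assms(3) by (rule integral_has_vector_derivative)
  hence "((\<lambda>u. a m + integral {0..u} (b r (Suc m))) has_vector_derivative b r (Suc m) s) (at s within {0..T})"
    by (auto intro: derivative_eq_intros)
  thus ?thesis using assms(3) by (rule has_vector_derivative_transform[rotated 2]) (simp add: eq)
qed

lemma b_continuous: "0 < r \<Longrightarrow> r < R \<Longrightarrow> continuous_on {0..T} (b r m)"
  unfolding continuous_on_eq_continuous_within
  using b_has_vector_derivative has_vector_derivative_continuous by blast

text \<open>Bounds the m-th Taylor term at distance \<rho> up to the factor exp(s/r). Having R in
  place of r/2 keeps it independent of r, as the limit r to R requires.\<close>

definition Kterm :: "real \<Rightarrow> nat \<Rightarrow> real" where
  "Kterm \<rho> m = (A + A * R * \<sigma> * real (Suc m)) * (\<sigma> * \<rho>) ^ m"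

lemma summable_Kterm: "0 \<le> \<rho> \<Longrightarrow> \<rho> < 1 / \<sigma> \<Longrightarrow> summable (Kterm \<rho>)"
proof -
  assume \<rho>: "0 \<le> \<rho>" "\<rho> < 1 / \<sigma>"
  hence n: "norm (\<sigma> * \<rho>) < 1" using \<sigma>_pos by (simp add: field_simps abs_mult)
  have "summable (\<lambda>m. real (Suc m) * (\<sigma> * \<rho>) ^ m)"
    using geometric_deriv_sums[OF n] by (simp add: sums_iff)
  moreover have "summable (\<lambda>m. (\<sigma> * \<rho>) ^ m)" using n by (rule summable_geometric)
  ultimately have "summable (\<lambda>m. A * (\<sigma> * \<rho>) ^ m + A * R * \<sigma> * (real (Suc m) * (\<sigma> * \<rho>) ^ m))"
    by (intro summable_add summable_mult)
  thus ?thesis by (simp add: Kterm_def[abs_def] algebra_simps)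
qed

lemma norm_b_coeff_le:
  assumes r: "0 < r" "r < R" and "s \<ge> 0" "0 \<le> \<rho>"
  shows "norm (b r m s) / fact m * \<rho> ^ m \<le> exp (s/r) * Kterm \<rho> m"
proof -
  have "norm (b r m s) \<le> norm (a m) + norm (b r m s - a m)" by (metis add.commute diff_add_cancel norm_triangle_ineq)
  also have "\<dots> \<le> A * \<sigma> ^ m * fact m + r/2 * (exp (s/r) * Q m)"
    by (intro add_mono norm_a_le norm_b_le assms)
  also have "\<dots> \<le> exp (s/r) * (A * \<sigma> ^ m * fact m) + exp (s/r) * (R * Q m)"
  proof (rule add_mono)
    have "1 * (A * \<sigma> ^ m * fact m) \<le> exp (s/r) * (A * \<sigma> ^ m * fact m)"
      using assms A_pos \<sigma>_pos by (intro mult_right_mono) auto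
    thus "A * \<sigma> ^ m * fact m \<le> exp (s/r) * (A * \<sigma> ^ m * fact m)" by simp
    have "(r/2) * (exp (s/r) * Q m) \<le> R * (exp (s/r) * Q m)"
      using r Q_pos[of m] by (intro mult_right_mono) auto
    thus "(r/2) * (exp (s/r) * Q m) \<le> exp (s/r) * (R * Q m)" by (simp add: mult_ac)
  qed
  also have "\<dots> = exp (s/r) * ((A + A * R * \<sigma> * real (Suc m)) * \<sigma> ^ m) * fact m"
    by (simp add: Q_def algebra_simps)
  finally have "norm (b r m s) / fact m \<le> exp (s/r) * ((A + A * R * \<sigma> * real (Suc m)) * \<sigma> ^ m)"
    by (simp add: divide_le_eq)
  hence "norm (b r m s) / fact m * \<rho> ^ m \<le> exp (s/r) * ((A + A * R * \<sigma> * real (Suc m)) * \<sigma> ^ m) * \<rho> ^ m"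
    using assms by (intro mult_right_mono) auto
  thus ?thesis by (simp add: Kterm_def power_mult_distrib mult_ac)
qed

text \<open>The Taylor series of \<open>b r 0\<close> at the centre s of the half-line; the m-th
  derivative of \<open>b r 0\<close> is \<open>b r m\<close>.\<close>

definition P :: "real \<Rightarrow> real \<Rightarrow> complex \<Rightarrow> complex" where
  "P r s z = (\<Sum>m. b r m s / fact m * (z - of_real s) ^ m)"

lemma summable_norm_P:
  assumes r: "0 < r" "r < R" and s: "s \<ge> 0" and z: "norm (z - of_real s) < 1 / \<sigma>"
  shows "summable (\<lambda>m. norm (b r m s / fact m * (z - of_real s) ^ m))"
proof (rule summable_comparison_test')
  show "summable (\<lambda>m. exp (s/r) * Kterm (norm (z - of_real s)) m)"
    by (intro summable_mult summable_Kterm z) simp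
  show "norm (norm (b r m s / fact m * (z - of_real s) ^ m)) \<le> exp (s/r) * Kterm (norm (z - of_real s)) m" for m
    using norm_b_coeff_le[OF r s, of "norm (z - of_real s)" m] by (simp add: norm_mult norm_divide norm_power)
qed

lemma P_sums: 
  assumes "0 < r" "r < R" "s \<ge> 0" "norm (z - of_real s) < 1 / \<sigma>"
  shows "(\<lambda>m. b r m s / fact m * (z - of_real s) ^ m) sums P r s z"
  unfolding P_def by (rule summable_sums, rule summable_norm_cancel, rule summable_norm_P[OF assms])

lemma Kterm_mono: "0 \<le> \<rho> \<Longrightarrow> \<rho> \<le> \<rho>' \<Longrightarrow> Kterm \<rho> m \<le> Kterm \<rho>' m"
  unfolding Kterm_def using A_pos R_pos \<sigma>_pos by (intro mult_left_mono power_mono) auto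

lemma norm_P_le:
  assumes r: "0 < r" "r < R" and s: "s \<ge> 0" and z: "norm (z - of_real s) \<le> \<rho>" "\<rho> < 1 / \<sigma>"
  shows "norm (P r s z) \<le> exp (s/r) * (\<Sum>m. Kterm \<rho> m)"
proof -
  have \<rho>: "0 \<le> \<rho>" using z(1) norm_ge_zero order_trans by blast
  have z': "norm (z - of_real s) < 1 / \<sigma>" using z by linarith
  have "norm (P r s z) \<le> (\<Sum>m. norm (b r m s / fact m * (z - of_real s) ^ m))"
    unfolding P_def by (rule summable_norm[OF summable_norm_P[OF r s z']])
  also have "\<dots> \<le> (\<Sum>m. exp (s/r) * Kterm \<rho> m)"
  proof (rule suminf_le[OF _ summable_norm_P[OF r s z']])
    show "norm (b r m s / fact m * (z - of_real s) ^ m) \<le> exp (s/r) * Kterm \<rho> m" for m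
    proof -
      have "norm (b r m s / fact m * (z - of_real s) ^ m) \<le> exp (s/r) * Kterm (norm (z - of_real s)) m"
        using norm_b_coeff_le[OF r s, of "norm (z - of_real s)" m] by (simp add: norm_mult norm_divide norm_power)
      also have "\<dots> \<le> exp (s/r) * Kterm \<rho> m" by (intro mult_left_mono Kterm_mono z) auto
      finally show ?thesis .
    qed
    show "summable (\<lambda>m. exp (s/r) * Kterm \<rho> m)" by (intro summable_mult summable_Kterm z \<rho>)
  qed
  also have "\<dots> = exp (s/r) * (\<Sum>m. Kterm \<rho> m)" by (intro suminf_mult summable_Kterm z \<rho>)
  finally show ?thesis .
qed

lemma P_holomorphic: "0 < r \<Longrightarrow> r < R \<Longrightarrow> s \<ge> 0 \<Longrightarrow> P r s holomorphic_on ball (of_real s) (1 / \<sigma>)"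
  by (rule power_series_holomorphic[of _ _ "\<lambda>m. b r m s / fact m"], rule P_sums)
     (auto simp: dist_norm norm_minus_commute)

text \<open>Taylor's formula with integral remainder. The remainder after p terms is at most
  exp(u/r) p \<open>Kterm (u - s) p\<close>, which tends to 0 because \<sigma>(u - s) < 1.\<close>

lemma P_of_real:
  assumes r: "0 < r" "r < R" and s: "0 \<le> s" "s \<le> u" "u - s < 1 / \<sigma>"
  shows "P r s (of_real u) = b r 0 u"
proof (cases "s = u")
  case True
  have "(\<lambda>m. b r m s / fact m * (of_real u - of_real s) ^ m) sums (b r 0 s / fact 0)"
    using powser_sums_zero[of "\<lambda>m. b r m s / fact m"] True by simp
  thus ?thesis using P_sums[OF r s(1), of "of_real u"] True \<sigma>_pos by (simp add: sums_unique2)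
next
  case False
  hence su: "s < u" using s by simp
  let ?S = "\<lambda>p. \<Sum>i<p. b r i s / fact i * (of_real u - of_real s) ^ i"
  have lim1: "?S \<longlonglongrightarrow> P r s (of_real u)"
    using P_sums[OF r s(1), of "of_real u"] s
    by (simp add: sums_def del: of_real_diff add: of_real_diff[symmetric])
  have "(\<lambda>p. b r 0 u - ?S p) \<longlonglongrightarrow> 0"
  proof (rule Lim_null_comparison)
    show "\<forall>\<^sub>F p in sequentially. norm (b r 0 u - ?S p) \<le> exp (u/r) * (Kterm (u - s) p * real p)"
    proof (rule eventually_sequentiallyI[of 1])
      fix p :: nat assume p: "p \<ge> 1"
      have "((\<lambda>x. ((u - x) ^ (p - 1) / fact (p - 1)) *\<^sub>R b r p x) has_integral
          b r 0 u - (\<Sum>i<p. ((u - s) ^ i / fact i) *\<^sub>R b r i s)) {s..u}"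
      proof (rule Taylor_has_integral)
        fix m t assume "s \<le> t" "t \<le> u"
        thus "(b r m has_vector_derivative b r (Suc m) t) (at t within {s..u})"
          using s by (intro has_vector_derivative_within_subset[OF b_has_vector_derivative[OF r, of t u]]) auto
      qed (use p s in auto)
      also have "(\<Sum>i<p. ((u - s) ^ i / fact i) *\<^sub>R b r i s) = ?S p"
        by (intro sum.cong refl) (simp add: scaleR_conv_of_real mult.commute)
      finally have hi: "((\<lambda>x. ((u - x) ^ (p - 1) / fact (p - 1)) *\<^sub>R b r p x) has_integral b r 0 u - ?S p) (cbox s u)" by simp
      have "norm (b r 0 u - ?S p) \<le> (exp (u/r) * Kterm (u - s) p * real p / (u - s)) * Henstock_Kurzweil_Integration.content (cbox s u)"
      proof (rule has_integral_bound[OF _ hi])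
        show "0 \<le> exp (u/r) * Kterm (u - s) p * real p / (u - s)"
          using su A_pos R_pos \<sigma>_pos by (simp add: Kterm_def)
        fix x assume x: "x \<in> cbox s u"
        have "norm (((u - x) ^ (p - 1) / fact (p - 1)) *\<^sub>R b r p x) = (u - x) ^ (p - 1) / fact (p - 1) * norm (b r p x)"
          using x by simp
        also have "\<dots> \<le> (u - s) ^ (p - 1) / fact (p - 1) * norm (b r p x)"
          using x by (intro mult_right_mono divide_right_mono power_mono) auto
        \<comment> \<open>Rewritten with (u - s)^p / p! to match \<open>norm_b_coeff_le\<close>. Of
          the factor p/(u - s), the denominator cancels against the length of the interval.\<close>
        also have "\<dots> = (norm (b r p x) / fact p * (u - s) ^ p) * real p / (u - s)"
        proof -
          have "(u - s) ^ p = (u - s) * (u - s) ^ (p - 1)" using p by (simp add: power_eq_if)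
          moreover have "(fact p :: real) = real p * fact (p - 1)" using p by (intro fact_reduce) simp
          ultimately show ?thesis using su p by simp
        qed
        also have "\<dots> \<le> (exp (x/r) * Kterm (u - s) p) * real p / (u - s)"
          using x s su by (intro divide_right_mono mult_right_mono norm_b_coeff_le r) auto
        also have "\<dots> \<le> (exp (u/r) * Kterm (u - s) p) * real p / (u - s)"
          using x s su r A_pos R_pos \<sigma>_pos
          by (intro divide_right_mono mult_right_mono) (auto simp: Kterm_def divide_right_mono)
        finally show "norm (((u - x) ^ (p - 1) / fact (p - 1)) *\<^sub>R b r p x) \<le> exp (u/r) * Kterm (u - s) p * real p / (u - s)" .
      qed
      thus "norm (b r 0 u - ?S p) \<le> exp (u/r) * (Kterm (u - s) p * real p)" using su by simp
    qed
    have "\<sigma> * (u - s) < 1" "\<sigma> * (u - s) > 0" using s su \<sigma>_pos by (auto simp: field_simps)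
    define x where "x = \<sigma> * (u - s)"
    have x: "norm x < 1" using \<open>\<sigma> * (u - s) < 1\<close> \<open>\<sigma> * (u - s) > 0\<close> by (simp add: x_def)
    have l1: "(\<lambda>p. real p * x ^ p) \<longlonglongrightarrow> 0" using powser_times_n_limit_0[OF x] by simp
    \<comment> \<open>\<open>Kterm\<close> is itself linear in p, so p^2 x^p must tend to 0; it is
      the square of p sqrt(x)^p.\<close>
    have "(\<lambda>p. real p * (real p * x ^ p)) \<longlonglongrightarrow> 0"
    proof -
      have "0 < sqrt x" "sqrt x < 1" using x \<open>\<sigma> * (u - s) > 0\<close> unfolding x_def[symmetric] by auto
      hence "(\<lambda>p. real p * sqrt x ^ p) \<longlonglongrightarrow> 0" using powser_times_n_limit_0[of "sqrt x"] by simp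
      hence "(\<lambda>p. (real p * sqrt x ^ p) * (real p * sqrt x ^ p)) \<longlonglongrightarrow> 0 * 0" by (intro tendsto_mult)
      moreover have "sqrt x ^ p * sqrt x ^ p = x ^ p" for p
        using \<open>0 < sqrt x\<close> by (simp add: power_mult_distrib[symmetric])
      ultimately show ?thesis by (simp add: mult_ac)
    qed
    hence "(\<lambda>p. exp (u/r) * ((A + A * R * \<sigma>) * (real p * x ^ p) + A * R * \<sigma> * (real p * (real p * x ^ p)))) \<longlonglongrightarrow>
       exp (u/r) * ((A + A * R * \<sigma>) * 0 + A * R * \<sigma> * 0)"
      by (intro tendsto_intros l1)
    thus "(\<lambda>p. exp (u/r) * (Kterm (u - s) p * real p)) \<longlonglongrightarrow> 0"
      by (simp add: Kterm_def x_def algebra_simps)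
  qed
  from tendsto_diff[OF tendsto_const[of "b r 0 u"] this] have "?S \<longlonglongrightarrow> b r 0 u" by simp
  thus ?thesis using lim1 LIMSEQ_unique by blast
qed

text \<open>To the right of both centres the two series equal \<open>b r 0\<close> on a real
  segment; the identity theorem on the intersection of the two discs extends the equality.\<close>

lemma P_agree:
  assumes r: "0 < r" "r < R" and s: "0 \<le> s" "0 \<le> s'" "\<bar>s - s'\<bar> < 1 / \<sigma>"
    and z: "norm (z - of_real s) < 1 / \<sigma>" "norm (z - of_real s') < 1 / \<sigma>"
  shows "P r s z = P r s' z"
proof -
  define m where "m = max s s'"
  \<comment> \<open>Real points less than e to the right of the larger centre still lie in both
    discs.\<close>
  define e where "e = 1 / \<sigma> - \<bar>s - s'\<bar>"
  have e: "e > 0" using s by (simp add: e_def)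
  let ?S = "ball (complex_of_real s) (1 / \<sigma>) \<inter> ball (of_real s') (1 / \<sigma>)"
  have "P r s z - P r s' z = 0"
  proof (rule analytic_continuation[where f = "\<lambda>z. P r s z - P r s' z" and w = z and S = ?S and U = "of_real ` {m..<m + e}" and \<xi> = "of_real m"])
    show "(\<lambda>z. P r s z - P r s' z) holomorphic_on ?S"
      by (intro holomorphic_intros holomorphic_on_subset[OF P_holomorphic[OF r]] s) auto
    show "connected ?S" by (intro convex_connected convex_Int convex_ball)
    show "complex_of_real ` {m..<m + e} \<subseteq> ?S"
    proof
      fix w assume "w \<in> complex_of_real ` {m..<m + e}"
      then obtain x where x: "w = of_real x" "m \<le> x" "x < m + e" by auto
      hence "\<bar>s - x\<bar> < 1 / \<sigma>" "\<bar>s' - x\<bar> < 1 / \<sigma>" by (auto simp: m_def e_def)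
      thus "w \<in> ?S" unfolding x(1) by (simp add: dist_norm flip: of_real_diff)
    qed
    moreover have "complex_of_real m \<in> of_real ` {m..<m + e}" using e by (intro imageI) simp
    ultimately show "complex_of_real m \<in> ?S" by blast
    show "complex_of_real m islimpt of_real ` {m..<m + e}"
    proof (rule islimptI)
      fix T assume T: "complex_of_real m \<in> T" "open T"
      then obtain d where d: "d > 0" "ball (of_real m) d \<subseteq> T" by (auto simp: open_contains_ball)
      define x where "x = m + min d e / 2"
      have "complex_of_real x \<in> ball (of_real m) d"
        using d e by (simp add: x_def dist_norm norm_divide flip: of_real_diff of_real_add)
      moreover have "x \<in> {m..<m + e}" "x \<noteq> m" using d e by (auto simp: x_def)
      ultimately show "\<exists>y\<in>of_real ` {m..<m + e}. y \<in> T \<and> y \<noteq> complex_of_real m"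
        using d(2) by (intro bexI[of _ "complex_of_real x"]) auto
    qed
    show "P r s w - P r s' w = 0" if w: "w \<in> complex_of_real ` {m..<m + e}" for w
    proof -
      obtain x where x: "w = of_real x" "m \<le> x" "x < m + e" using w by auto
      hence "s \<le> x" "s' \<le> x" "x - s < 1 / \<sigma>" "x - s' < 1 / \<sigma>" by (auto simp: m_def e_def)
      thus ?thesis unfolding x(1) using P_of_real[OF r] s by simp
    qed
  qed (use z in \<open>auto simp: dist_norm norm_minus_commute\<close>)
  thus ?thesis by simp
qed

text \<open>The centre is the point of the half-line nearest to z, so the series converges on the
  whole half-strip.\<close>

definition G :: "real \<Rightarrow> complex \<Rightarrow> complex" where
  "G r z = P r (max (Re z) 0) z"

end

section \<open>Geometry of the half-strip and of the tangent discs\<close>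

lemma mem_half_strip_iff: "z \<in> half_strip \<rho> \<longleftrightarrow> norm (z - of_real (max (Re z) 0)) < \<rho>"
proof -
  let ?R = "complex_of_real ` {0..}"
  have "infdist z ?R = dist z (of_real (max (Re z) 0))"
  proof (rule antisym)
    show "infdist z ?R \<le> dist z (of_real (max (Re z) 0))" by (rule infdist_le) auto
    have "dist z (of_real (max (Re z) 0)) \<le> dist z a" if "a \<in> ?R" for a
    proof -
      obtain x where x: "a = of_real x" "x \<in> {0..}" using \<open>a \<in> ?R\<close> by blast
      have "\<bar>Re z - max (Re z) 0\<bar> \<le> \<bar>Re z - x\<bar>" using x by auto
      hence "(Re z - max (Re z) 0)\<^sup>2 \<le> (Re z - x)\<^sup>2" by (simp only: abs_le_square_iff)
      thus ?thesis by (simp add: x dist_norm cmod_def)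
    qed
    thus "dist z (of_real (max (Re z) 0)) \<le> infdist z ?R"
      unfolding infdist_def by (auto intro!: cINF_greatest)
  qed
  thus ?thesis by (simp add: half_strip_def dist_norm)
qed

text \<open>As a Minkowski sum of the half-line and a disc, the half-strip is seen to be open and
  convex.\<close>

lemma half_strip_eq_sums: "half_strip \<rho> = (\<Union>x\<in>complex_of_real ` {0..}. \<Union>y\<in>ball 0 \<rho>. {x + y})"
proof (intro equalityI subsetI)
  fix z assume "z \<in> half_strip \<rho>"
  hence "z - of_real (max (Re z) 0) \<in> ball 0 \<rho>" unfolding mem_half_strip_iff by simp
  moreover have "complex_of_real (max (Re z) 0) \<in> complex_of_real ` {0..}" by (intro imageI) simp
  ultimately show "z \<in> (\<Union>x\<in>complex_of_real ` {0..}. \<Union>y\<in>ball 0 \<rho>. {x + y})"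
    by (intro UN_I[where a = "complex_of_real (max (Re z) 0)"] UN_I[where a = "z - complex_of_real (max (Re z) 0)"]) simp_all
next
  fix z assume "z \<in> (\<Union>x\<in>complex_of_real ` {0..}. \<Union>y\<in>ball 0 \<rho>. {x + y})"
  then obtain x y where xy: "z = x + y" "x \<in> complex_of_real ` {0..}" "norm y < \<rho>" by auto
  have "infdist z (complex_of_real ` {0..}) \<le> dist z x" by (rule infdist_le[OF xy(2)])
  thus "z \<in> half_strip \<rho>" using xy by (simp add: half_strip_def dist_norm)
qed

lemma open_half_strip: "open (half_strip \<rho>)"
  unfolding half_strip_eq_sums by (rule open_sums) auto

lemma convex_half_strip: "convex (half_strip \<rho>)"
  unfolding half_strip_eq_sums
  by (intro convex_sums convex_ball convex_linear_image) (auto intro: linearI simp: scaleR_conv_of_real)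

lemma Re_inverse_gt_iff:
  assumes "r > 0" shows "Re (1 / \<epsilon>) > 1 / r \<longleftrightarrow> \<epsilon> \<in> ball (of_real (r/2)) (r/2)"
proof (cases "\<epsilon> = 0")
  case True
  thus ?thesis using assms zero_notin_tangent_ball by simp
next
  case False
  hence "(norm \<epsilon>)\<^sup>2 > 0" by simp
  moreover have "Re (1 / \<epsilon>) = Re \<epsilon> / (norm \<epsilon>)\<^sup>2" by (simp add: Re_divide cmod_power2)
  moreover have "1 / r < x / n \<longleftrightarrow> n < r * x" if "n > 0" for x n
    using that assms by (simp add: field_simps)
  ultimately show ?thesis unfolding mem_tangent_ball_iff[OF assms] by simp
qed

lemma ball_subset_half_strip: "ball 0 \<rho> \<subseteq> half_strip \<rho>"
proof
  fix z :: complex assume "z \<in> ball 0 \<rho>"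
  moreover have "infdist z (complex_of_real ` {0..}) \<le> dist z 0"
    by (rule infdist_le) (metis atLeast_iff imageI of_real_0 order_refl)
  ultimately show "z \<in> half_strip \<rho>" by (simp add: half_strip_def)
qed

section \<open>Gluing of the Taylor series and inversion of the Laplace transform\<close>

context gevrey_expansion begin

text \<open>The centre in \<open>G\<close> varies with z; near z0 it may be frozen by
  \<open>P_agree\<close>, after which holomorphy is that of a single power series. The radius is
  half of the gap to 1/\<sigma>, since both z and its centre may move by \<delta>.\<close>

lemma G_locally:
  assumes r: "0 < r" "r < R" and z0: "z0 \<in> half_strip (1 / \<sigma>)"
  shows "\<exists>\<delta>>0. \<forall>z\<in>ball z0 \<delta>. G r z = P r (max (Re z0) 0) z \<and> z \<in> ball (of_real (max (Re z0) 0)) (1 / \<sigma>)"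
proof -
  define s0 where "s0 = max (Re z0) 0"
  define \<delta> where "\<delta> = (1 / \<sigma> - norm (z0 - of_real s0)) / 2"
  have \<delta>: "\<delta> > 0" using z0 unfolding mem_half_strip_iff by (simp add: \<delta>_def s0_def)
  have "G r z = P r s0 z \<and> z \<in> ball (of_real s0) (1 / \<sigma>)" if z: "z \<in> ball z0 \<delta>" for z
  proof -
    define s1 where "s1 = max (Re z) 0"
    have n: "norm (z - z0) < \<delta>" using z by (simp add: dist_norm norm_minus_commute)
    have s: "\<bar>s0 - s1\<bar> \<le> norm (z - z0)"
      using abs_Re_le_cmod[of "z - z0"] by (auto simp: s0_def s1_def)
    have "norm (z - of_real s0) \<le> norm (z - z0) + norm (z0 - of_real s0)"
      by (rule norm_diff_triangle_le[OF order_refl order_refl])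
    moreover have "norm (z0 - of_real s0) = 1 / \<sigma> - 2 * \<delta>" by (simp add: \<delta>_def field_simps)
    ultimately have z_s0: "norm (z - of_real s0) < 1 / \<sigma> - \<delta>" using n by linarith
    have "norm (z - of_real s1) \<le> norm (z - of_real s0) + norm (of_real s0 - of_real s1 :: complex)"
      by (rule norm_diff_triangle_le[OF order_refl order_refl])
    moreover have "norm (of_real s0 - of_real s1 :: complex) = \<bar>s0 - s1\<bar>"
      by (metis norm_of_real of_real_diff)
    ultimately have z_s1: "norm (z - of_real s1) < 1 / \<sigma>" using z_s0 s n by linarith
    have "0 < 1 / \<sigma>" using \<sigma>_pos by simp
    \<comment> \<open>\<open>P_agree\<close> asks for centres closer than 1/\<sigma>, hence the need
      for \<delta> \<le> 1/\<sigma>.\<close>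
    have "(x - n) / 2 \<le> x" if "0 < x" "0 \<le> n" for x n :: real using that by simp
    from this[OF \<open>0 < 1 / \<sigma>\<close> norm_ge_zero] have "\<delta> \<le> 1 / \<sigma>" unfolding \<delta>_def .
    hence "P r s1 z = P r s0 z"
      using s n z_s0 z_s1 \<delta> by (intro P_agree[OF r]) (auto simp: s0_def s1_def)
    thus ?thesis using z_s0 \<delta> by (simp add: G_def s1_def dist_norm norm_minus_commute)
  qed
  thus ?thesis using \<delta> unfolding s0_def by blast
qed

lemma G_holomorphic:
  assumes r: "0 < r" "r < R"
  shows "G r holomorphic_on half_strip (1 / \<sigma>)"
  unfolding holomorphic_on_def
proof
  fix z0 assume z0: "z0 \<in> half_strip (1 / \<sigma>)"
  define s0 where "s0 = max (Re z0) 0"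
  obtain \<delta> where \<delta>: "\<delta> > 0" "\<And>z. z \<in> ball z0 \<delta> \<Longrightarrow> G r z = P r s0 z \<and> z \<in> ball (of_real s0) (1 / \<sigma>)"
    using G_locally[OF r z0] unfolding s0_def by blast
  have "P r s0 holomorphic_on ball (of_real s0) (1 / \<sigma>)" by (rule P_holomorphic[OF r]) (simp add: s0_def)
  then obtain D where "(P r s0 has_field_derivative D) (at z0)"
    using \<delta>(2)[of z0] \<delta>(1) by (metis centre_in_ball field_differentiable_def holomorphic_on_imp_differentiable_at open_ball)
  hence "(G r has_field_derivative D) (at z0)"
    by (rule has_field_derivative_transform_within_open[of _ _ _ "ball z0 \<delta>"]) (use \<delta> in auto)
  thus "G r field_differentiable at z0 within half_strip (1 / \<sigma>)"
    using field_differentiable_at_within field_differentiable_def by blast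
qed

lemma G_series:
  assumes r: "0 < r" "r < R" and z: "norm z < 1 / \<sigma>"
  shows "G r z = (\<Sum>k. 1 / fact k * z ^ k * a k)"
proof -
  have "z \<in> half_strip (1 / \<sigma>)" using ball_subset_half_strip[of "1 / \<sigma>"] z by (intro subsetD[OF ball_subset_half_strip]) simp
  hence "G r z = P r 0 z" unfolding G_def mem_half_strip_iff
    using z abs_Re_le_cmod[of z] \<sigma>_pos by (intro P_agree[OF r]) auto
  thus ?thesis using r by (simp add: P_def b_0 mult_ac)
qed

text \<open>All \<open>G r\<close> have the Taylor coefficients a_k / k! at 0, and the half-strip is
  connected.\<close>

lemma G_independent:
  assumes r: "0 < r" "r < R" and r': "0 < r'" "r' < R" and z: "z \<in> half_strip (1 / \<sigma>)"
  shows "G r z = G r' z"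
proof (rule analytic_continuation_open[of "ball 0 (1 / \<sigma>)" "half_strip (1 / \<sigma>)" "G r" "G r'"])
  show "connected (half_strip (1 / \<sigma>))" by (rule convex_connected[OF convex_half_strip])
qed (use \<sigma>_pos z open_half_strip ball_subset_half_strip G_holomorphic r r' in \<open>auto simp: G_series\<close>)

text \<open>For each r' < R the bound holds with exp(s/r') and the same constant in front; the limit
  r' to R gives the rate 1/R, which no single admissible radius attains.\<close>

lemma norm_G_le:
  assumes r: "0 < r" "r < R" and z: "z \<in> half_strip \<rho>" and \<rho>: "\<rho> < 1 / \<sigma>"
  shows "norm (G r z) \<le> (\<Sum>m. Kterm \<rho> m) * exp (norm z / R)"
proof -
  define s where "s = max (Re z) 0"
  have zs: "norm (z - of_real s) < \<rho>" using z unfolding mem_half_strip_iff s_def .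
  hence \<rho>0: "0 \<le> \<rho>" using norm_ge_zero[of "z - of_real s"] by linarith
  have z': "z \<in> half_strip (1 / \<sigma>)" using zs \<rho> unfolding mem_half_strip_iff s_def by linarith
  have K: "(\<Sum>m. Kterm \<rho> m) \<ge> 0"
    using A_pos R_pos \<sigma>_pos \<rho>0 by (intro suminf_nonneg summable_Kterm \<rho>) (auto simp: Kterm_def)
  have "norm (G r z) \<le> exp (s/R) * (\<Sum>m. Kterm \<rho> m)"
  proof (rule tendsto_lowerbound)
    show "((\<lambda>r'. exp (s/r') * (\<Sum>m. Kterm \<rho> m)) \<longlongrightarrow> exp (s/R) * (\<Sum>m. Kterm \<rho> m)) (at_left R)"
      using R_pos by (intro tendsto_intros) auto
    show "\<forall>\<^sub>F r' in at_left R. norm (G r z) \<le> exp (s/r') * (\<Sum>m. Kterm \<rho> m)"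
    proof (rule eventually_at_leftI[of 0])
      fix r' assume r': "r' \<in> {0<..<R}"
      have "norm (P r' s z) \<le> exp (s/r') * (\<Sum>m. Kterm \<rho> m)"
        using r' zs \<rho> by (intro norm_P_le) (auto simp: s_def)
      moreover have "G r z = P r' s z" using G_independent[OF r _ _ z', of r'] r' by (simp add: G_def s_def)
      ultimately show "norm (G r z) \<le> exp (s/r') * (\<Sum>m. Kterm \<rho> m)" by simp
    qed (rule R_pos)
  qed simp
  also have "\<dots> \<le> exp (norm z / R) * (\<Sum>m. Kterm \<rho> m)"
    using K R_pos complex_Re_le_cmod[of z] by (intro mult_right_mono) (auto simp: s_def divide_right_mono)
  finally show ?thesis by (simp add: mult.commute)
qed

lemma G_of_real: "0 < r \<Longrightarrow> r < R \<Longrightarrow> s \<ge> 0 \<Longrightarrow> G r (of_real s) = b r 0 s"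
  using P_of_real[of r s s] \<sigma>_pos by (simp add: G_def)

text \<open>Integration up to T produces the kernel (exp(T z) - 1)/z with z =
  1/\<open>circ r \<theta>\<close> - 1/\<epsilon>. Since Re z is bounded above by a negative
  constant, T to infinity leaves -1/z, a Cauchy kernel for the point \<epsilon>.\<close>

lemma laplace_integral:
  assumes r: "0 < r" "r < R" and \<epsilon>: "\<epsilon> \<in> ball (of_real (r/2)) (r/2)"
  shows "(\<lambda>s. exp (- (of_real s / \<epsilon>)) * b r 0 s) absolutely_integrable_on {0..}" (is ?abs)
    and "integral {0..} (\<lambda>s. exp (- (of_real s / \<epsilon>)) * b r 0 s) = \<epsilon> * F \<epsilon>"
proof -
  define w where "w = 1 / \<epsilon>"
  \<comment> \<open>The exponential rate by which exp(-s/\<epsilon>) beats the growth exp(s/r) of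
    \<open>b r 0\<close>; it is positive because \<epsilon> lies inside the disc.\<close>
  define d where "d = Re w - 1 / r"
  define f where "f = (\<lambda>s. exp (- (of_real s / \<epsilon>)) * b r 0 s)"
  have \<epsilon>0: "\<epsilon> \<noteq> 0" using \<epsilon> zero_notin_tangent_ball by blast
  have d: "d > 0" using Re_inverse_gt_iff[OF r(1)] \<epsilon> by (simp add: d_def w_def)
  have Rew: "Re w > 0" using d r(1) by (simp add: d_def) (smt (verit) divide_pos_pos)
  have norm_exp: "norm (exp (- (of_real s / \<epsilon>))) = exp (- (s * Re w))" for s
  proof -
    have "- (of_real s / \<epsilon>) = - (of_real s * w)" by (simp add: w_def)
    thus ?thesis by (simp add: norm_exp_eq_Re)
  qed
  have cont: "continuous_on {0..} f"
  proof -
    have "continuous_on {0..} (b r 0)"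
      unfolding continuous_on_eq_continuous_within
    proof
      fix x :: real assume x: "x \<in> {0..}"
      have "continuous (at x within {0..x+1}) (b r 0)"
        using b_continuous[OF r, of "x+1" 0] x unfolding continuous_on_eq_continuous_within by auto
      moreover have "at x within {0..x+1} = at x within {0..}"
        by (rule at_within_nhd[of _ "{..<x+1}"]) auto
      ultimately show "continuous (at x within {0..}) (b r 0)" by (simp add: continuous_within)
    qed
    thus ?thesis unfolding f_def using \<epsilon>0 by (intro continuous_intros) auto
  qed
  have b_bound: "norm (b r 0 s) \<le> (norm (a 0) + r/2 * Q 0) * exp (s/r)" if "s \<ge> 0" for s
  proof -
    have "norm (b r 0 s) \<le> norm (a 0) + norm (b r 0 s - a 0)" by (metis add.commute diff_add_cancel norm_triangle_ineq)
    also have "\<dots> \<le> norm (a 0) * exp (s/r) + r/2 * (exp (s/r) * Q 0)"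
      using that r mult_left_mono[of 1 "exp (s/r)" "norm (a 0)"] by (intro add_mono norm_b_le[OF r that]) auto
    finally show ?thesis by (simp add: algebra_simps)
  qed
  have abs: "f absolutely_integrable_on {0..}"
  proof (rule measurable_bounded_by_integrable_imp_absolutely_integrable)
    show "f \<in> borel_measurable (lebesgue_on {0..})"
      by (rule continuous_imp_measurable_on_sets_lebesgue[OF cont]) simp
    have "(\<lambda>s. exp (- d * s)) integrable_on {0..}"
      using integrable_on_exp_minus_to_infinity[OF d, of 0] by simp
    thus "(\<lambda>s. (norm (a 0) + r/2 * Q 0) * exp (- d * s)) integrable_on {0..}"
      by (rule integrable_on_mult_right)
    fix s :: real assume "s \<in> {0..}"
    hence s: "s \<ge> 0" by simp
    have "norm (f s) \<le> exp (- (s * Re w)) * ((norm (a 0) + r/2 * Q 0) * exp (s/r))"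
      unfolding f_def norm_mult norm_exp by (intro mult_left_mono b_bound s) auto
    also have "\<dots> = (norm (a 0) + r/2 * Q 0) * exp (- d * s)"
      by (simp add: d_def exp_add[symmetric] algebra_simps)
    finally show "norm (f s) \<le> (norm (a 0) + r/2 * Q 0) * exp (- d * s)" .
  qed auto
  thus ?abs unfolding f_def .
  let ?k = "\<lambda>\<theta>. of_real (r/2) * turn \<theta>"
  define z where "z = (\<lambda>\<theta>. 1 / circ r \<theta> - w)"
  \<comment> \<open>At the tangency point 1/\<open>circ r \<theta>\<close> is 0 by convention, and
    the bound persists because 1/r > 0.\<close>
  have Re_z: "Re (z \<theta>) \<le> - d" for \<theta>
    using Re_inverse_circ[OF r(1), of \<theta>] r(1) Rew by (cases "circ r \<theta> = 0") (auto simp: z_def d_def)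
  hence z0: "z \<theta> \<noteq> 0" for \<theta> using d by (metis neg_0_le_iff_le not_le zero_complex.sel(1))
  have norm_z: "norm (z \<theta>) \<ge> d" for \<theta> using Re_z[of \<theta>] abs_Re_le_cmod[of "z \<theta>"] by linarith
  have [measurable]: "(\<lambda>\<theta>. q 0 (circ r \<theta>)) \<in> borel_measurable borel" using r q_circ_measurable by blast
  have [measurable]: "z \<in> borel_measurable borel" unfolding z_def by measurable
  define L where "L = (\<integral>\<theta>. ?k \<theta> * (q 0 (circ r \<theta>) * (- 1 / z \<theta>)) \<partial>unit_lborel)"
  have kq: "norm (?k \<theta> * (q 0 (circ r \<theta>) * v)) \<le> r/2 * Q 0 * norm v" for \<theta> v
    using mult_right_mono[OF integrand_bound[OF r order_refl, of \<theta> 0], of "norm v"] by (simp add: norm_mult mult_ac)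
  let ?I = "\<lambda>T. \<integral>\<theta>. ?k \<theta> * (q 0 (circ r \<theta>) * ((exp (of_real T * z \<theta>) - 1) / z \<theta>)) \<partial>unit_lborel"
  have int: "((\<lambda>u. exp (- (of_real u * w)) * (b r 0 u - a 0)) has_integral
    ?I T) {0..T}" if "T \<ge> 0" for T
    unfolding z_def by (rule b_laplace_finite[OF r that]) (use z0 in \<open>auto simp: z_def\<close>)
  have diff: "norm (?I T - L)
     \<le> r/2 * Q 0 * (exp (- d * T) / d)" if T: "T \<ge> 0" for T
  proof -
    have e: "norm (exp (of_real T * z \<theta>) / z \<theta>) \<le> exp (- d * T) / d" for \<theta>
    proof -
      have "norm (exp (of_real T * z \<theta>)) \<le> exp (- d * T)"
        using mult_left_mono[OF Re_z[of \<theta>] T] by (simp add: norm_exp_eq_Re mult.commute)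
      thus ?thesis unfolding norm_divide using d norm_z by (intro frac_le) auto
    qed
    have b1: "norm (?k \<theta> * (q 0 (circ r \<theta>) * (exp (of_real T * z \<theta>) / z \<theta>))) \<le> r/2 * Q 0 * (exp (- d * T) / d)" for \<theta>
      by (rule order_trans[OF kq mult_left_mono[OF e]]) (use r Q_pos[of 0] in simp)
    have b2: "norm (?k \<theta> * (q 0 (circ r \<theta>) * (- 1 / z \<theta>))) \<le> r/2 * Q 0 * (1 / d)" for \<theta>
    proof -
      have "norm (- 1 / z \<theta>) \<le> 1 / d" using norm_z[of \<theta>] d by (simp add: norm_divide frac_le)
      from order_trans[OF kq mult_left_mono[OF this]] show ?thesis using r Q_pos[of 0] by simp
    qed
    have i1: "integrable unit_lborel (\<lambda>\<theta>. ?k \<theta> * (q 0 (circ r \<theta>) * (exp (of_real T * z \<theta>) / z \<theta>)))"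
      by (rule integrable_unit_lborel[OF _ b1], rule measurable_restrict_space1) measurable
    have i2: "integrable unit_lborel (\<lambda>\<theta>. ?k \<theta> * (q 0 (circ r \<theta>) * (- 1 / z \<theta>)))"
      by (rule integrable_unit_lborel[OF _ b2], rule measurable_restrict_space1) measurable
    have "?k \<theta> * (q 0 (circ r \<theta>) * ((exp (of_real T * z \<theta>) - 1) / z \<theta>)) =
       ?k \<theta> * (q 0 (circ r \<theta>) * (exp (of_real T * z \<theta>) / z \<theta>)) + ?k \<theta> * (q 0 (circ r \<theta>) * (- 1 / z \<theta>))" for \<theta>
      by (simp add: diff_divide_distrib algebra_simps)
    hence "?I T - L =
       (\<integral>\<theta>. ?k \<theta> * (q 0 (circ r \<theta>) * (exp (of_real T * z \<theta>) / z \<theta>)) \<partial>unit_lborel)"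
      unfolding L_def by (simp only: Bochner_Integration.integral_add[OF i1 i2]) simp
    also have "norm \<dots> \<le> r/2 * Q 0 * (exp (- d * T) / d)"
      by (rule norm_integral_unit_lborel_le[OF _ b1], rule measurable_restrict_space1) measurable
    finally show ?thesis .
  qed
  \<comment> \<open>With u = \<open>circ r \<theta>\<close>, -1/z equals \<epsilon> u/(u -
    \<epsilon>), so L is Cauchy's formula at \<epsilon> for the function
    \<open>\<epsilon> * (q 0 u * u)\<close>.\<close>
  have L: "L = \<epsilon> * (q 0 \<epsilon> * \<epsilon>)"
  proof -
    have "L = (\<integral>\<theta>. ?k \<theta> * (\<epsilon> * (q 0 (circ r \<theta>) * circ r \<theta>) / (circ r \<theta> - \<epsilon>)) \<partial>unit_lborel)"
      unfolding L_def
    proof (rule integral_cong_AE)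
      show "AE \<theta> in unit_lborel. ?k \<theta> * (q 0 (circ r \<theta>) * (- 1 / z \<theta>)) = ?k \<theta> * (\<epsilon> * (q 0 (circ r \<theta>) * circ r \<theta>) / (circ r \<theta> - \<epsilon>))"
      proof (rule AE_unit_lborel)
        fix \<theta> :: real assume "\<theta> \<in> {0..1}" "\<theta> \<noteq> 1/2"
        hence c: "circ r \<theta> \<noteq> 0" by (rule circ_nonzero[OF r(1)])
        have "z \<theta> = (\<epsilon> - circ r \<theta>) / (\<epsilon> * circ r \<theta>)" using c \<epsilon>0 by (simp add: z_def w_def field_simps)
        hence "- 1 / z \<theta> = \<epsilon> * circ r \<theta> / (circ r \<theta> - \<epsilon>)"
          by simp (metis minus_diff_eq minus_divide_right)
        thus "?k \<theta> * (q 0 (circ r \<theta>) * (- 1 / z \<theta>)) = ?k \<theta> * (\<epsilon> * (q 0 (circ r \<theta>) * circ r \<theta>) / (circ r \<theta> - \<epsilon>))"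
          by (simp only:) (simp add: mult_ac)
      qed
    qed (rule measurable_restrict_space1, measurable)+
    also have "\<dots> = \<epsilon> * (q 0 \<epsilon> * \<epsilon>)"
      unfolding circ_def
      by (rule Cauchy_formula_unit_lborel[of "of_real (r/2)" "r/2" "\<lambda>u. \<epsilon> * (q 0 u * u)"])
         (intro continuous_intros holomorphic_intros q_continuous[OF r] \<epsilon>
           holomorphic_on_subset[OF q_holomorphic] tangent_ball_subset[OF r])+
    finally show ?thesis .
  qed
  have exp0: "((\<lambda>T. exp (- c * T)) \<longlongrightarrow> 0) at_top" if "c > 0" for c :: real
    using that by (intro filterlim_compose[OF exp_at_bot] filterlim_tendsto_neg_mult_at_bot[OF tendsto_const]) (auto intro: filterlim_ident)
  have lim1: "(?I \<longlongrightarrow> L) at_top"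
  proof (rule Lim_transform2 [OF tendsto_const], rule Lim_null_comparison)
    show "\<forall>\<^sub>F T in at_top. norm (L - ?I T)
       \<le> r/2 * Q 0 * (exp (- d * T) / d)"
      using eventually_ge_at_top[of 0] 
    proof eventually_elim
      case (elim T)
      show ?case by (subst norm_minus_commute) (rule diff[OF elim])
    qed
    have "((\<lambda>T. r/2 * Q 0 * (exp (- d * T) / d)) \<longlongrightarrow> r/2 * Q 0 * (0 / d)) at_top"
      using d by (intro tendsto_intros exp0) auto
    thus "((\<lambda>T. r/2 * Q 0 * (exp (- d * T) / d)) \<longlongrightarrow> 0) at_top" by simp
  qed
  have w0: "w \<noteq> 0" using Rew by auto
  have int2: "((\<lambda>u. exp (- (of_real u * w))) has_integral (1 - exp (- (of_real T * w))) / w) {0..T}" if "T \<ge> 0" for T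
  proof -
    have "((\<lambda>u. exp (- (of_real u * w))) has_integral (- exp (- (of_real T * w)) / w - - exp (- (of_real 0 * w)) / w)) {0..T}"
      using w0 by (intro fundamental_theorem_of_calculus[OF that])
         (auto intro!: derivative_eq_intros has_vector_derivative_real_field)
    thus ?thesis by (simp add: diff_divide_distrib)
  qed
  have lim2: "((\<lambda>T. (1 - exp (- (of_real T * w))) / w) \<longlongrightarrow> (1 - 0) / w) at_top"
  proof (intro tendsto_intros w0)
    have "((\<lambda>T. exp (- Re w * T)) \<longlongrightarrow> 0) at_top" by (rule exp0[OF Rew])
    thus "((\<lambda>T. exp (- (complex_of_real T * w))) \<longlongrightarrow> 0) at_top"
      by (subst tendsto_norm_zero_iff[symmetric]) (simp add: norm_exp_eq_Re mult.commute)
  qed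
  have "((\<lambda>T. integral {0..T} f) \<longlongrightarrow> L + a 0 * ((1 - 0) / w)) at_top"
  proof (rule Lim_transform_eventually)
    show "((\<lambda>T. ?I T +
        a 0 * ((1 - exp (- (of_real T * w))) / w)) \<longlongrightarrow> L + a 0 * ((1 - 0) / w)) at_top"
      by (intro tendsto_add tendsto_mult_left lim1 lim2)
    show "\<forall>\<^sub>F T in at_top. ?I T +
        a 0 * ((1 - exp (- (of_real T * w))) / w) = integral {0..T} f"
      using eventually_ge_at_top[of 0]
    proof eventually_elim
      case (elim T)
      have "((\<lambda>u. exp (- (of_real u * w)) * (b r 0 u - a 0) + a 0 * exp (- (of_real u * w))) has_integral
        ?I T +
        a 0 * ((1 - exp (- (of_real T * w))) / w)) {0..T}"
        by (intro has_integral_add has_integral_mult_right int int2 elim)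
      also have "(\<lambda>u. exp (- (of_real u * w)) * (b r 0 u - a 0) + a 0 * exp (- (of_real u * w))) = f"
        by (auto simp: f_def w_def algebra_simps)
      finally show ?case by (simp only: integral_unique)
    qed
  qed
  moreover have "((\<lambda>T. integral {0..T} f) \<longlongrightarrow> integral {0..} f) at_top"
  proof -
    have "((\<lambda>T. LINT x:{0..T}|lebesgue. f x) \<longlongrightarrow> (LINT x:{0..}|lebesgue. f x)) at_top"
      by (rule tendsto_set_lebesgue_integral_at_top) (use abs in auto)
    moreover have "(LINT x:{0..T}|lebesgue. f x) = integral {0..T} f" for T
      by (intro set_lebesgue_integral_eq_integral(2) set_integrable_subset[OF abs]) auto
    ultimately show ?thesis using set_lebesgue_integral_eq_integral(2)[OF abs] by simp
  qed
  ultimately have "integral {0..} f = L + a 0 * ((1 - 0) / w)"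
    using tendsto_unique trivial_limit_at_top_linorder by blast
  \<comment> \<open>L supplies \<epsilon>^2 q 0 \<epsilon>, and the constant a 0 supplies \<epsilon>
    a 0.\<close>
  also have "\<dots> = \<epsilon> * F \<epsilon>" using F_eq[OF \<epsilon>0] \<epsilon>0 by (simp add: L w_def algebra_simps)
  finally show "integral {0..} (\<lambda>s. exp (- (of_real s / \<epsilon>)) * b r 0 s) = \<epsilon> * F \<epsilon>" unfolding f_def .
qed

theorem nevanlinna_sokal:
  obtains g where "\<And>z. norm z < 1 / \<sigma> \<Longrightarrow> g z = (\<Sum>k. 1 / fact k * z ^ k * a k)"
    and "g holomorphic_on half_strip (1 / \<sigma>)"
    and "\<And>\<rho> z. \<rho> < 1 / \<sigma> \<Longrightarrow> z \<in> half_strip \<rho> \<Longrightarrow> norm (g z) \<le> (\<Sum>m. Kterm \<rho> m) * exp (norm z / R)"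
    and "\<And>\<epsilon>. \<epsilon> \<in> ball (of_real (R/2)) (R/2) \<Longrightarrow>
      (\<lambda>s. exp (- (of_real s / \<epsilon>)) * g (of_real s)) absolutely_integrable_on {0..}"
    and "\<And>\<epsilon>. \<epsilon> \<in> ball (of_real (R/2)) (R/2) \<Longrightarrow>
      F \<epsilon> = 1 / \<epsilon> * integral {0..} (\<lambda>s. exp (- (of_real s / \<epsilon>)) * g (of_real s))"
proof -
  have r: "0 < R/2" "R/2 < R" using R_pos by auto
  have lap: "(\<lambda>s. exp (- (of_real s / \<epsilon>)) * G (R/2) (of_real s)) absolutely_integrable_on {0..} \<and>
      F \<epsilon> = 1 / \<epsilon> * integral {0..} (\<lambda>s. exp (- (of_real s / \<epsilon>)) * G (R/2) (of_real s))"
    if \<epsilon>: "\<epsilon> \<in> ball (of_real (R/2)) (R/2)" for \<epsilon>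
  proof -
    \<comment> \<open>A radius r < R is sought whose tangent disc still contains \<epsilon>. The
      Laplace integral is computed with this r and carried over to \<open>G (R/2)\<close> by
      \<open>G_independent\<close>.\<close>
    have "1 / Re (1 / \<epsilon>) < R" "0 < Re (1 / \<epsilon>)"
      using \<epsilon> R_pos Re_inverse_gt_iff[OF R_pos, of \<epsilon>]
      by (smt (verit, best) divide_pos_pos pos_divide_less_eq mult.commute)+
    then obtain r where r': "1 / Re (1 / \<epsilon>) < r" "r < R" using dense by blast
    have r0: "0 < r" using r'(1) \<open>0 < Re (1 / \<epsilon>)\<close> by (smt (verit) divide_pos_pos)
    have "1 / r < Re (1 / \<epsilon>)" using r'(1) r0 \<open>0 < Re (1 / \<epsilon>)\<close> by (simp add: field_simps)
    hence \<epsilon>r: "\<epsilon> \<in> ball (of_real (r/2)) (r/2)" using Re_inverse_gt_iff[OF r0] by blast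
    have "\<epsilon> \<noteq> 0" using \<epsilon> zero_notin_tangent_ball by blast
    have eq: "G (R/2) (of_real s) = b r 0 s" if "s \<in> {0..}" for s
    proof -
      have "of_real s \<in> half_strip (1 / \<sigma>)" using that \<sigma>_pos by (simp add: mem_half_strip_iff)
      thus ?thesis using G_independent[OF r r0 r'(2)] G_of_real[OF r0 r'(2)] that by simp
    qed
    have "(\<lambda>s. exp (- (of_real s / \<epsilon>)) * G (R/2) (of_real s)) absolutely_integrable_on {0..} \<longleftrightarrow>
      (\<lambda>s. exp (- (of_real s / \<epsilon>)) * b r 0 s) absolutely_integrable_on {0..}"
      unfolding absolutely_integrable_on_def
      by (intro conj_cong integrable_cong) (simp_all add: eq)
    moreover have "integral {0..} (\<lambda>s. exp (- (of_real s / \<epsilon>)) * G (R/2) (of_real s)) =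
      integral {0..} (\<lambda>s. exp (- (of_real s / \<epsilon>)) * b r 0 s)"
      by (rule integral_cong) (simp add: eq)
    ultimately show ?thesis using laplace_integral[OF r0 r'(2) \<epsilon>r] \<open>\<epsilon> \<noteq> 0\<close> by simp
  qed
  show thesis
    by (rule that[of "G (R/2)"]) (use r G_series G_holomorphic norm_G_le lap in blast)+
qed

lemma summable_borel: "norm z < 1 / \<sigma> \<Longrightarrow> summable (\<lambda>k. 1 / fact k * z ^ k * a k)"
  using summable_norm_cancel[OF summable_norm_P[of "R/2" 0 z]] R_pos by (simp add: b_0 mult_ac)

end

section \<open>Fourier series of real-analytic functions\<close>

lemma summable_on_exp_abs:
  assumes "\<xi> > 0" shows "(\<lambda>\<nu>::int. exp (- \<xi> * \<bar>real_of_int \<nu>\<bar>)) summable_on UNIV"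
proof -
  let ?g = "\<lambda>\<nu>::int. exp (- \<xi> * \<bar>real_of_int \<nu>\<bar>)"
  have eq: "exp (- \<xi> * real n) = exp (- \<xi>) ^ n" for n
    by (simp add: exp_of_nat_mult[symmetric] mult.commute)
  have "summable (\<lambda>n. exp (- \<xi>) ^ n)" using assms by (intro summable_geometric) simp
  hence s: "(\<lambda>n::nat. exp (- \<xi> * real n)) summable_on UNIV"
    unfolding eq by (intro summable_nonneg_imp_summable_on) auto
  have "?g summable_on range int" using s by (subst summable_on_reindex) (auto simp: o_def)
  moreover have "?g summable_on range (\<lambda>n. - int n)"
    using s by (subst summable_on_reindex) (auto simp: o_def inj_on_def)
  ultimately have "?g summable_on (range int \<union> range (\<lambda>n. - int n))" by (rule summable_on_union)
  moreover have "range int \<union> range (\<lambda>n. - int n) = UNIV"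
    by (auto simp: image_iff) (metis int_cases2)
  ultimately show ?thesis by simp
qed

lemma periodic_int_shift:
  fixes f :: "real \<Rightarrow> 'a"
  assumes "\<And>x. f (x + p) = f x" shows "f (x + of_int n * p) = f x"
proof (induction n rule: int_induct[where k = 0])
  case (step1 i)
  thus ?case using assms[of "x + of_int i * p"] by (simp add: algebra_simps)
next
  case (step2 i)
  thus ?case using assms[of "x + of_int (i - 1) * p"] by (simp add: algebra_simps)
qed simp

definition strip :: "real \<Rightarrow> complex set" where "strip \<delta> = {z. \<bar>Im z\<bar> < \<delta>}"

lemma open_strip: "open (strip \<delta>)"
  unfolding strip_def by (intro open_Collect_less continuous_intros)

lemma convex_strip: "convex (strip \<delta>)"
proof -
  have "strip \<delta> = {z. Im z < \<delta>} \<inter> {z. Im z > - \<delta>}" by (auto simp: strip_def)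
  thus ?thesis by (metis convex_Int convex_halfspace_Im_gt convex_halfspace_Im_lt)
qed

lemma of_real_in_strip: "\<delta> > 0 \<Longrightarrow> of_real x \<in> strip \<delta>"
  by (simp add: strip_def)

lemma of_real_in_ball_iff: "complex_of_real y \<in> ball (of_real x) d \<longleftrightarrow> \<bar>y - x\<bar> < d"
  by (simp add: dist_real_def abs_minus_commute)

lemma islimpt_of_real_image:
  assumes "open S" "of_real x \<in> S"
  shows "complex_of_real x islimpt (of_real ` UNIV \<inter> S)"
proof (rule islimptI)
  fix T assume T: "complex_of_real x \<in> T" "open T"
  hence "open (S \<inter> T)" "of_real x \<in> S \<inter> T" using assms by auto
  then obtain d where d: "d > 0" "ball (of_real x) d \<subseteq> S \<inter> T" by (rule openE)
  have "complex_of_real (x + d/2) \<in> ball (of_real x) d"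
    using d by (simp add: dist_norm norm_divide)
  thus "\<exists>y\<in>of_real ` UNIV \<inter> S. y \<in> T \<and> y \<noteq> complex_of_real x"
    using d by (intro bexI[of _ "complex_of_real (x + d/2)"]) (auto simp del: of_real_add)
qed

lemma holomorphic_eq_if_eq_on_reals:
  assumes "f holomorphic_on S" "g holomorphic_on S" "open S" "connected S" "of_real x \<in> S"
    and "\<And>y. of_real y \<in> S \<Longrightarrow> f (of_real y) = g (of_real y)" and "w \<in> S"
  shows "f w = g w"
proof -
  have "f w - g w = 0"
    by (rule analytic_continuation[where f = "\<lambda>z. f z - g z" and S = S and U = "of_real ` UNIV \<inter> S" and \<xi> = "of_real x" and w = w])
       (use assms in \<open>auto intro!: holomorphic_intros islimpt_of_real_image\<close>)
  thus ?thesis by simp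
qed

text \<open>Convergence of the real series at a real point farther from x0 than z forces convergence
  at z.\<close>

lemma real_analytic_imp_complex_ball:
  assumes "real_analytic f"
  shows "\<exists>r>0. \<exists>h. h holomorphic_on ball (complex_of_real x0) r \<and> (\<forall>x. \<bar>x - x0\<bar> < r \<longrightarrow> h (of_real x) = of_real (f x))"
proof -
  obtain r a where r: "r > 0" and sums: "\<And>x. \<bar>x - x0\<bar> < r \<Longrightarrow> (\<lambda>n. a n * (x - x0) ^ n) sums f x"
    using assms unfolding real_analytic_def by metis
  define h where "h = (\<lambda>z. \<Sum>n. complex_of_real (a n) * (z - of_real x0) ^ n)"
  have h_sums: "(\<lambda>n. complex_of_real (a n) * (z - of_real x0) ^ n) sums h z" if z: "z \<in> ball (of_real x0) r" for z
  proof -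
    obtain s where s: "norm (z - of_real x0) < s" "s < r" using z dense by (auto simp: dist_norm norm_minus_commute)
    have s0: "s > 0" using s norm_ge_zero[of "z - of_real x0"] by linarith
    have "summable (\<lambda>n. a n * s ^ n)" using sums[of "x0 + s"] s s0 by (auto simp: sums_iff)
    hence "summable (\<lambda>n. complex_of_real (a n * s ^ n))" by (subst summable_of_real_iff)
    hence "summable (\<lambda>n. complex_of_real (a n) * of_real s ^ n)" by simp
    hence "summable (\<lambda>n. complex_of_real (a n) * (z - of_real x0) ^ n)"
      by (rule powser_inside) (use s s0 in simp)
    thus ?thesis unfolding h_def by (rule summable_sums)
  qed
  have "h holomorphic_on ball (of_real x0) r"
    by (rule power_series_holomorphic[OF h_sums])
  moreover have "h (of_real x) = of_real (f x)" if x: "\<bar>x - x0\<bar> < r" for x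
  proof -
    have "(\<lambda>n. complex_of_real (a n) * (of_real x - of_real x0) ^ n) sums of_real (f x)"
      using sums_of_real[OF sums[OF x], where 'a = complex] by simp
    moreover have "complex_of_real x \<in> ball (of_real x0) r"
      using x by (simp add: dist_norm abs_minus_commute flip: of_real_diff)
    ultimately show ?thesis using h_sums sums_unique2 by blast
  qed
  ultimately show ?thesis using r by blast
qed

text \<open>The local extensions have no common radius a priori. The Lebesgue number of the cover of
  one period provides it, and periodicity transports it to every real centre. Overlapping extensions
  agree by the identity theorem, because they agree on the real axis.\<close>

lemma real_analytic_periodic_extension:
  assumes an: "real_analytic f" and per: "\<And>x. f (x + 2 * pi) = f x"
  obtains \<delta> F where "\<delta> > 0" "F holomorphic_on strip \<delta>" "\<And>x. F (of_real x) = of_real (f x)"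
    "\<And>z. z \<in> strip \<delta> \<Longrightarrow> F (z + 2 * pi) = F z"
proof -
  obtain r h where r: "\<And>x0. r x0 > 0" and h: "\<And>x0. h x0 holomorphic_on ball (complex_of_real x0) (r x0)"
    "\<And>x0 x. \<bar>x - x0\<bar> < r x0 \<Longrightarrow> h x0 (of_real x) = of_real (f x)"
    using real_analytic_imp_complex_ball[OF an] by metis
  have "compact (complex_of_real ` {0..2*pi})"
    by (intro compact_continuous_image continuous_intros compact_Icc)
  moreover have "complex_of_real ` {0..2*pi} \<subseteq> \<Union> (range (\<lambda>x0. ball (complex_of_real x0) (r x0)))"
  proof
    fix z assume "z \<in> complex_of_real ` {0..2*pi}"
    then obtain x where "z = of_real x" by blast
    hence "z \<in> ball (of_real x) (r x)" using r by simp
    thus "z \<in> \<Union> (range (\<lambda>x0. ball (complex_of_real x0) (r x0)))" by blast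
  qed
  ultimately obtain \<delta> where \<delta>: "\<delta> > 0"
    "\<And>x. x \<in> complex_of_real ` {0..2*pi} \<Longrightarrow> \<exists>G\<in>range (\<lambda>x0. ball (complex_of_real x0) (r x0)). ball x \<delta> \<subseteq> G"
    using Heine_Borel_lemma[of "complex_of_real ` {0..2*pi}" "range (\<lambda>x0. ball (complex_of_real x0) (r x0))"] by blast
  have "\<exists>H. H holomorphic_on ball (complex_of_real x) \<delta> \<and> (\<forall>y. \<bar>y - x\<bar> < \<delta> \<longrightarrow> H (of_real y) = of_real (f y))" for x
  proof -
    define n where "n = \<lfloor>x / (2*pi)\<rfloor>"
    define x' where "x' = x - of_int n * (2*pi)"
    define c where "c = complex_of_real (of_int n * (2*pi))"
    have "of_int n \<le> x / (2*pi)" "x / (2*pi) < of_int n + 1" by (auto simp: n_def)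
    hence "x' \<in> {0..2*pi}" by (auto simp: x'_def field_simps)
    then obtain x0 where x0: "ball (complex_of_real x') \<delta> \<subseteq> ball (of_real x0) (r x0)"
      using \<delta>(2) by blast
    have shift: "z - c \<in> ball (complex_of_real x0) (r x0)" if "z \<in> ball (of_real x) \<delta>" for z :: complex
      by (rule subsetD[OF x0]) (use that in \<open>simp add: x'_def c_def dist_norm algebra_simps\<close>)
    have "(\<lambda>z. h x0 (z - c)) holomorphic_on ball (of_real x) \<delta>"
      by (rule holomorphic_on_compose_gen[OF _ h(1)[of x0], unfolded o_def])
         (use shift in \<open>auto intro!: holomorphic_intros\<close>)
    moreover have "h x0 (of_real y - c) = of_real (f y)" if y: "\<bar>y - x\<bar> < \<delta>" for y
    proof -
      have "complex_of_real y \<in> ball (of_real x) \<delta>"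
        using y by (simp only: of_real_in_ball_iff)
      hence "complex_of_real (y - of_int n * (2*pi)) \<in> ball (of_real x0) (r x0)"
        using shift[of "of_real y"] by (simp add: c_def)
      hence "\<bar>(y - of_int n * (2*pi)) - x0\<bar> < r x0"
        by (simp only: of_real_in_ball_iff)
      hence "h x0 (of_real (y - of_int n * (2*pi))) = of_real (f (y - of_int n * (2*pi)))" by (rule h(2))
      also have "f (y - of_int n * (2*pi)) = f y"
        using periodic_int_shift[of f "2*pi" y "-n", OF per] by simp
      finally show ?thesis by (simp add: c_def)
    qed
    ultimately show ?thesis by (intro exI[of _ "\<lambda>z. h x0 (z - c)"] conjI allI impI)
  qed
  then obtain H where H: "\<And>x. H x holomorphic_on ball (complex_of_real x) \<delta>"
    "\<And>x y. \<bar>y - x\<bar> < \<delta> \<Longrightarrow> H x (of_real y) = of_real (f y)" by metis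
  \<comment> \<open>The centre is the nearest real point and varies with z; \<open>F_eq\<close>
    allows it to be frozen locally.\<close>
  define F where "F = (\<lambda>z. H (Re z) z)"
  have F_eq: "F z = H x z" if "\<bar>Re z - x\<bar> < \<delta>" "z \<in> ball (of_real x) \<delta>" "z \<in> strip \<delta>" for x z
    unfolding F_def
  proof (rule holomorphic_eq_if_eq_on_reals[where f = "H (Re z)" and g = "H x" and w = z and S = "ball (of_real (Re z)) \<delta> \<inter> ball (of_real x) \<delta>" and x = "Re z"])
    show "connected (ball (complex_of_real (Re z)) \<delta> \<inter> ball (of_real x) \<delta>)"
      by (intro convex_connected convex_Int convex_ball)
    have "norm (of_real (Re z) - z) = \<bar>Im z\<bar>" by (simp add: cmod_def)
    thus "z \<in> ball (complex_of_real (Re z)) \<delta> \<inter> ball (of_real x) \<delta>"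
      using that by (simp add: strip_def dist_norm)
    show "complex_of_real (Re z) \<in> ball (of_real (Re z)) \<delta> \<inter> ball (of_real x) \<delta>"
      using that \<delta>(1) by (simp add: dist_norm abs_minus_commute flip: of_real_diff)
    show "H (Re z) (of_real y) = H x (of_real y)" if "complex_of_real y \<in> ball (of_real (Re z)) \<delta> \<inter> ball (of_real x) \<delta>" for y
      using that by (simp add: H(2) dist_norm abs_minus_commute flip: of_real_diff)
  qed (auto intro: holomorphic_on_subset[OF H(1)])
  have hol: "F holomorphic_on strip \<delta>"
    unfolding holomorphic_on_def
  proof
    fix z0 assume z0: "z0 \<in> strip \<delta>"
    let ?x = "Re z0"
    have z0': "z0 \<in> ball (complex_of_real ?x) \<delta>" using z0 by (simp add: strip_def dist_norm cmod_def)
    then obtain D where "(H ?x has_field_derivative D) (at z0)"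
      using H(1) by (metis field_differentiable_def holomorphic_on_imp_differentiable_at open_ball)
    hence "(F has_field_derivative D) (at z0)"
    proof (rule has_field_derivative_transform_within_open)
      show "open (ball (complex_of_real ?x) \<delta> \<inter> strip \<delta>)" by (intro open_Int open_ball open_strip)
      fix z assume z: "z \<in> ball (complex_of_real ?x) \<delta> \<inter> strip \<delta>"
      have "\<bar>Re z - ?x\<bar> < \<delta>" using z abs_Re_le_cmod[of "of_real ?x - z"] by (auto simp: dist_norm)
      thus "H ?x z = F z" using z F_eq by simp
    qed (use z0 z0' in auto)
    thus "F field_differentiable at z0 within strip \<delta>"
      using field_differentiable_at_within field_differentiable_def by blast
  qed
  have real: "F (of_real x) = of_real (f x)" for x using H(2)[of x x] \<delta>(1) by (simp add: F_def)
  have "F (z + 2 * pi) = F z" if z: "z \<in> strip \<delta>" for z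
  proof (rule holomorphic_eq_if_eq_on_reals[where S = "strip \<delta>" and x = 0 and f = "\<lambda>z. F (z + 2 * pi)" and g = F and w = z])
    show "(\<lambda>z. F (z + 2 * pi)) holomorphic_on strip \<delta>"
      by (rule holomorphic_on_compose_gen[OF _ hol, unfolded o_def])
         (auto intro!: holomorphic_intros simp: strip_def)
    show "connected (strip \<delta>)" by (rule convex_connected[OF convex_strip])
    show "F (complex_of_real y + 2 * pi) = F (of_real y)" for y
      using real[of "y + 2 * pi"] real[of y] per by simp
  qed (use hol open_strip z \<delta>(1) in \<open>auto simp: strip_def\<close>)
  thus thesis using that[OF \<delta>(1) hol real] by blast
qed

section \<open>Decay of Fourier coefficients and pointwise inversion\<close>

definition cfourier :: "(complex \<Rightarrow> complex) \<Rightarrow> int \<Rightarrow> complex" where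
  "cfourier F \<nu> = integral {0..2*pi} (\<lambda>x. exp (- (\<i> * of_int \<nu> * of_real x)) * F (of_real x)) / of_real (2*pi)"

text \<open>With a primitive H of g, the integral at height y is the increment of H over one period,
  and this increment is constant in the strip because its derivative g(z + 2 pi) - g(z)
  vanishes.\<close>

lemma integral_horizontal_shift:
  assumes hol: "g holomorphic_on strip \<delta>" and per: "\<And>z. z \<in> strip \<delta> \<Longrightarrow> g (z + 2 * pi) = g z"
    and y: "\<bar>y\<bar> < \<delta>"
  shows "integral {0..2*pi} (\<lambda>x. g (of_real x + \<i> * of_real y)) = integral {0..2*pi} (\<lambda>x. g (of_real x))"
proof -
  have \<delta>: "\<delta> > 0" using y by simp
  obtain H where H: "\<And>z. z \<in> strip \<delta> \<Longrightarrow> (H has_field_derivative g z) (at z)"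
  proof (rule holomorphic_convex_primitive'[OF convex_strip open_strip hol])
    fix H assume a: "\<And>x. x \<in> strip \<delta> \<Longrightarrow> (H has_field_derivative g x) (at x within strip \<delta>)"
    show thesis by (rule that[of H]) (use a at_within_open[OF _ open_strip] in force)
  qed
  have FTC: "integral {0..2*pi} (\<lambda>x. g (of_real x + \<i> * of_real y)) = H (2 * pi + \<i> * of_real y) - H (0 + \<i> * of_real y)"
    if y: "\<bar>y\<bar> < \<delta>" for y
  proof (rule integral_unique)
    have "((\<lambda>x. H (of_real x + \<i> * of_real y)) has_vector_derivative g (of_real x + \<i> * of_real y)) (at x within {0..2*pi})" for x
    proof -
      have "(H has_field_derivative g (of_real x + \<i> * of_real y)) (at (of_real x + \<i> * of_real y))"
        using y by (intro H) (simp add: strip_def)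
      moreover have "((\<lambda>z. z + \<i> * of_real y) has_field_derivative 1) (at (complex_of_real x))"
        by (auto intro!: derivative_eq_intros)
      ultimately have "((\<lambda>z. H (z + \<i> * of_real y)) has_field_derivative g (of_real x + \<i> * of_real y) * 1) (at (complex_of_real x))"
        by (rule DERIV_chain2)
      thus ?thesis by (intro has_vector_derivative_real_field) simp
    qed
    thus "((\<lambda>x. g (of_real x + \<i> * of_real y)) has_integral H (2 * pi + \<i> * of_real y) - H (0 + \<i> * of_real y)) {0..2*pi}"
      using fundamental_theorem_of_calculus[of 0 "2*pi" "\<lambda>x. H (of_real x + \<i> * of_real y)"] by simp
  qed
  have "\<exists>c. \<forall>z\<in>strip \<delta>. H (z + 2 * pi) - H z = c"
  proof (rule has_field_derivative_zero_constant[OF convex_strip])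
    fix z assume z: "z \<in> strip \<delta>"
    hence z': "z + 2 * pi \<in> strip \<delta>" by (simp add: strip_def)
    have "((\<lambda>z. H (z + 2 * pi)) has_field_derivative g (z + 2 * pi) * 1) (at z)"
      by (rule DERIV_chain2[where g = "\<lambda>z::complex. z + 2 * pi", OF H[OF z']]) (auto intro!: derivative_eq_intros)
    hence "((\<lambda>z. H (z + 2 * pi) - H z) has_field_derivative g (z + 2 * pi) * 1 - g z) (at z)"
      by (intro DERIV_diff H z)
    thus "((\<lambda>z. H (z + 2 * pi) - H z) has_field_derivative 0) (at z within strip \<delta>)"
      using per[OF z] has_field_derivative_at_within by force
  qed
  then obtain c where c: "\<And>z. z \<in> strip \<delta> \<Longrightarrow> H (z + 2 * pi) - H z = c" by blast
  have "integral {0..2*pi} (\<lambda>x. g (of_real x + \<i> * of_real y)) = c"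
    unfolding FTC[OF y] using c[of "\<i> * of_real y"] y by (simp add: strip_def add.commute)
  moreover have "integral {0..2*pi} (\<lambda>x. g (of_real x + \<i> * of_real 0)) = c"
    using FTC[of 0] c[of 0] \<delta> by (simp add: strip_def)
  ultimately show ?thesis by simp
qed

text \<open>Moving the line of integration to height -\<eta> for \<nu> \<ge> 0, and to \<eta>
  otherwise, makes the modulus of the exponential equal to exp(-\<eta>|\<nu>|).\<close>

lemma cfourier_decay:
  assumes hol: "F holomorphic_on strip \<delta>" and per: "\<And>z. z \<in> strip \<delta> \<Longrightarrow> F (z + 2 * pi) = F z"
    and \<eta>: "0 < \<eta>" "\<eta> < \<delta>"
  shows "\<exists>M. \<forall>\<nu>. norm (cfourier F \<nu>) \<le> M * exp (- \<eta> * \<bar>of_int \<nu>\<bar>)"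
proof -
  have cont: "continuous_on {0..2*pi} (\<lambda>x. F (of_real x + \<i> * of_real y))" if "\<bar>y\<bar> < \<delta>" for y
    by (intro continuous_on_compose2[OF holomorphic_on_imp_continuous_on[OF hol]] continuous_intros)
       (use that in \<open>auto simp: strip_def\<close>)
  have "\<exists>M. \<forall>x\<in>{0..2*pi}. norm (F (of_real x + \<i> * of_real y)) \<le> M" if "\<bar>y\<bar> < \<delta>" for y
    using compact_imp_bounded[OF compact_continuous_image[OF cont[OF that] compact_Icc]]
    by (auto simp: bounded_iff)
  from this[of \<eta>] this[of "-\<eta>"] \<eta> obtain M1 M2 where
    "\<forall>x\<in>{0..2*pi}. norm (F (of_real x + \<i> * of_real \<eta>)) \<le> M1"
    "\<forall>x\<in>{0..2*pi}. norm (F (of_real x + \<i> * of_real (-\<eta>))) \<le> M2" by auto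
  hence M: "norm (F (of_real x + \<i> * of_real y)) \<le> max M1 M2" if "x \<in> {0..2*pi}" "y = \<eta> \<or> y = - \<eta>" for x y
    using that by (metis max.coboundedI1 max.coboundedI2)
  have "norm (cfourier F \<nu>) \<le> max M1 M2 * exp (- \<eta> * \<bar>of_int \<nu>\<bar>)" for \<nu>
  proof -
    define y where "y = (if \<nu> \<ge> 0 then - \<eta> else \<eta>)"
    define g where "g = (\<lambda>z. exp (- (\<i> * of_int \<nu> * z)) * F z)"
    have y: "\<bar>y\<bar> < \<delta>" "y = \<eta> \<or> y = - \<eta>" using \<eta> by (auto simp: y_def)
    have "g holomorphic_on strip \<delta>" unfolding g_def by (intro holomorphic_intros hol)
    moreover have "g (z + 2 * pi) = g z" if "z \<in> strip \<delta>" for z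
    proof -
      have "exp (- (\<i> * of_int \<nu> * (z + 2 * pi))) = exp (- (\<i> * of_int \<nu> * z)) * exp (of_int (2 * (-\<nu>)) * of_real pi * \<i>)"
        by (simp add: exp_add[symmetric] algebra_simps)
      also have "exp (of_int (2 * (-\<nu>)) * of_real pi * \<i>) = 1"
        using exp_integer_2pi[of "of_int (-\<nu>)"] by (simp add: mult_ac)
      finally show ?thesis using per[OF that] by (simp add: g_def)
    qed
    ultimately have "integral {0..2*pi} (\<lambda>x. g (of_real x + \<i> * of_real y)) = integral {0..2*pi} (\<lambda>x. g (of_real x))"
      using y(1) by (rule integral_horizontal_shift)
    hence eq: "cfourier F \<nu> = integral {0..2*pi} (\<lambda>x. g (of_real x + \<i> * of_real y)) / of_real (2*pi)"
      by (simp add: cfourier_def g_def)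
    have "norm (integral {0..2*pi} (\<lambda>x. g (of_real x + \<i> * of_real y))) \<le> (max M1 M2 * exp (- \<eta> * \<bar>of_int \<nu>\<bar>)) * (2*pi - 0)"
    proof (rule integral_bound)
      show "continuous_on {0..2*pi} (\<lambda>x. g (of_real x + \<i> * of_real y))"
        unfolding g_def by (intro continuous_intros cont y)
      fix x :: real assume x: "x \<in> {0..2*pi}"
      have "norm (exp (- (\<i> * of_int \<nu> * (of_real x + \<i> * of_real y)))) = exp (- \<eta> * \<bar>of_int \<nu>\<bar>)"
        by (simp add: norm_exp_eq_Re y_def)
      thus "norm (g (of_real x + \<i> * of_real y)) \<le> max M1 M2 * exp (- \<eta> * \<bar>of_int \<nu>\<bar>)"
        using M[OF x y(2)] unfolding g_def norm_mult by (simp add: mult.commute mult_left_mono)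
    qed simp
    thus ?thesis unfolding eq by (simp add: norm_divide divide_le_eq mult_ac)
  qed
  thus ?thesis by blast
qed

lemma exp_i_eq_1_iff: "exp (\<i> * (z - of_real \<psi>)) = 1 \<longleftrightarrow> (\<exists>n::int. z = of_real (\<psi> + of_int n * (2 * pi)))"
proof
  assume "exp (\<i> * (z - of_real \<psi>)) = 1"
  then obtain n :: int where n: "Re (\<i> * (z - of_real \<psi>)) = 0" "Im (\<i> * (z - of_real \<psi>)) = of_int (2 * n) * pi"
    unfolding exp_eq_1 by blast
  have "z = of_real (\<psi> + of_int n * (2 * pi))" using n by (simp add: complex_eq_iff algebra_simps)
  thus "\<exists>n::int. z = of_real (\<psi> + of_int n * (2 * pi))" ..
next
  assume "\<exists>n::int. z = of_real (\<psi> + of_int n * (2 * pi))"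
  then obtain n :: int where "z = of_real (\<psi> + of_int n * (2 * pi))" ..
  thus "exp (\<i> * (z - of_real \<psi>)) = 1"
    unfolding exp_eq_1 by (auto simp: algebra_simps intro!: exI[of _ n])
qed

text \<open>The quotient whose Fourier coefficients telescope to those of \<open>F\<close> (Chernoff's proof of
  pointwise convergence).\<close>
lemma fourier_quotient_holomorphic:
  fixes \<psi> :: real
  assumes hol: "F holomorphic_on strip \<delta>" and per: "\<And>x n. F (of_real (x + of_int n * (2 * pi))) = F (of_real x)"
  defines "h \<equiv> \<lambda>z. if exp (\<i> * (z - of_real \<psi>)) = 1 then deriv F z / \<i>
     else (F z - F (of_real \<psi>)) / (exp (\<i> * (z - of_real \<psi>)) - 1)"
  shows "h holomorphic_on strip \<delta>"
  unfolding holomorphic_on_def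
proof
  fix z0 assume z0: "z0 \<in> strip \<delta>"
  let ?Z = "{z. exp (\<i> * (z - of_real \<psi>)) \<noteq> 1}"
  have openZ: "open ?Z" by (intro open_Collect_neq continuous_intros)
  have hol_off: "h holomorphic_on U" if "U \<subseteq> strip \<delta> \<inter> ?Z" for U
  proof -
    have "(\<lambda>z. (F z - F (of_real \<psi>)) / (exp (\<i> * (z - of_real \<psi>)) - 1)) holomorphic_on U"
      using that by (intro holomorphic_intros holomorphic_on_subset[OF hol]) auto
    thus ?thesis by (rule holomorphic_transform) (use that in \<open>auto simp: h_def\<close>)
  qed
  have "\<exists>U. open U \<and> z0 \<in> U \<and> h holomorphic_on U"
  proof (cases "z0 \<in> ?Z")
    case True
    thus ?thesis using hol_off[of "strip \<delta> \<inter> ?Z"] z0 openZ open_strip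
      by (intro exI[of _ "strip \<delta> \<inter> ?Z"]) auto
  next
    case False
    then obtain n :: int where n: "z0 = of_real (\<psi> + of_int n * (2 * pi))"
      using exp_i_eq_1_iff[of z0 \<psi>] by auto
    obtain \<rho> where \<rho>: "\<rho> > 0" "ball z0 \<rho> \<subseteq> strip \<delta>" using openE[OF open_strip z0] .
    \<comment> \<open>Radius at most 1 keeps the other zeros of the denominator, at distance at
      least 2 pi, out of the disc.\<close>
    define U where "U = ball z0 (min \<rho> 1)"
    have U: "open U" "z0 \<in> U" "U \<subseteq> strip \<delta>" using \<rho> by (auto simp: U_def)
    have UZ: "U - {z0} \<subseteq> ?Z"
    proof
      fix z assume z: "z \<in> U - {z0}"
      show "z \<in> ?Z"
      proof (rule ccontr)
        assume "z \<notin> ?Z"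
        then obtain m :: int where m: "z = of_real (\<psi> + of_int m * (2 * pi))"
          using exp_i_eq_1_iff[of z \<psi>] by auto
        have "z - z0 = of_real (of_int (m - n) * (2 * pi))" by (simp add: m n algebra_simps)
        hence "norm (z - z0) = \<bar>of_int (m - n)\<bar> * (2 * pi)" by (simp only: norm_of_real abs_mult) simp
        moreover have "m \<noteq> n" using z m n by auto
        hence "1 * (2 * pi) \<le> \<bar>of_int (m - n)\<bar> * (2 * pi)" by (intro mult_right_mono) auto
        moreover have "norm (z - z0) < 1" using z by (simp add: U_def dist_norm norm_minus_commute)
        ultimately show False using pi_gt3 by linarith
      qed
    qed
    have "h holomorphic_on U"
    proof (rule no_isolated_singularity[where K = "{z0}"])
      show hol': "h holomorphic_on U - {z0}" using hol_off[of "U - {z0}"] UZ U by auto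
      \<comment> \<open>The singularity is removable: near z0 the function is a quotient of two
        difference quotients, with limit F'(z0)/i.\<close>
      have "h \<midarrow>z0\<rightarrow> h z0"
      proof (rule Lim_transform_eventually)
        have "(F has_field_derivative deriv F z0) (at z0)"
          using hol z0 open_strip by (meson holomorphic_derivI)
        moreover have "((\<lambda>z. exp (\<i> * (z - of_real \<psi>))) has_field_derivative exp (\<i> * (z0 - of_real \<psi>)) * \<i>) (at z0)"
          by (auto intro!: derivative_eq_intros)
        ultimately have "((\<lambda>z. ((F z - F z0) / (z - z0)) / ((exp (\<i> * (z - of_real \<psi>)) - exp (\<i> * (z0 - of_real \<psi>))) / (z - z0)))
           \<longlongrightarrow> deriv F z0 / (exp (\<i> * (z0 - of_real \<psi>)) * \<i>)) (at z0)"
          unfolding has_field_derivative_iff by (intro tendsto_divide) auto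
        thus "((\<lambda>z. ((F z - F z0) / (z - z0)) / ((exp (\<i> * (z - of_real \<psi>)) - exp (\<i> * (z0 - of_real \<psi>))) / (z - z0)))
           \<longlongrightarrow> h z0) (at z0)" using False by (simp add: h_def)
        have "\<forall>\<^sub>F z in at z0. z \<in> U - {z0}"
          using U eventually_at_in_open by blast
        thus "\<forall>\<^sub>F z in at z0. ((F z - F z0) / (z - z0)) / ((exp (\<i> * (z - of_real \<psi>)) - exp (\<i> * (z0 - of_real \<psi>))) / (z - z0)) = h z"
        proof eventually_elim
          case (elim z)
          hence "z \<in> ?Z" "z - z0 \<noteq> 0" using UZ by auto
          thus ?case using False per[of \<psi> n] by (simp add: h_def n)
        qed
      qed
      hence "isCont h z0" by (simp add: isCont_def)
      moreover have "isCont h z" if "z \<in> U - {z0}" for z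
        using holomorphic_on_imp_continuous_on[OF hol'] that U(1)
        by (metis continuous_on_eq_continuous_at open_delete)
      ultimately show "continuous_on U h" by (metis Diff_iff continuous_at_imp_continuous_on singletonD)
    qed (use U in auto)
    thus ?thesis using U by blast
  qed
  thus "h field_differentiable at z0 within strip \<delta>"
    by (meson field_differentiable_at_within holomorphic_on_imp_differentiable_at)
qed

lemma cfourier_1: "integral {0..2*pi} (\<lambda>x. exp (- (\<i> * of_int \<nu> * complex_of_real x))) = (if \<nu> = 0 then of_real (2 * pi) else 0)"
proof (cases "\<nu> = 0")
  case False
  have "((\<lambda>x. exp (- (\<i> * of_int \<nu> * complex_of_real x))) has_integral
    exp (- (\<i> * of_int \<nu> * complex_of_real (2*pi))) / (- (\<i> * of_int \<nu>)) - exp (- (\<i> * of_int \<nu> * complex_of_real 0)) / (- (\<i> * of_int \<nu>))) {0..2*pi}"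
    by (rule fundamental_theorem_of_calculus)
      (use False in \<open>auto intro!: derivative_eq_intros has_vector_derivative_real_field\<close>)
  moreover have "exp (- (\<i> * of_int \<nu> * complex_of_real (2*pi))) = 1"
    using exp_integer_2pi[of "of_int (-\<nu>)"] by (simp add: mult_ac)
  ultimately show ?thesis using False by (simp add: integral_unique)
qed (simp add: scaleR_conv_of_real)

lemma tendsto_exp_minus_int:
  assumes "\<eta> > 0" "filterlim k at_top sequentially"
  shows "(\<lambda>n. M * exp (- \<eta> * real (k n))) \<longlonglongrightarrow> 0"
proof -
  have "((\<lambda>n. exp (- \<eta> * real (k n))) \<longlonglongrightarrow> 0)"
    by (intro filterlim_compose[OF exp_at_bot] filterlim_tendsto_neg_mult_at_bot[OF tendsto_const])
       (use assms filterlim_compose[OF filterlim_real_sequentially] in auto)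
  from tendsto_mult_left[OF this, of M] show ?thesis by simp
qed

text \<open>From F(x) - F(\<psi>) = h(x)(exp(i(x - \<psi>)) - 1), the coefficients of F - F(\<psi>)
  times their phases at \<psi> are differences D(\<nu> - 1) - D(\<nu>) built from h. Symmetric
  partial sums telescope to two boundary terms, which decay exponentially because h is holomorphic
  in the strip.\<close>

lemma fourier_inversion:
  assumes \<delta>: "\<delta> > 0" and hol: "F holomorphic_on strip \<delta>" and per: "\<And>z. z \<in> strip \<delta> \<Longrightarrow> F (z + 2 * pi) = F z"
  shows "((\<lambda>\<nu>. exp (\<i> * of_int \<nu> * of_real \<psi>) * cfourier F \<nu>) has_sum F (of_real \<psi>)) UNIV"
proof -
  let ?p = "\<lambda>\<nu>. exp (\<i> * of_int \<nu> * of_real \<psi>)"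
  let ?S = "\<lambda>n. \<Sum>\<nu>\<in>{- int n..int n}. exp (\<i> * of_int \<nu> * of_real \<psi>) * cfourier F \<nu>"
  define h where "h = (\<lambda>z. if exp (\<i> * (z - of_real \<psi>)) = 1 then deriv F z / \<i>
     else (F z - F (of_real \<psi>)) / (exp (\<i> * (z - of_real \<psi>)) - 1))"
  have per_real: "F (of_real (x + of_int n * (2 * pi))) = F (of_real x)" for x n
    by (rule periodic_int_shift[of "\<lambda>x. F (of_real x)"]) (use per[OF of_real_in_strip[OF \<delta>]] in simp)
  have h_hol: "h holomorphic_on strip \<delta>"
    unfolding h_def by (rule fourier_quotient_holomorphic[OF hol per_real])
  have F_eq: "F (of_real x) - F (of_real \<psi>) = h (of_real x) * exp (\<i> * (of_real x - of_real \<psi>)) - h (of_real x)" for x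
  proof (cases "exp (\<i> * (complex_of_real x - of_real \<psi>)) = 1")
    case True
    then obtain n :: int where "complex_of_real x = of_real (\<psi> + of_int n * (2*pi))"
      using exp_i_eq_1_iff by blast
    thus ?thesis using per_real[of \<psi> n] True by simp
  next
    case False
    hence "h (of_real x) * (exp (\<i> * (of_real x - of_real \<psi>)) - 1) = F (of_real x) - F (of_real \<psi>)"
      by (simp add: h_def)
    thus ?thesis by (simp only: right_diff_distrib mult_1_right)
  qed
  have h_per: "h (z + 2 * pi) = h z" if z: "z \<in> strip \<delta>" for z
  proof -
    have e: "exp (\<i> * (z + 2 * pi - of_real \<psi>)) = exp (\<i> * (z - of_real \<psi>))"
    proof -
      have "exp (\<i> * (z + 2 * pi - of_real \<psi>)) = exp (\<i> * (z - of_real \<psi>) + 2 * of_real pi * \<i>)"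
        by (simp add: algebra_simps)
      thus ?thesis by (simp add: exp_add mult.commute)
    qed
    have "deriv F (z + 2 * pi) = deriv F z"
    proof -
      have z': "z + 2 * pi \<in> strip \<delta>" using z by (simp add: strip_def)
      have "((\<lambda>w. F (w + 2 * pi)) has_field_derivative deriv F (z + 2 * pi) * 1) (at z)"
        by (rule DERIV_chain2[where g = "\<lambda>w::complex. w + 2 * pi", OF holomorphic_derivI[OF hol open_strip z']]) (auto intro!: derivative_eq_intros)
      from this[unfolded mult_1_right] open_strip z have "(F has_field_derivative deriv F (z + 2 * pi)) (at z)"
        by (rule has_field_derivative_transform_within_open) (rule per)
      thus ?thesis by (rule DERIV_imp_deriv[symmetric])
    qed
    thus ?thesis using e per[OF z] by (simp add: h_def)
  qed
  have cont: "continuous_on {0..2*pi} (\<lambda>x. u (of_real x))" if "u holomorphic_on strip \<delta>" for u :: "complex \<Rightarrow> complex"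
    by (intro continuous_on_compose2[OF holomorphic_on_imp_continuous_on[OF that]] continuous_intros)
       (use \<delta> in \<open>auto simp: strip_def\<close>)
  have cancel: "e * (u * w - u) = v * (e' * u) - e * u" if "v * e' = e * w" for e e' u v w :: complex
    using that by (simp add: right_diff_distrib)
  define D where "D = (\<lambda>\<nu>. ?p \<nu> * cfourier h \<nu>)"
  have step: "?p \<nu> * cfourier F \<nu> - (if \<nu> = 0 then F (of_real \<psi>) else 0) = D (\<nu> - 1) - D \<nu>" for \<nu>
  proof -
    let ?e = "\<lambda>\<nu> x. exp (- (\<i> * of_int \<nu> * complex_of_real x))"
    have "integral {0..2*pi} (\<lambda>x. ?e \<nu> x * F (of_real x)) =
      integral {0..2*pi} (\<lambda>x. F (of_real \<psi>) * ?e \<nu> x + (exp (- (\<i> * of_real \<psi>)) * (?e (\<nu> - 1) x * h (of_real x)) - ?e \<nu> x * h (of_real x)))"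
    proof (rule integral_cong)
      fix x
      have "exp (- (\<i> * of_real \<psi>)) * ?e (\<nu> - 1) x = ?e \<nu> x * exp (\<i> * (of_real x - of_real \<psi>))"
        by (simp add: exp_add[symmetric] algebra_simps)
      hence "?e \<nu> x * (h (of_real x) * exp (\<i> * (of_real x - of_real \<psi>)) - h (of_real x)) =
         exp (- (\<i> * of_real \<psi>)) * (?e (\<nu> - 1) x * h (of_real x)) - ?e \<nu> x * h (of_real x)"
        by (rule cancel)
      thus "?e \<nu> x * F (of_real x) = F (of_real \<psi>) * ?e \<nu> x + (exp (- (\<i> * of_real \<psi>)) * (?e (\<nu> - 1) x * h (of_real x)) - ?e \<nu> x * h (of_real x))"
        unfolding F_eq[of x, symmetric] by (simp only: right_diff_distrib mult.commute[of "F (of_real \<psi>)"] diff_eq_eq add.commute)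
    qed
    also have "\<dots> = F (of_real \<psi>) * integral {0..2*pi} (?e \<nu>) + (exp (- (\<i> * of_real \<psi>)) *
        integral {0..2*pi} (\<lambda>x. ?e (\<nu> - 1) x * h (of_real x)) - integral {0..2*pi} (\<lambda>x. ?e \<nu> x * h (of_real x)))"
    proof -
      have i: "(\<lambda>x. ?e \<nu> x) integrable_on {0..2*pi}" "(\<lambda>x. ?e \<nu> x * h (of_real x)) integrable_on {0..2*pi}" for \<nu>
        by (intro integrable_continuous_real continuous_intros cont h_hol)+
      have i2: "(\<lambda>x. F (of_real \<psi>) * ?e \<nu> x) integrable_on {0..2*pi}"
        "(\<lambda>x. exp (- (\<i> * of_real \<psi>)) * (?e (\<nu> - 1) x * h (of_real x))) integrable_on {0..2*pi}"
        by (rule integrable_on_mult_right i)+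
      show ?thesis
        by (simp only: integral_add integral_diff integral_mult_right i i2 integrable_diff)
    qed
    finally have c: "cfourier F \<nu> = F (of_real \<psi>) * (if \<nu> = 0 then 1 else 0) + (exp (- (\<i> * of_real \<psi>)) * cfourier h (\<nu> - 1) - cfourier h \<nu>)"
      unfolding cfourier_def cfourier_1 by (simp add: diff_divide_distrib add_divide_distrib)
    have e: "?p \<nu> * exp (- (\<i> * of_real \<psi>)) = exp (\<i> * of_int (\<nu> - 1) * of_real \<psi>)"
      by (simp add: exp_add[symmetric] algebra_simps)
    have "?p \<nu> * cfourier F \<nu> = ?p \<nu> * (F (of_real \<psi>) * (if \<nu> = 0 then 1 else 0))
       + (D (\<nu> - 1) - D \<nu>)"
      unfolding c D_def e[symmetric] by (simp only: distrib_left right_diff_distrib mult.assoc)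
    thus ?thesis by (cases "\<nu> = 0") simp_all
  qed
  have tele: "?S n - F (of_real \<psi>) = D (- int n - 1) - D (int n)" for n
  proof -
    have "?S n - F (of_real \<psi>) =
       (\<Sum>\<nu>\<in>{- int n..int n}. ?p \<nu> * cfourier F \<nu> - (if \<nu> = 0 then F (of_real \<psi>) else 0))"
      by (simp add: sum_subtractf)
    also have "\<dots> = (\<Sum>\<nu>\<in>{- int n..int n}. D (\<nu> - 1) - D \<nu>)" by (simp only: step)
    also have "\<dots> = D (- int n - 1) - D (int n)"
    proof (induction n)
      case (Suc n)
      have "{- int (Suc n)..int (Suc n)} = insert (- int (Suc n)) (insert (int (Suc n)) {- int n..int n})" by auto
      moreover have "D (- int n - 1) = D (- 1 - int n)" by (rule arg_cong[of _ _ D]) simp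
      ultimately show ?case using Suc by simp
    qed simp
    finally show ?thesis .
  qed
  obtain M where M: "\<And>\<nu>. norm (cfourier h \<nu>) \<le> M * exp (- (\<delta>/2) * \<bar>of_int \<nu>\<bar>)"
    using cfourier_decay[OF h_hol h_per, of "\<delta>/2"] \<delta> by auto
  obtain M' where M': "\<And>\<nu>. norm (cfourier F \<nu>) \<le> M' * exp (- (\<delta>/2) * \<bar>of_int \<nu>\<bar>)"
    using cfourier_decay[OF hol per, of "\<delta>/2"] \<delta> by auto
  have D_bound: "norm (D \<nu>) \<le> M * exp (- (\<delta>/2) * \<bar>of_int \<nu>\<bar>)" for \<nu>
    using M[of \<nu>] by (simp add: D_def norm_mult norm_exp_eq_Re)
  have summ: "(\<lambda>\<nu>. ?p \<nu> * cfourier F \<nu>) summable_on UNIV"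
  proof (rule abs_summable_summable, rule summable_on_comparison_test)
    show "(\<lambda>\<nu>. M' * exp (- (\<delta>/2) * \<bar>real_of_int \<nu>\<bar>)) summable_on UNIV"
      using \<delta> by (intro summable_on_cmult_right summable_on_exp_abs) simp
    show "norm (?p \<nu> * cfourier F \<nu>) \<le> M' * exp (- (\<delta>/2) * \<bar>real_of_int \<nu>\<bar>)" for \<nu>
      using M'[of \<nu>] by (simp add: norm_mult norm_exp_eq_Re)
  qed simp
  define S where "S = infsum (\<lambda>\<nu>. ?p \<nu> * cfourier F \<nu>) UNIV"
  have hs: "((\<lambda>\<nu>. ?p \<nu> * cfourier F \<nu>) has_sum S) UNIV"
    using summ unfolding S_def by (rule has_sum_infsum)
  \<comment> \<open>The unordered sum exists by absolute convergence, so its value may be computed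
    along the symmetric intervals.\<close>
  have "filterlim (\<lambda>n. {- int n..int n}) (finite_subsets_at_top UNIV) sequentially"
    unfolding filterlim_finite_subsets_at_top
  proof (intro allI impI)
    fix X :: "int set" assume X: "finite X \<and> X \<subseteq> UNIV"
    show "\<forall>\<^sub>F n in sequentially. finite {- int n..int n} \<and> X \<subseteq> {- int n..int n} \<and> {- int n..int n} \<subseteq> UNIV"
    proof (rule eventually_sequentiallyI)
      fix n assume n: "n \<ge> nat (\<Sum>x\<in>X. \<bar>x\<bar>)"
      have "\<bar>x\<bar> \<le> int n" if "x \<in> X" for x
        using member_le_sum[of x X abs] that X n by force
      thus "finite {- int n..int n} \<and> X \<subseteq> {- int n..int n} \<and> {- int n..int n} \<subseteq> UNIV" by force
    qed
  qed
  hence "?S \<longlonglongrightarrow> S"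
    using hs unfolding has_sum_def by (rule filterlim_compose[rotated])
  hence l1: "(\<lambda>n. ?S n - F (of_real \<psi>)) \<longlonglongrightarrow> S - F (of_real \<psi>)"
    by (intro tendsto_intros)
  have "(\<lambda>n. D (- int n - 1) - D (int n)) \<longlonglongrightarrow> 0 - 0"
  proof (rule tendsto_diff)
    show "(\<lambda>n. D (- int n - 1)) \<longlonglongrightarrow> 0"
    proof (rule Lim_null_comparison[OF always_eventually])
      show "\<forall>n. norm (D (- int n - 1)) \<le> M * exp (- (\<delta>/2) * real (Suc n))"
      proof
        fix n show "norm (D (- int n - 1)) \<le> M * exp (- (\<delta>/2) * real (Suc n))"
          using D_bound[of "- int n - 1"] by (simp add: algebra_simps)
      qed
      show "(\<lambda>n. M * exp (- (\<delta>/2) * real (Suc n))) \<longlonglongrightarrow> 0"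
        using \<delta> by (intro tendsto_exp_minus_int filterlim_Suc) simp
    qed
    show "(\<lambda>n. D (int n)) \<longlonglongrightarrow> 0"
    proof (rule Lim_null_comparison[OF always_eventually])
      show "\<forall>n. norm (D (int n)) \<le> M * exp (- (\<delta>/2) * real n)" using D_bound by (metis abs_of_nat of_int_of_nat_eq of_int_abs)
      show "(\<lambda>n. M * exp (- (\<delta>/2) * real n)) \<longlonglongrightarrow> 0"
        using \<delta> by (intro tendsto_exp_minus_int filterlim_ident) simp
    qed
  qed
  hence "S - F (of_real \<psi>) = 0 - 0" using l1 unfolding tele using LIMSEQ_unique by blast
  thus ?thesis using hs by simp
qed

theorem real_analytic_fourier:
  assumes an: "real_analytic f" and per: "\<And>x. f (x + 2 * pi) = f x"
  obtains \<xi> M where "\<xi> > 0" "\<And>\<nu>. norm (fourier_coeff f \<nu>) \<le> M * exp (- \<xi> * \<bar>of_int \<nu>\<bar>)"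
    "\<And>\<psi>. ((\<lambda>\<nu>. exp (\<i> * of_int \<nu> * of_real \<psi>) * fourier_coeff f \<nu>) has_sum of_real (f \<psi>)) UNIV"
proof -
  obtain \<delta> F where F: "\<delta> > 0" "F holomorphic_on strip \<delta>" "\<And>x. F (of_real x) = of_real (f x)"
    "\<And>z. z \<in> strip \<delta> \<Longrightarrow> F (z + 2 * pi) = F z"
    using real_analytic_periodic_extension[OF an per] by blast
  have eq: "fourier_coeff f = cfourier F" by (simp add: fun_eq_iff fourier_coeff_def cfourier_def F(3))
  obtain M where M: "\<And>\<nu>. norm (cfourier F \<nu>) \<le> M * exp (- (\<delta>/2) * \<bar>of_int \<nu>\<bar>)"
    using cfourier_decay[OF F(2,4), of "\<delta>/2"] F(1) by auto
  show thesis
  proof (rule that[of "\<delta>/2" M])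
    show "((\<lambda>\<nu>. exp (\<i> * of_int \<nu> * of_real \<psi>) * fourier_coeff f \<nu>) has_sum of_real (f \<psi>)) UNIV" for \<psi>
      using fourier_inversion[OF F(1,2,4), of \<psi>] by (simp add: eq F(3))
  qed (use F(1) M eq in auto)
qed

section \<open>A weighted Wiener algebra and majorants\<close>

lemma has_sum_sum_finite:
  fixes f :: "'i \<Rightarrow> 'a \<Rightarrow> 'b :: topological_comm_monoid_add"
  assumes "finite I" "\<And>i. i \<in> I \<Longrightarrow> (f i has_sum S i) A"
  shows "((\<lambda>x. \<Sum>i\<in>I. f i x) has_sum (\<Sum>i\<in>I. S i)) A"
  using assms by (induction I rule: finite_induct) (auto intro: has_sum_add)

definition weight :: "real \<Rightarrow> int \<Rightarrow> real" where
  "weight \<xi> \<nu> = exp (\<xi> * \<bar>of_int \<nu>\<bar>)"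

text \<open>An infinite sum that does not exist has the value 0, so a bound on \<open>wnorm\<close>
  is meaningful only together with this predicate; the two are carried side by side.\<close>

definition weighted_summable :: "real \<Rightarrow> (int \<Rightarrow> complex) \<Rightarrow> bool" where
  "weighted_summable \<xi> u \<longleftrightarrow> (\<lambda>\<nu>. norm (u \<nu>) * weight \<xi> \<nu>) summable_on UNIV"

definition wnorm :: "real \<Rightarrow> (int \<Rightarrow> complex) \<Rightarrow> real" where
  "wnorm \<xi> u = (\<Sum>\<^sub>\<infinity>\<nu>. norm (u \<nu>) * weight \<xi> \<nu>)"

lemma weight_pos [simp]: "weight \<xi> \<nu> > 0" and weight_nonneg [simp]: "weight \<xi> \<nu> \<ge> 0"
  by (simp_all add: weight_def)

lemma weight_0 [simp]: "weight 0 \<nu> = 1" "weight \<xi> 0 = 1"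
  by (simp_all add: weight_def)

lemma weight_mono: "\<xi>' \<le> \<xi> \<Longrightarrow> weight \<xi>' \<nu> \<le> weight \<xi> \<nu>"
  by (simp add: weight_def mult_right_mono)

text \<open>By the triangle inequality for |\<nu>|. This makes the weighted sequences an algebra
  under convolution.\<close>

lemma weight_add_le: "0 \<le> \<xi> \<Longrightarrow> weight \<xi> \<nu> \<le> weight \<xi> a * weight \<xi> (\<nu> - a)"
proof -
  assume "0 \<le> \<xi>"
  moreover have "\<bar>real_of_int \<nu>\<bar> \<le> \<bar>of_int a\<bar> + \<bar>of_int (\<nu> - a)\<bar>" by simp
  ultimately have "\<xi> * \<bar>of_int \<nu>\<bar> \<le> \<xi> * (\<bar>of_int a\<bar> + \<bar>of_int (\<nu> - a)\<bar>)" by (rule mult_left_mono[rotated])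
  thus ?thesis by (simp add: weight_def exp_add[symmetric] distrib_left)
qed

lemma has_sum_wnorm: "weighted_summable \<xi> u \<Longrightarrow> ((\<lambda>\<nu>. norm (u \<nu>) * weight \<xi> \<nu>) has_sum wnorm \<xi> u) UNIV"
  by (simp add: weighted_summable_def wnorm_def)

lemma wnorm_nonneg: "wnorm \<xi> u \<ge> 0"
  by (simp add: wnorm_def infsum_nonneg)

lemma wnorm_le_has_sum:
  assumes "(g has_sum B) UNIV" "\<And>\<nu>. norm (v \<nu>) * weight \<xi> \<nu> \<le> g \<nu>"
  shows "weighted_summable \<xi> v" "wnorm \<xi> v \<le> B"
proof -
  show s: "weighted_summable \<xi> v" unfolding weighted_summable_def
    by (rule summable_on_comparison_test[OF has_sum_imp_summable[OF assms(1)]]) (use assms(2) in auto)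
  show "wnorm \<xi> v \<le> B" by (rule has_sum_mono[OF has_sum_wnorm[OF s] assms(1)]) (rule assms(2))
qed

lemma wnorm_le_finite_sums:
  assumes "\<And>X. finite X \<Longrightarrow> (\<Sum>\<nu>\<in>X. norm (u \<nu>) * weight \<xi> \<nu>) \<le> B"
  shows "weighted_summable \<xi> u" "wnorm \<xi> u \<le> B"
proof -
  show s: "weighted_summable \<xi> u" unfolding weighted_summable_def
    by (rule nonneg_bdd_above_summable_on) (use assms in \<open>auto intro!: bdd_aboveI2\<close>)
  show "wnorm \<xi> u \<le> B" unfolding wnorm_def
    by (rule infsum_le_finite_sums[OF s[unfolded weighted_summable_def]]) (use assms in auto)
qed

lemma wnorm_mono:
  assumes "\<xi>' \<le> \<xi>" "weighted_summable \<xi> u"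
  shows "weighted_summable \<xi>' u" "wnorm \<xi>' u \<le> wnorm \<xi> u"
  by (rule wnorm_le_has_sum[OF has_sum_wnorm[OF assms(2)]]; rule mult_left_mono[OF weight_mono[OF assms(1)]]; simp)+

lemma wnorm_dominated:
  assumes "weighted_summable \<xi> u" "\<And>\<nu>. norm (v \<nu>) * weight \<xi>' \<nu> \<le> C * (norm (u \<nu>) * weight \<xi> \<nu>)"
  shows "weighted_summable \<xi>' v" "wnorm \<xi>' v \<le> C * wnorm \<xi> u"
  by (rule wnorm_le_has_sum[OF has_sum_cmult_right[OF has_sum_wnorm[OF assms(1)]] assms(2)])+

lemma norm_le_wnorm:
  assumes "weighted_summable \<xi> u" shows "norm (u \<nu>) * weight \<xi> \<nu> \<le> wnorm \<xi> u"
  using finite_sum_le_infsum[OF assms[unfolded weighted_summable_def], of "{\<nu>}"] by (simp add: wnorm_def)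

lemma wnorm_single:
  "weighted_summable \<xi> (\<lambda>\<nu>. if \<nu> = 0 then c else 0)" "wnorm \<xi> (\<lambda>\<nu>. if \<nu> = 0 then c else 0) = norm c"
proof -
  have "((\<lambda>\<nu>::int. norm (if \<nu> = 0 then c else 0) * weight \<xi> \<nu>) has_sum norm c) UNIV"
    by (rule has_sum_finite_neutralI[of "{0}"]) auto
  thus "weighted_summable \<xi> (\<lambda>\<nu>. if \<nu> = 0 then c else 0)" "wnorm \<xi> (\<lambda>\<nu>. if \<nu> = 0 then c else 0) = norm c"
    by (auto simp: weighted_summable_def wnorm_def has_sum_iff)
qed

lemma wnorm_add:
  assumes "weighted_summable \<xi> u" "weighted_summable \<xi> v"
  shows "weighted_summable \<xi> (\<lambda>\<nu>. u \<nu> + v \<nu>)" "wnorm \<xi> (\<lambda>\<nu>. u \<nu> + v \<nu>) \<le> wnorm \<xi> u + wnorm \<xi> v"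
  by (rule wnorm_le_has_sum[OF has_sum_add[OF has_sum_wnorm[OF assms(1)] has_sum_wnorm[OF assms(2)]]];
      simp add: distrib_right[symmetric] mult_right_mono norm_triangle_ineq)+

lemma wnorm_scale:
  assumes "weighted_summable \<xi> u"
  shows "weighted_summable \<xi> (\<lambda>\<nu>. c * u \<nu>)" "wnorm \<xi> (\<lambda>\<nu>. c * u \<nu>) \<le> norm c * wnorm \<xi> u"
  by (rule wnorm_dominated[OF assms, of _ _ "norm c"]; simp add: norm_mult)+

lemma weighted_summable_diff:
  "weighted_summable \<xi> u \<Longrightarrow> weighted_summable \<xi> v \<Longrightarrow> weighted_summable \<xi> (\<lambda>\<nu>. u \<nu> - v \<nu>)"
  using wnorm_add(1)[of \<xi> u "\<lambda>\<nu>. (-1) * v \<nu>"] wnorm_scale(1)[of \<xi> v "-1"] by simp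

lemma weighted_summable_sum:
  "finite I \<Longrightarrow> (\<And>i. i \<in> I \<Longrightarrow> weighted_summable \<xi> (u i)) \<Longrightarrow> weighted_summable \<xi> (\<lambda>\<nu>. \<Sum>i\<in>I. u i \<nu>)"
proof (induction I rule: finite_induct)
  case empty
  thus ?case using wnorm_single(1)[of \<xi> 0] by simp
qed (use wnorm_add(1) in auto)

text \<open>Only finitely many \<nu> are summed at a time. That finite sum moves inside the infinite
  sum over a without any exchange of infinite sums, and each shifted finite sum of V is at most
  \<open>wnorm \<xi> v\<close>.\<close>

lemma
  assumes \<xi>: "0 \<le> \<xi>" and u: "weighted_summable \<xi> u" and v: "weighted_summable \<xi> v"
  shows abs_summable_conv: "(\<lambda>a. norm (u a * v (\<nu> - a))) summable_on UNIV"
    and weighted_summable_conv: "weighted_summable \<xi> (fourier_conv u v)"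
    and wnorm_conv_le: "wnorm \<xi> (fourier_conv u v) \<le> wnorm \<xi> u * wnorm \<xi> v"
proof -
  define U where "U = (\<lambda>a. norm (u a) * weight \<xi> a)"
  define V where "V = (\<lambda>a. norm (v a) * weight \<xi> a)"
  have nn: "U a \<ge> 0" "V a \<ge> 0" for a by (simp_all add: U_def V_def)
  have V_le: "(\<Sum>\<nu>\<in>X. V (\<nu> - a)) \<le> wnorm \<xi> v" if "finite X" for X a
  proof -
    have "(\<Sum>\<nu>\<in>X. V (\<nu> - a)) = sum V ((\<lambda>\<nu>. \<nu> - a) ` X)" by (subst sum.reindex) (auto simp: inj_on_def)
    also have "\<dots> \<le> wnorm \<xi> v"
    proof -
      have "V summable_on UNIV" "infsum V UNIV = wnorm \<xi> v"
        using v by (simp_all add: V_def weighted_summable_def wnorm_def)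
      thus ?thesis using finite_sum_le_infsum[of V UNIV "(\<lambda>\<nu>. \<nu> - a) ` X"] that nn by simp
    qed
    finally show ?thesis .
  qed
  have bound: "((\<lambda>a. U a * wnorm \<xi> v) has_sum (wnorm \<xi> u * wnorm \<xi> v)) UNIV"
    using has_sum_cmult_left[OF has_sum_wnorm[OF u]] by (simp add: U_def)
  have UV: "(\<lambda>a. U a * V (\<nu> - a)) summable_on UNIV" for \<nu>
  proof (rule summable_on_comparison_test[OF has_sum_imp_summable[OF bound]])
    show "U a * V (\<nu> - a) \<le> U a * wnorm \<xi> v" for a
      using V_le[of "{\<nu>}" a] by (intro mult_left_mono nn) simp
  qed (use nn in auto)
  have le: "norm (u a * v (\<nu> - a)) * weight \<xi> \<nu> \<le> U a * V (\<nu> - a)" for a \<nu>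
    using mult_left_mono[OF weight_add_le[OF \<xi>, of \<nu> a], of "norm (u a) * norm (v (\<nu> - a))"]
    by (simp add: U_def V_def norm_mult mult_ac)
  show abs: "(\<lambda>a. norm (u a * v (\<nu> - a))) summable_on UNIV" for \<nu>
  proof -
    have "(\<lambda>a. norm (u a * v (\<nu> - a)) * weight \<xi> \<nu>) summable_on UNIV"
      by (rule summable_on_comparison_test[OF UV[of \<nu>]]) (use le in auto)
    from summable_on_cmult_left[OF this, of "1 / weight \<xi> \<nu>"] show ?thesis
      by (simp add: less_imp_neq[OF weight_pos, symmetric])
  qed
  have conv_le: "norm (fourier_conv u v \<nu>) * weight \<xi> \<nu> \<le> (\<Sum>\<^sub>\<infinity>a. U a * V (\<nu> - a))" for \<nu>
  proof -
    have "norm (fourier_conv u v \<nu>) * weight \<xi> \<nu> \<le> (\<Sum>\<^sub>\<infinity>a. norm (u a * v (\<nu> - a))) * weight \<xi> \<nu>"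
      unfolding fourier_conv_def by (intro mult_right_mono norm_infsum_bound abs) simp
    also have "\<dots> = (\<Sum>\<^sub>\<infinity>a. norm (u a * v (\<nu> - a)) * weight \<xi> \<nu>)" by (rule infsum_cmult_left'[symmetric])
    also have "\<dots> \<le> (\<Sum>\<^sub>\<infinity>a. U a * V (\<nu> - a))"
      by (intro infsum_mono UV le summable_on_cmult_left abs)
    finally show ?thesis .
  qed
  have "(\<Sum>\<nu>\<in>X. norm (fourier_conv u v \<nu>) * weight \<xi> \<nu>) \<le> wnorm \<xi> u * wnorm \<xi> v" if X: "finite X" for X
  proof -
    have "(\<Sum>\<nu>\<in>X. norm (fourier_conv u v \<nu>) * weight \<xi> \<nu>) \<le> (\<Sum>\<nu>\<in>X. \<Sum>\<^sub>\<infinity>a. U a * V (\<nu> - a))"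
      by (intro sum_mono conv_le)
    also have "\<dots> \<le> wnorm \<xi> u * wnorm \<xi> v"
    proof (rule has_sum_mono[OF has_sum_sum_finite[OF X has_sum_infsum[OF UV]] bound])
      show "(\<Sum>\<nu>\<in>X. U a * V (\<nu> - a)) \<le> U a * wnorm \<xi> v" for a
        unfolding sum_distrib_left[symmetric] by (intro mult_left_mono nn V_le X)
    qed
    finally show ?thesis .
  qed
  from wnorm_le_finite_sums[OF this]
  show "weighted_summable \<xi> (fourier_conv u v)" "wnorm \<xi> (fourier_conv u v) \<le> wnorm \<xi> u * wnorm \<xi> v" by blast+
qed

lemma summable_on_conv:
  "0 \<le> \<xi> \<Longrightarrow> weighted_summable \<xi> u \<Longrightarrow> weighted_summable \<xi> v \<Longrightarrow> (\<lambda>a. u a * v (\<nu> - a)) summable_on UNIV"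
  by (rule abs_summable_summable[OF abs_summable_conv])

lemma fourier_conv_single_left: "fourier_conv (\<lambda>\<nu>. if \<nu> = 0 then c else 0) v \<nu> = c * v \<nu>"
proof -
  have "((\<lambda>a. (if a = 0 then c else 0) * v (\<nu> - a)) has_sum c * v \<nu>) UNIV"
    by (rule has_sum_finite_neutralI[of "{0}"]) auto
  thus ?thesis by (simp add: fourier_conv_def infsumI)
qed

lemma fourier_conv_single_right: "fourier_conv u (\<lambda>\<nu>. if \<nu> = 0 then c else 0) \<nu> = u \<nu> * c"
proof -
  have "((\<lambda>a. u a * (if \<nu> - a = 0 then c else 0)) has_sum u \<nu> * c) UNIV"
    by (rule has_sum_finite_neutralI[of "{\<nu>}"]) auto
  thus ?thesis by (simp add: fourier_conv_def infsumI)
qed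

section \<open>Numerical majorant inequalities and the recursions they control\<close>

lemma sum_triangle_le:
  fixes a b :: "nat \<Rightarrow> real"
  assumes "\<And>k. a k \<ge> 0" "\<And>k. b k \<ge> 0"
  shows "(\<Sum>k<n. \<Sum>j\<le>k. a j * b (k - j)) \<le> (\<Sum>j<n. a j) * (\<Sum>j<n. b j)"
proof -
  have "(\<Sum>k<n. \<Sum>j\<le>k. a j * b (k - j)) = (\<Sum>(i,j)\<in>{(i,j). i + j < n}. a i * b j)"
    by (rule sum.triangle_reindex[symmetric])
  also have "\<dots> \<le> (\<Sum>(i,j)\<in>{..<n} \<times> {..<n}. a i * b j)"
    by (rule sum_mono2) (use assms in auto)
  also have "\<dots> = (\<Sum>j<n. a j) * (\<Sum>j<n. b j)"
    by (simp add: sum_product sum.cartesian_product)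
  finally show ?thesis .
qed

lemma sum_Suc_shift: "(\<Sum>k\<in>{1..n}. a k) = (\<Sum>k<n. a (Suc k))" for a :: "nat \<Rightarrow> real"
  by (rule sum.reindex_bij_witness[of _ Suc "\<lambda>k. k - 1"]) auto

text \<open>Induction on m: if the sum up to m is at most c/2, the step bounds the next sum by c/16
  + c/8 + c/8. The 3c/2 in \<open>small\<close> is the resulting bound for a 0 plus the sum.\<close>

lemma majorant_sequence_bound:
  fixes a :: "nat \<Rightarrow> real"
  assumes c: "c > 0" and nn: "\<And>k. a k \<ge> 0" and a0: "a 0 = c" and \<kappa>: "\<kappa> \<ge> 0" "\<Phi> \<ge> 0"
    and step: "\<And>k. k < N \<Longrightarrow> a (Suc k) \<le> 1/8 * (if k = 0 then 0 else a k)
      + \<kappa> * ((if k = 0 then \<Phi> else 0) + (\<Sum>j\<le>k. a j * a (k - j)))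
      + 1 / (2 * c) * (\<Sum>j\<in>{1..k}. a (Suc k - j) * a j)"
    and small: "\<kappa> * (\<Phi> + (3 * c / 2)\<^sup>2) \<le> c / 8" and m: "m \<le> N"
  shows "(\<Sum>k\<in>{1..m}. a k) \<le> c / 2"
  using m
proof (induction m)
  case 0
  thus ?case using c by simp
next
  case (Suc m)
  define S where "S = (\<Sum>k\<in>{1..m}. a k)"
  have S: "0 \<le> S" "S \<le> c / 2" using Suc nn by (auto simp: S_def intro: sum_nonneg)
  have S_le: "(\<Sum>k<Suc m. if k = 0 then 0 else a k) = S"
    unfolding S_def by (rule sum.mono_neutral_cong_right) auto
  have cS: "(\<Sum>k<Suc m. a k) = c + S"
    unfolding S_le[symmetric] by (subst (1 2) sum.lessThan_Suc_shift) (simp add: a0)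
  define a1 where "a1 = (\<lambda>j. if j = 0 then 0 else a j)"
  \<comment> \<open>In the zero-mode sum both factors have index between 1 and m, so it is
    controlled by the sum already bounded in the induction hypothesis; the cut-off in
    \<open>a2\<close> records this.\<close>
  define a2 where "a2 = (\<lambda>j. if j < m then a (Suc j) else 0)"
  have "(\<Sum>k\<in>{1..Suc m}. a k) = (\<Sum>k<Suc m. a (Suc k))" by (rule sum_Suc_shift)
  also have "\<dots> \<le> (\<Sum>k<Suc m. 1/8 * (if k = 0 then 0 else a k)
      + \<kappa> * ((if k = 0 then \<Phi> else 0) + (\<Sum>j\<le>k. a j * a (k - j)))
      + 1 / (2 * c) * (\<Sum>j\<in>{1..k}. a (Suc k - j) * a j))"
    by (rule sum_mono) (use step Suc.prems in auto)
  also have "\<dots> = 1/8 * S + \<kappa> * (\<Phi> + (\<Sum>k<Suc m. \<Sum>j\<le>k. a j * a (k - j)))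
      + 1 / (2 * c) * (\<Sum>k<Suc m. \<Sum>j\<in>{1..k}. a (Suc k - j) * a j)"
    unfolding sum.distrib sum_distrib_left[symmetric] S_le by (simp del: sum.lessThan_Suc)
  finally have main: "(\<Sum>k\<in>{1..Suc m}. a k) \<le> 1/8 * S + \<kappa> * (\<Phi> + (\<Sum>k<Suc m. \<Sum>j\<le>k. a j * a (k - j)))
      + 1 / (2 * c) * (\<Sum>k<Suc m. \<Sum>j\<in>{1..k}. a (Suc k - j) * a j)" .
  have "(\<Sum>k<Suc m. \<Sum>j\<in>{1..k}. a (Suc k - j) * a j) = (\<Sum>k<Suc m. \<Sum>j\<le>k. a1 j * a2 (k - j))"
  proof (rule sum.cong[OF refl])
    fix k assume k: "k \<in> {..<Suc m}"
    show "(\<Sum>j\<in>{1..k}. a (Suc k - j) * a j) = (\<Sum>j\<le>k. a1 j * a2 (k - j))"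
    proof (rule sum.mono_neutral_cong_left)
      fix j assume j: "j \<in> {1..k}"
      hence "Suc (k - j) = Suc k - j" "k - j < m" using k by auto
      thus "a (Suc k - j) * a j = a1 j * a2 (k - j)" using j by (simp add: a1_def a2_def)
    qed (auto simp: a1_def)
  qed
  also have "(\<Sum>k<Suc m. \<Sum>j\<le>k. a1 j * a2 (k - j)) \<le> (\<Sum>k<Suc m. a1 k) * (\<Sum>k<Suc m. a2 k)"
    by (rule sum_triangle_le) (auto simp: a1_def a2_def nn)
  also have "(\<Sum>k<Suc m. a1 k) = S" unfolding a1_def by (rule S_le)
  also have "(\<Sum>k<Suc m. a2 k) = S" unfolding S_def sum_Suc_shift by (simp add: a2_def)
  also have "S * S \<le> c/2 * (c/2)" using S c by (intro mult_mono) auto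
  finally have t2: "(\<Sum>k<Suc m. \<Sum>j\<in>{1..k}. a (Suc k - j) * a j) \<le> c/2 * (c/2)" .
  have "(\<Sum>k<Suc m. \<Sum>j\<le>k. a j * a (k - j)) \<le> (c + S) * (c + S)"
    unfolding cS[symmetric] by (rule sum_triangle_le) (rule nn)+
  also have "\<dots> \<le> (3*c/2) * (3*c/2)" using S c by (intro mult_mono) auto
  finally have t1: "(\<Sum>k<Suc m. \<Sum>j\<le>k. a j * a (k - j)) \<le> (3*c/2) * (3*c/2)" .
  note main
  also have "1/8 * S + \<kappa> * (\<Phi> + (\<Sum>k<Suc m. \<Sum>j\<le>k. a j * a (k - j)))
      + 1 / (2 * c) * (\<Sum>k<Suc m. \<Sum>j\<in>{1..k}. a (Suc k - j) * a j)
    \<le> 1/8 * (c/2) + \<kappa> * (\<Phi> + (3*c/2) * (3*c/2)) + 1 / (2 * c) * (c/2 * (c/2))"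
    by (intro add_mono mult_left_mono t1 t2 order_refl) (use S c \<kappa> in auto)
  also have "\<dots> \<le> c / 2" using small c by (simp add: power2_eq_square)
  finally show ?case .
qed

text \<open>Here b (k+1) also occurs on the right, so instead of an induction all inequalities are
  summed and the total E is absorbed. Its coefficient on the right is at most 1/8 + 1/6 + 1/2 =
  19/24, against a constant term 3c/16; hence E \<le> 9c/10.\<close>

lemma remainder_sequence_bound:
  fixes a b :: "nat \<Rightarrow> real"
  assumes c: "c > 0" and nn: "\<And>k. a k \<ge> 0" "\<And>k. b k \<ge> 0" and a0: "a 0 = c" and \<kappa>: "\<kappa> \<ge> 0" "\<Phi> \<ge> 0"
    and a: "(\<Sum>k\<in>{1..N}. a k) \<le> c / 2" and b0: "b 0 \<le> 3 * c / 2"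
    and step: "\<And>k. k < N \<Longrightarrow> b (Suc k) \<le> 1/8 * (if k = 0 then c / 2 else b k)
      + \<kappa> * ((if k = 0 then \<Phi> else 0) + ((\<Sum>j<k. a j * b (k - j)) + b k * (3 * c / 2)))
      + 1 / (2 * c) * ((\<Sum>j\<in>{1..k}. a j * b (Suc k - j)) + b (Suc k) * (c / 2))"
    and small: "\<kappa> * (\<Phi> + (3 * c / 2)\<^sup>2) \<le> c / 8"
  shows "(\<Sum>k\<in>{1..N}. b k) \<le> c"
proof -
  define E where "E = (\<Sum>k\<in>{1..N}. b k)"
  define S where "S = (\<Sum>k\<in>{1..N}. a k)"
  define a1 where "a1 = (\<lambda>j. if j = 0 then 0 else a j)"
  define b1 where "b1 = (\<lambda>j. if j = 0 then 0 else b j)"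
  have E: "E \<ge> 0" and S: "S \<ge> 0" "S \<le> c / 2" using nn a by (auto simp: E_def S_def intro: sum_nonneg)
  have E_shift: "(\<Sum>k<N. b (Suc k)) = E" by (simp only: E_def sum_Suc_shift)
  have b1_le: "(\<Sum>k<N. b1 k) \<le> E"
  proof -
    have "(\<Sum>k<N. b1 k) = (\<Sum>k\<in>{1..<N}. b k)"
      by (rule sum.mono_neutral_cong_right) (auto simp: b1_def)
    also have "\<dots> \<le> E" unfolding E_def by (rule sum_mono2) (auto simp: nn)
    finally show ?thesis .
  qed
  have a1_le: "(\<Sum>k<N. a1 k) \<le> S"
  proof -
    have "(\<Sum>k<N. a1 k) = (\<Sum>k\<in>{1..<N}. a k)"
      by (rule sum.mono_neutral_cong_right) (auto simp: a1_def)
    also have "\<dots> \<le> S" unfolding S_def by (rule sum_mono2) (auto simp: nn)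
    finally show ?thesis .
  qed
  have a_le: "(\<Sum>k<N. a k) \<le> 3 * c / 2"
  proof -
    have "(\<Sum>k<N. a k) \<le> (\<Sum>k<N. a1 k + (if k = 0 then c else 0))"
      by (rule sum_mono) (auto simp: a1_def a0)
    also have "\<dots> = (\<Sum>k<N. a1 k) + (if N = 0 then 0 else c)" by (simp add: sum.distrib)
    also have "\<dots> \<le> 3 * c / 2" using a1_le S c by auto
    finally show ?thesis .
  qed
  have "E = (\<Sum>k<N. b (Suc k))" by (simp add: E_shift)
  also have "\<dots> \<le> (\<Sum>k<N. 1/8 * (if k = 0 then c / 2 else b k)
      + \<kappa> * ((if k = 0 then \<Phi> else 0) + ((\<Sum>j<k. a j * b (k - j)) + b k * (3 * c / 2)))
      + 1 / (2 * c) * ((\<Sum>j\<in>{1..k}. a j * b (Suc k - j)) + b (Suc k) * (c / 2)))"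
    by (rule sum_mono) (use step in auto)
  also have "\<dots> = 1/8 * (\<Sum>k<N. if k = 0 then c / 2 else b k)
      + \<kappa> * ((\<Sum>k<N. if k = 0 then \<Phi> else 0) + ((\<Sum>k<N. \<Sum>j<k. a j * b (k - j)) + (\<Sum>k<N. b k) * (3 * c / 2)))
      + 1 / (2 * c) * ((\<Sum>k<N. \<Sum>j\<in>{1..k}. a j * b (Suc k - j)) + E * (c / 2))"
    unfolding sum.distrib sum_distrib_left[symmetric] sum_distrib_right[symmetric] E_shift ..
  also have "(\<Sum>k<N. \<Sum>j<k. a j * b (k - j)) = (\<Sum>k<N. \<Sum>j\<le>k. a j * b1 (k - j))"
    by (rule sum.cong[OF refl], rule sum.mono_neutral_cong_left) (auto simp: b1_def)
  also have "(\<Sum>k<N. \<Sum>j\<in>{1..k}. a j * b (Suc k - j)) = (\<Sum>k<N. \<Sum>j\<le>k. a1 j * b (Suc (k - j)))"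
    by (rule sum.cong[OF refl], rule sum.mono_neutral_cong_left) (auto simp: a1_def Suc_diff_le)
  also have "1/8 * (\<Sum>k<N. if k = 0 then c / 2 else b k)
      + \<kappa> * ((\<Sum>k<N. if k = 0 then \<Phi> else 0) + ((\<Sum>k<N. \<Sum>j\<le>k. a j * b1 (k - j)) + (\<Sum>k<N. b k) * (3 * c / 2)))
      + 1 / (2 * c) * ((\<Sum>k<N. \<Sum>j\<le>k. a1 j * b (Suc (k - j))) + E * (c / 2))
    \<le> 1/8 * (c/2 + E) + \<kappa> * (\<Phi> + ((3*c/2) * E + (3*c/2 + E) * (3*c/2))) + 1 / (2 * c) * (c/2 * E + E * (c/2))"
  proof (intro add_mono mult_left_mono mult_right_mono)
    have "(\<Sum>k<N. if k = 0 then c / 2 else b k) = (\<Sum>k<N. b1 k + (if k = 0 then c/2 else 0))"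
      by (rule sum.cong) (auto simp: b1_def)
    also have "\<dots> = (\<Sum>k<N. b1 k) + (if N = 0 then 0 else c/2)" by (simp add: sum.distrib)
    finally show "(\<Sum>k<N. if k = 0 then c / 2 else b k) \<le> c/2 + E" using b1_le c by auto
    show "(\<Sum>k<N. if k = 0 then \<Phi> else 0) \<le> \<Phi>" using \<kappa> by simp
    have "(\<Sum>k<N. b k) = (\<Sum>k<N. b1 k + (if k = 0 then b 0 else 0))"
      by (rule sum.cong) (auto simp: b1_def)
    also have "\<dots> = (\<Sum>k<N. b1 k) + (if N = 0 then 0 else b 0)" by (simp add: sum.distrib)
    finally show "(\<Sum>k<N. b k) \<le> 3*c/2 + E" using b1_le c b0 by auto
    have "(\<Sum>k<N. \<Sum>j\<le>k. a j * b1 (k - j)) \<le> (\<Sum>k<N. a k) * (\<Sum>k<N. b1 k)"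
      by (rule sum_triangle_le) (auto simp: nn b1_def)
    also have "\<dots> \<le> (3*c/2) * E" using c E by (intro mult_mono a_le b1_le sum_nonneg) (auto simp: nn b1_def)
    finally show "(\<Sum>k<N. \<Sum>j\<le>k. a j * b1 (k - j)) \<le> (3*c/2) * E" .
    have "(\<Sum>k<N. \<Sum>j\<le>k. a1 j * b (Suc (k - j))) \<le> (\<Sum>k<N. a1 k) * (\<Sum>k<N. b (Suc k))"
      by (rule sum_triangle_le) (auto simp: nn a1_def)
    also have "\<dots> \<le> c/2 * E" unfolding E_shift using a1_le S E by (intro mult_right_mono) auto
    finally show "(\<Sum>k<N. \<Sum>j\<le>k. a1 j * b (Suc (k - j))) \<le> c/2 * E" .
  qed (use c \<kappa> E in auto)
  also have "\<dots> = c/16 + \<kappa> * (\<Phi> + (3*c/2)\<^sup>2) + E * (1/8 + 3 * (\<kappa> * c) + 1/2)"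
    using c by (simp add: field_simps power2_eq_square)
  also have "\<dots> \<le> c/16 + c/8 + E * (1/8 + 1/6 + 1/2)"
  proof (intro add_mono small mult_left_mono E order_refl)
    \<comment> \<open>Dropping \<Phi> from \<open>small\<close> leaves \<kappa> c \<le>
      1/18.\<close>
    have "\<kappa> * (3*c/2)\<^sup>2 \<le> \<kappa> * (\<Phi> + (3*c/2)\<^sup>2)" using \<kappa> by (intro mult_left_mono) auto
    hence "\<kappa> * (9 * c * c / 4) \<le> c / 8" using small by (simp add: power2_eq_square)
    hence "(\<kappa> * c * 9 / 4) * c \<le> (1 / 8) * c" by (simp add: mult_ac)
    hence "\<kappa> * c * 9 / 4 \<le> 1 / 8" using c by (simp only: mult_le_cancel_right_pos)
    thus "3 * (\<kappa> * c) \<le> 1/6" by simp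
  qed
  finally have "E \<le> c" using c by simp
  thus ?thesis by (simp add: E_def)
qed

lemma decreasing_up_to:
  fixes \<xi> :: "nat \<Rightarrow> real"
  assumes "\<And>k. k < N \<Longrightarrow> \<xi> (Suc k) \<le> \<xi> k" "i \<le> j" "j \<le> N"
  shows "\<xi> j \<le> \<xi> i"
  using assms(2,3)
proof (induction rule: dec_induct)
  case (step n)
  thus ?case using assms(1)[of n] by simp
qed simp

text \<open>A recursion with at most one derivative per step, of size D, and a factor \<delta> in
  front of the nonlinear part; the k-th term is measured with the factor lam^k. The drop from \<xi>
  k to \<xi> (k+1) pays for the derivative. It is applied with D = 0, constant \<xi> and lam = 2 to
  the resummed coefficients, and with D = |\<omega>|, N equal drops and lam = L/N to the formal
  coefficients and the remainders.\<close>

context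
  fixes x :: "nat \<Rightarrow> int \<Rightarrow> complex" and \<xi> :: "nat \<Rightarrow> real" and F :: "int \<Rightarrow> complex"
    and c D \<delta> lam \<Phi> :: real and N :: nat
  assumes c: "c > 0"
    and x0: "x 0 = (\<lambda>\<nu>. if \<nu> = 0 then of_real c else 0)"
    and \<xi>: "\<And>k. k < N \<Longrightarrow> \<xi> (Suc k) \<le> \<xi> k" "\<And>k. k \<le> N \<Longrightarrow> 0 \<le> \<xi> k"
    and F: "weighted_summable (\<xi> 0) F" "wnorm (\<xi> 0) F \<le> \<Phi>"
    and nn: "D \<ge> 0" "\<delta> \<ge> 0" "lam > 0"
    and deriv: "\<And>k \<nu>. k < N \<Longrightarrow> lam * (D * \<bar>of_int \<nu>\<bar>) * weight (\<xi> (Suc k)) \<nu> \<le> 1/8 * weight (\<xi> k) \<nu>"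
    and small: "lam * \<delta> * (\<Phi> + (3 * c / 2)\<^sup>2) \<le> c / 8"
begin

lemma deriv_le: "k < N \<Longrightarrow> D * \<bar>of_int \<nu>\<bar> * r * weight (\<xi> (Suc k)) \<nu> \<le> 1 / (8 * lam) * (r * weight (\<xi> k) \<nu>)" if "r \<ge> 0"
proof -
  assume k: "k < N"
  have "D * \<bar>of_int \<nu>\<bar> * weight (\<xi> (Suc k)) \<nu> \<le> 1 / (8 * lam) * weight (\<xi> k) \<nu>"
    using deriv[OF k, of \<nu>] nn by (simp add: field_simps)
  from mult_left_mono[OF this that] show ?thesis by (simp add: mult_ac)
qed

lemma weighted_summable_F: "k \<le> N \<Longrightarrow> weighted_summable (\<xi> k) F" "k \<le> N \<Longrightarrow> wnorm (\<xi> k) F \<le> \<Phi>"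
  using wnorm_mono[OF decreasing_up_to[of N \<xi> 0 k, OF \<xi>(1)] F(1)] F(2) by auto

lemma recursion_majorant:
  assumes zero: "\<And>k. k < N \<Longrightarrow> x (Suc k) 0 = - (1 / (2 * of_real c)) * (\<Sum>j\<in>{1..k}. fourier_conv (x (Suc k - j)) (x j) 0)"
    and step: "\<And>k \<nu>. k < N \<Longrightarrow> \<nu> \<noteq> 0 \<Longrightarrow> norm (x (Suc k) \<nu>) \<le> D * \<bar>of_int \<nu>\<bar> * norm (x k \<nu>)
      + \<delta> * norm ((if k = 0 then F \<nu> else 0) - (\<Sum>j\<le>k. fourier_conv (x j) (x (k - j)) \<nu>))"
  shows "\<And>k. k \<le> N \<Longrightarrow> weighted_summable (\<xi> k) (x k)"
    and "(\<Sum>k\<in>{1..N}. lam ^ k * wnorm (\<xi> k) (x k)) \<le> c / 2"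
proof -
  let ?a = "\<lambda>k. wnorm (\<xi> k) (x k)"
  have main: "weighted_summable (\<xi> (Suc k)) (x (Suc k)) \<and>
      ?a (Suc k) \<le> (if k = 0 then 0 else 1 / (8 * lam) * ?a k)
        + \<delta> * ((if k = 0 then \<Phi> else 0) + (\<Sum>j\<le>k. ?a j * ?a (k - j)))
        + 1 / (2 * c) * (\<Sum>j\<in>{1..k}. ?a (Suc k - j) * ?a j)"
    if k: "k < N" and ws: "\<And>j. j \<le> k \<Longrightarrow> weighted_summable (\<xi> j) (x j)" for k
  proof -
    define \<eta> where "\<eta> = \<xi> (Suc k)"
    have \<eta>0: "0 \<le> \<eta>" using \<xi>(2) k by (simp add: \<eta>_def)
    have ws': "weighted_summable \<eta> (x j)" "wnorm \<eta> (x j) \<le> ?a j" if "j \<le> k" for j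
      using wnorm_mono[OF decreasing_up_to[of N \<xi>, OF \<xi>(1)] ws[OF that], of "Suc k"] that k by (auto simp: \<eta>_def)
    have conv: "weighted_summable \<eta> (fourier_conv (x i) (x j))"
      "wnorm \<eta> (fourier_conv (x i) (x j)) \<le> ?a i * ?a j" if "i \<le> k" "j \<le> k" for i j
    proof -
      show "weighted_summable \<eta> (fourier_conv (x i) (x j))"
        by (intro weighted_summable_conv \<eta>0 ws' that)
      have "wnorm \<eta> (fourier_conv (x i) (x j)) \<le> wnorm \<eta> (x i) * wnorm \<eta> (x j)"
        by (intro wnorm_conv_le \<eta>0 ws' that)
      also have "\<dots> \<le> ?a i * ?a j"
        by (intro mult_mono ws' that wnorm_nonneg)
      finally show "wnorm \<eta> (fourier_conv (x i) (x j)) \<le> ?a i * ?a j" .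
    qed
    let ?n = "\<lambda>u \<nu>. norm (u \<nu>) * weight \<eta> \<nu>"
    let ?g1 = "\<lambda>\<nu>. if k = 0 then 0 else 1 / (8 * lam) * (norm (x k \<nu>) * weight (\<xi> k) \<nu>)"
    let ?g2 = "\<lambda>\<nu>. (if k = 0 then ?n F \<nu> else 0) + (\<Sum>j\<le>k. ?n (fourier_conv (x j) (x (k - j))) \<nu>)"
    let ?g3 = "\<lambda>\<nu>. \<Sum>j\<in>{1..k}. ?n (fourier_conv (x (Suc k - j)) (x j)) \<nu>"
    define B where "B = (if k = 0 then 0 else 1 / (8 * lam) * ?a k)
        + \<delta> * ((if k = 0 then wnorm \<eta> F else 0) + (\<Sum>j\<le>k. wnorm \<eta> (fourier_conv (x j) (x (k - j)))))
        + 1 / (2 * c) * (\<Sum>j\<in>{1..k}. wnorm \<eta> (fourier_conv (x (Suc k - j)) (x j)))"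
    have "(?g1 has_sum (if k = 0 then 0 else 1 / (8 * lam) * ?a k)) UNIV"
      using has_sum_cmult_right[OF has_sum_wnorm[OF ws[OF order_refl]], of "1 / (8 * lam)"] by simp
    moreover have "((\<lambda>\<nu>. if k = 0 then ?n F \<nu> else 0) has_sum (if k = 0 then wnorm \<eta> F else 0)) UNIV"
      using has_sum_wnorm[OF weighted_summable_F(1)[of "Suc k"]] k by (cases "k = 0") (auto simp: \<eta>_def)
    ultimately have "((\<lambda>\<nu>. ?g1 \<nu> + \<delta> * ?g2 \<nu> + 1 / (2 * c) * ?g3 \<nu>) has_sum B) UNIV"
      unfolding B_def
      by (intro has_sum_add has_sum_cmult_right has_sum_sum_finite has_sum_wnorm conv) auto
    moreover have "norm (x (Suc k) \<nu>) * weight \<eta> \<nu> \<le> ?g1 \<nu> + \<delta> * ?g2 \<nu> + 1 / (2 * c) * ?g3 \<nu>" for \<nu>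
    proof (cases "\<nu> = 0")
      case True
      have "norm (x (Suc k) 0) = 1 / (2 * c) * norm (\<Sum>j\<in>{1..k}. fourier_conv (x (Suc k - j)) (x j) 0)"
        using c by (simp add: zero[OF k] norm_mult norm_divide)
      also have "\<dots> \<le> 1 / (2 * c) * ?g3 0"
        using c by (intro mult_left_mono order_trans[OF norm_sum]) auto
      finally have "norm (x (Suc k) \<nu>) * weight \<eta> \<nu> \<le> 1 / (2 * c) * ?g3 \<nu>" using True by simp
      moreover have "?g1 \<nu> \<ge> 0" "\<delta> * ?g2 \<nu> \<ge> 0" using nn by (auto intro!: mult_nonneg_nonneg add_nonneg_nonneg sum_nonneg)
      ultimately show ?thesis by linarith
    next
      case False
      let ?e = "(if k = 0 then F \<nu> else 0) - (\<Sum>j\<le>k. fourier_conv (x j) (x (k - j)) \<nu>)"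
      have "norm (x (Suc k) \<nu>) * weight \<eta> \<nu> \<le> (D * \<bar>of_int \<nu>\<bar> * norm (x k \<nu>)
        + \<delta> * norm ?e) * weight \<eta> \<nu>"
        by (intro mult_right_mono step k False) simp
      also have "\<dots> = D * \<bar>of_int \<nu>\<bar> * norm (x k \<nu>) * weight \<eta> \<nu>
        + \<delta> * (norm ?e * weight \<eta> \<nu>)"
        by (simp add: algebra_simps)
      also have "\<dots> \<le> ?g1 \<nu> + \<delta> * ?g2 \<nu>"
      proof (intro add_mono mult_left_mono nn)
        \<comment> \<open>For k = 0 the left side vanishes, because \<open>x 0\<close> lives on the
          zero mode and \<nu> \<noteq> 0.\<close>
        show "D * \<bar>of_int \<nu>\<bar> * norm (x k \<nu>) * weight \<eta> \<nu> \<le> ?g1 \<nu>"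
          using deriv_le[OF _ k, of "norm (x k \<nu>)" \<nu>] False by (simp add: x0 \<eta>_def)
        have "norm ?e
          \<le> norm (if k = 0 then F \<nu> else 0) + (\<Sum>j\<le>k. norm (fourier_conv (x j) (x (k - j)) \<nu>))"
          by (intro order_trans[OF norm_triangle_ineq4] add_left_mono norm_sum)
        hence "norm ?e * weight \<eta> \<nu>
          \<le> (norm (if k = 0 then F \<nu> else 0) + (\<Sum>j\<le>k. norm (fourier_conv (x j) (x (k - j)) \<nu>))) * weight \<eta> \<nu>"
          by (rule mult_right_mono) simp
        also have "\<dots> = ?g2 \<nu>" by (simp add: distrib_right sum_distrib_right)
        finally show "norm ?e * weight \<eta> \<nu> \<le> ?g2 \<nu>" .
      qed
      moreover have "1 / (2 * c) * ?g3 \<nu> \<ge> 0" using c by (intro mult_nonneg_nonneg sum_nonneg) auto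
      ultimately show ?thesis by linarith
    qed
    ultimately have "weighted_summable \<eta> (x (Suc k))" "wnorm \<eta> (x (Suc k)) \<le> B"
      using wnorm_le_has_sum[of "\<lambda>\<nu>. ?g1 \<nu> + \<delta> * ?g2 \<nu> + 1 / (2 * c) * ?g3 \<nu>" B "x (Suc k)" \<eta>] by blast+
    moreover have "B \<le> (if k = 0 then 0 else 1 / (8 * lam) * ?a k)
        + \<delta> * ((if k = 0 then \<Phi> else 0) + (\<Sum>j\<le>k. ?a j * ?a (k - j)))
        + 1 / (2 * c) * (\<Sum>j\<in>{1..k}. ?a (Suc k - j) * ?a j)"
      unfolding B_def using c k
      by (intro add_mono mult_left_mono order_refl sum_mono conv nn) (auto simp: \<eta>_def weighted_summable_F)
    ultimately show ?thesis unfolding \<eta>_def by linarith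
  qed
  have ws: "\<forall>j\<le>k. weighted_summable (\<xi> j) (x j)" if "k \<le> N" for k
    using that
  proof (induction k)
    case 0
    thus ?case by (simp add: x0 wnorm_single)
  next
    case (Suc k)
    hence "weighted_summable (\<xi> (Suc k)) (x (Suc k))" using main[of k] by auto
    thus ?case using Suc by (auto simp: le_Suc_eq)
  qed
  thus "\<And>k. k \<le> N \<Longrightarrow> weighted_summable (\<xi> k) (x k)" by blast
  show "(\<Sum>k\<in>{1..N}. lam ^ k * ?a k) \<le> c / 2"
  proof (rule majorant_sequence_bound[where \<kappa> = "lam * \<delta>" and \<Phi> = \<Phi> and N = N])
    show "\<Phi> \<ge> 0" using F(2) wnorm_nonneg order_trans by blast
    show "lam ^ 0 * ?a 0 = c" using c by (simp add: x0 wnorm_single)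
    fix k assume k: "k < N"
    have "lam ^ Suc k * ?a (Suc k) \<le> lam ^ Suc k * ((if k = 0 then 0 else 1 / (8 * lam) * ?a k)
        + \<delta> * ((if k = 0 then \<Phi> else 0) + (\<Sum>j\<le>k. ?a j * ?a (k - j)))
        + 1 / (2 * c) * (\<Sum>j\<in>{1..k}. ?a (Suc k - j) * ?a j))"
      using main[OF k] ws[of k] k nn by (intro mult_left_mono) auto
    also have "\<dots> = 1/8 * (if k = 0 then 0 else lam ^ k * ?a k)
      + lam * \<delta> * ((if k = 0 then \<Phi> else 0) + (\<Sum>j\<le>k. lam ^ k * (?a j * ?a (k - j))))
      + 1 / (2 * c) * (\<Sum>j\<in>{1..k}. lam ^ Suc k * (?a (Suc k - j) * ?a j))"
      using nn by (simp add: distrib_left sum_distrib_left[symmetric] mult_ac)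
    also have "(\<Sum>j\<le>k. lam ^ k * (?a j * ?a (k - j))) =
      (\<Sum>j\<le>k. lam ^ j * ?a j * (lam ^ (k - j) * ?a (k - j)))"
    proof (rule sum.cong[OF refl])
      fix j assume "j \<in> {..k}"
      hence "lam ^ k = lam ^ j * lam ^ (k - j)" by (simp add: power_add[symmetric])
      thus "lam ^ k * (?a j * ?a (k - j)) =
        lam ^ j * ?a j * (lam ^ (k - j) * ?a (k - j))" by (simp only: mult_ac)
    qed
    also have "(\<Sum>j\<in>{1..k}. lam ^ Suc k * (?a (Suc k - j) * ?a j)) =
      (\<Sum>j\<in>{1..k}. lam ^ (Suc k - j) * ?a (Suc k - j) * (lam ^ j * ?a j))"
    proof (rule sum.cong[OF refl])
      fix j assume "j \<in> {1..k}"
      hence "lam ^ Suc k = lam ^ (Suc k - j) * lam ^ j" by (simp only: power_add[symmetric]) simp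
      thus "lam ^ Suc k * (?a (Suc k - j) * ?a j) =
        lam ^ (Suc k - j) * ?a (Suc k - j) * (lam ^ j * ?a j)" by (simp only: mult_ac)
    qed
    finally show "lam ^ Suc k * ?a (Suc k) \<le> 1/8 * (if k = 0 then 0 else lam ^ k * ?a k)
      + lam * \<delta> * ((if k = 0 then \<Phi> else 0) + (\<Sum>j\<le>k. lam ^ j * ?a j * (lam ^ (k - j) * ?a (k - j))))
      + 1 / (2 * c) * (\<Sum>j\<in>{1..k}. lam ^ (Suc k - j) * ?a (Suc k - j) * (lam ^ j * ?a j))" .
  qed (use c nn small wnorm_nonneg in auto)
qed

text \<open>Once the x j and \<open>\<rho> 0\<close> are bounded, the recursion is linear in the
  remaining \<rho> k. The zero mode of \<open>\<rho> (Suc k)\<close> is coupled to all modes of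
  \<open>\<rho> (Suc k)\<close> through the factor \<open>\<rho> 0\<close> - \<open>x 0\<close>; its
  norm c/2 makes this coupling a quarter of the term itself.\<close>

lemma remainder_majorant:
  fixes \<rho> :: "nat \<Rightarrow> int \<Rightarrow> complex"
  assumes ws: "\<And>k. k \<le> N \<Longrightarrow> weighted_summable (\<xi> k) (x k)"
    and x_bound: "(\<Sum>k\<in>{1..N}. lam ^ k * wnorm (\<xi> k) (x k)) \<le> c / 2"
    and X: "weighted_summable (\<xi> 0) (\<lambda>\<nu>. \<rho> 0 \<nu> - x 0 \<nu>)" "wnorm (\<xi> 0) (\<lambda>\<nu>. \<rho> 0 \<nu> - x 0 \<nu>) \<le> c / 2"
    and ws\<rho>: "\<And>k. k \<le> N \<Longrightarrow> weighted_summable (\<xi> k) (\<rho> k)"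
    and zero: "\<And>k. k < N \<Longrightarrow> norm (\<rho> (Suc k) 0) \<le> 1 / (2 * c) * norm ((\<Sum>j\<in>{1..k}. fourier_conv (x j) (\<rho> (Suc k - j)) 0)
        + fourier_conv (\<rho> (Suc k)) (\<lambda>\<nu>. \<rho> 0 \<nu> - x 0 \<nu>) 0)"
    and step: "\<And>k \<nu>. k < N \<Longrightarrow> \<nu> \<noteq> 0 \<Longrightarrow> norm (\<rho> (Suc k) \<nu>) \<le> D * \<bar>of_int \<nu>\<bar> * norm (\<rho> k \<nu>)
      + \<delta> * norm ((if k = 0 then F \<nu> else 0) - ((\<Sum>j<k. fourier_conv (x j) (\<rho> (k - j)) \<nu>) + fourier_conv (\<rho> k) (\<rho> 0) \<nu>))"
  shows "(\<Sum>k\<in>{1..N}. lam ^ k * wnorm (\<xi> k) (\<rho> k)) \<le> c"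
proof -
  let ?a = "\<lambda>k. wnorm (\<xi> k) (x k)" and ?b = "\<lambda>k. wnorm (\<xi> k) (\<rho> k)"
  define Y where "Y = (\<lambda>\<nu>. \<rho> 0 \<nu> - x 0 \<nu>)"
  have wX: "wnorm (\<xi> 0) (\<rho> 0) \<le> 3 * c / 2"
  proof -
    have "wnorm (\<xi> 0) (\<lambda>\<nu>. Y \<nu> + x 0 \<nu>) \<le> wnorm (\<xi> 0) Y + ?a 0"
      using X ws[of 0] unfolding Y_def by (intro wnorm_add) auto
    also have "\<dots> \<le> c/2 + c" using X(2) c unfolding Y_def by (simp add: x0 wnorm_single)
    finally show ?thesis by (simp add: Y_def)
  qed
  have main: "?b (Suc k) \<le> 1 / (8 * lam) * (if k = 0 then c / 2 else ?b k)
        + \<delta> * ((if k = 0 then \<Phi> else 0) + ((\<Sum>j<k. ?a j * ?b (k - j)) + ?b k * (3 * c / 2)))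
        + 1 / (2 * c) * ((\<Sum>j\<in>{1..k}. ?a j * ?b (Suc k - j)) + ?b (Suc k) * (c / 2))"
    if k: "k < N" for k
  proof -
    define \<eta> where "\<eta> = \<xi> (Suc k)"
    have \<eta>0: "0 \<le> \<eta>" using \<xi>(2) k by (simp add: \<eta>_def)
    have le\<eta>: "\<eta> \<le> \<xi> j" if "j \<le> Suc k" for j
      using decreasing_up_to[of N \<xi>, OF \<xi>(1)] that k by (auto simp: \<eta>_def)
    have conv: "weighted_summable \<eta> (fourier_conv u v) \<and> wnorm \<eta> (fourier_conv u v) \<le> B1 * B2"
      if "weighted_summable (\<xi> i) u" "weighted_summable (\<xi> j) v" "wnorm (\<xi> i) u \<le> B1" "wnorm (\<xi> j) v \<le> B2" "i \<le> Suc k" "j \<le> Suc k" for u v i j B1 B2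
    proof
      have w: "weighted_summable \<eta> u" "weighted_summable \<eta> v" "wnorm \<eta> u \<le> B1" "wnorm \<eta> v \<le> B2"
        using wnorm_mono(1)[OF le\<eta>[OF that(5)] that(1)] wnorm_mono(1)[OF le\<eta>[OF that(6)] that(2)]
          order_trans[OF wnorm_mono(2)[OF le\<eta>[OF that(5)] that(1)] that(3)]
          order_trans[OF wnorm_mono(2)[OF le\<eta>[OF that(6)] that(2)] that(4)] by auto
      show "weighted_summable \<eta> (fourier_conv u v)" by (intro weighted_summable_conv \<eta>0 w)
      have "wnorm \<eta> (fourier_conv u v) \<le> wnorm \<eta> u * wnorm \<eta> v" by (intro wnorm_conv_le \<eta>0 w)
      also have "\<dots> \<le> B1 * B2" by (intro mult_mono w wnorm_nonneg order_trans[OF wnorm_nonneg w(3)])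
      finally show "wnorm \<eta> (fourier_conv u v) \<le> B1 * B2" .
    qed
    have cj: "weighted_summable \<eta> (fourier_conv (x j) (\<rho> i))"
      "wnorm \<eta> (fourier_conv (x j) (\<rho> i)) \<le> ?a j * ?b i" if "j \<le> k" "i \<le> Suc k" for i j
      using conv[OF ws[of j] ws\<rho>[of i] order_refl order_refl] that k by auto
    have cX: "weighted_summable \<eta> (fourier_conv (\<rho> k) (\<rho> 0))"
      "wnorm \<eta> (fourier_conv (\<rho> k) (\<rho> 0)) \<le> ?b k * (3 * c / 2)"
      using conv[OF ws\<rho>[of k] ws\<rho>[of 0] order_refl wX] k by auto
    have cY: "weighted_summable \<eta> (fourier_conv (\<rho> (Suc k)) Y)"
      "wnorm \<eta> (fourier_conv (\<rho> (Suc k)) Y) \<le> ?b (Suc k) * (c / 2)"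
      using conv[OF ws\<rho>[of "Suc k"] X(1) order_refl X(2)] k by (auto simp: Y_def)
    \<comment> \<open>The factor |\<nu>| annihilates the zero mode, so at k = 0 only
      \<open>\<rho> 0\<close> - \<open>x 0\<close> matters; this gives c/2 where
      \<open>\<rho> 0\<close> would give 3c/2.\<close>
    define v where "v = (if k = 0 then Y else \<rho> k)"
    have v: "weighted_summable (\<xi> k) v" "wnorm (\<xi> k) v \<le> (if k = 0 then c / 2 else ?b k)"
      using X ws\<rho> k by (auto simp: v_def Y_def)
    let ?n = "\<lambda>u \<nu>. norm (u \<nu>) * weight \<eta> \<nu>"
    let ?g1 = "\<lambda>\<nu>. norm (v \<nu>) * weight (\<xi> k) \<nu>"
    let ?g2 = "\<lambda>\<nu>. (if k = 0 then ?n F \<nu> else 0) + ((\<Sum>j<k. ?n (fourier_conv (x j) (\<rho> (k - j))) \<nu>) + ?n (fourier_conv (\<rho> k) (\<rho> 0)) \<nu>)"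
    let ?g3 = "\<lambda>\<nu>. (\<Sum>j\<in>{1..k}. ?n (fourier_conv (x j) (\<rho> (Suc k - j))) \<nu>) + ?n (fourier_conv (\<rho> (Suc k)) Y) \<nu>"
    define B where "B = 1 / (8 * lam) * wnorm (\<xi> k) v
        + \<delta> * ((if k = 0 then wnorm \<eta> F else 0) + ((\<Sum>j<k. wnorm \<eta> (fourier_conv (x j) (\<rho> (k - j)))) + wnorm \<eta> (fourier_conv (\<rho> k) (\<rho> 0))))
        + 1 / (2 * c) * ((\<Sum>j\<in>{1..k}. wnorm \<eta> (fourier_conv (x j) (\<rho> (Suc k - j)))) + wnorm \<eta> (fourier_conv (\<rho> (Suc k)) Y))"
    have "((\<lambda>\<nu>. if k = 0 then ?n F \<nu> else 0) has_sum (if k = 0 then wnorm \<eta> F else 0)) UNIV"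
      using has_sum_wnorm[OF weighted_summable_F(1)[of "Suc k"]] k by (cases "k = 0") (auto simp: \<eta>_def)
    hence "((\<lambda>\<nu>. 1 / (8 * lam) * ?g1 \<nu> + \<delta> * ?g2 \<nu> + 1 / (2 * c) * ?g3 \<nu>) has_sum B) UNIV"
      unfolding B_def
      by (intro has_sum_add has_sum_cmult_right has_sum_sum_finite has_sum_wnorm cj cX cY v) auto
    moreover have "norm (\<rho> (Suc k) \<nu>) * weight \<eta> \<nu> \<le> 1 / (8 * lam) * ?g1 \<nu> + \<delta> * ?g2 \<nu> + 1 / (2 * c) * ?g3 \<nu>" for \<nu>
    proof (cases "\<nu> = 0")
      case True
      have "norm (\<rho> (Suc k) 0) \<le> 1 / (2 * c) * norm ((\<Sum>j\<in>{1..k}. fourier_conv (x j) (\<rho> (Suc k - j)) 0) + fourier_conv (\<rho> (Suc k)) Y 0)"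
        using zero[OF k] by (simp add: Y_def)
      also have "\<dots> \<le> 1 / (2 * c) * ?g3 0"
        using c by (intro mult_left_mono order_trans[OF norm_triangle_ineq] add_mono order_trans[OF norm_sum]) auto
      finally have "norm (\<rho> (Suc k) \<nu>) * weight \<eta> \<nu> \<le> 1 / (2 * c) * ?g3 \<nu>" using True by simp
      moreover have "1 / (8 * lam) * ?g1 \<nu> \<ge> 0" "\<delta> * ?g2 \<nu> \<ge> 0" using nn by (auto intro!: mult_nonneg_nonneg add_nonneg_nonneg sum_nonneg)
      ultimately show ?thesis by linarith
    next
      case False
      let ?e = "(if k = 0 then F \<nu> else 0) - ((\<Sum>j<k. fourier_conv (x j) (\<rho> (k - j)) \<nu>) + fourier_conv (\<rho> k) (\<rho> 0) \<nu>)"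
      have "norm (\<rho> (Suc k) \<nu>) * weight \<eta> \<nu> \<le> (D * \<bar>of_int \<nu>\<bar> * norm (\<rho> k \<nu>) + \<delta> * norm ?e) * weight \<eta> \<nu>"
        by (intro mult_right_mono step k False) simp
      also have "\<dots> = D * \<bar>of_int \<nu>\<bar> * norm (\<rho> k \<nu>) * weight \<eta> \<nu> + \<delta> * (norm ?e * weight \<eta> \<nu>)"
        by (simp add: algebra_simps)
      also have "\<dots> \<le> 1 / (8 * lam) * ?g1 \<nu> + \<delta> * ?g2 \<nu>"
      proof (intro add_mono mult_left_mono nn)
        have "\<rho> k \<nu> = v \<nu>" using False by (simp add: v_def Y_def x0)
        thus "D * \<bar>of_int \<nu>\<bar> * norm (\<rho> k \<nu>) * weight \<eta> \<nu> \<le> 1 / (8 * lam) * ?g1 \<nu>"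
          using deriv_le[OF _ k, of "norm (\<rho> k \<nu>)" \<nu>] by (simp add: \<eta>_def)
        have "norm ?e \<le> norm (if k = 0 then F \<nu> else 0) + ((\<Sum>j<k. norm (fourier_conv (x j) (\<rho> (k - j)) \<nu>)) + norm (fourier_conv (\<rho> k) (\<rho> 0) \<nu>))"
          by (intro order_trans[OF norm_triangle_ineq4] add_left_mono order_trans[OF norm_triangle_ineq] add_right_mono norm_sum)
        hence "norm ?e * weight \<eta> \<nu> \<le> (norm (if k = 0 then F \<nu> else 0) + ((\<Sum>j<k. norm (fourier_conv (x j) (\<rho> (k - j)) \<nu>)) + norm (fourier_conv (\<rho> k) (\<rho> 0) \<nu>))) * weight \<eta> \<nu>"
          by (rule mult_right_mono) simp
        also have "\<dots> = ?g2 \<nu>" by (simp add: distrib_right sum_distrib_right)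
        finally show "norm ?e * weight \<eta> \<nu> \<le> ?g2 \<nu>" .
      qed
      moreover have "1 / (2 * c) * ?g3 \<nu> \<ge> 0" using c by (intro mult_nonneg_nonneg add_nonneg_nonneg sum_nonneg) auto
      ultimately show ?thesis by linarith
    qed
    ultimately have "wnorm \<eta> (\<rho> (Suc k)) \<le> B"
      using wnorm_le_has_sum(2)[of "\<lambda>\<nu>. 1 / (8 * lam) * ?g1 \<nu> + \<delta> * ?g2 \<nu> + 1 / (2 * c) * ?g3 \<nu>" B "\<rho> (Suc k)" \<eta>] by blast
    also have "B \<le> 1 / (8 * lam) * (if k = 0 then c / 2 else ?b k)
        + \<delta> * ((if k = 0 then \<Phi> else 0) + ((\<Sum>j<k. ?a j * ?b (k - j)) + ?b k * (3 * c / 2)))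
        + 1 / (2 * c) * ((\<Sum>j\<in>{1..k}. ?a j * ?b (Suc k - j)) + ?b (Suc k) * (c / 2))"
      unfolding B_def using c k nn
      by (intro add_mono mult_left_mono order_refl sum_mono cj cX cY v) (auto simp: \<eta>_def weighted_summable_F)
    finally show ?thesis by (simp add: \<eta>_def)
  qed
  show ?thesis
  proof (rule remainder_sequence_bound[where \<kappa> = "lam * \<delta>" and \<Phi> = \<Phi> and N = N and a = "\<lambda>k. lam ^ k * ?a k"])
    show "\<Phi> \<ge> 0" using F(2) wnorm_nonneg order_trans by blast
    show "lam ^ 0 * ?a 0 = c" using c by (simp add: x0 wnorm_single)
    show "lam ^ 0 * wnorm (\<xi> 0) (\<rho> 0) \<le> 3 * c / 2" using wX by simp
    fix k assume k: "k < N"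
    have pow: "lam ^ n * (?a j * ?b (n - j)) =
        lam ^ j * ?a j * (lam ^ (n - j) * ?b (n - j))" if "j \<le> n" for n j
    proof -
      have "lam ^ n = lam ^ j * lam ^ (n - j)" using that by (simp add: power_add[symmetric])
      thus ?thesis by (simp only: mult_ac)
    qed
    have "lam ^ Suc k * ?b (Suc k) \<le> lam ^ Suc k * (1 / (8 * lam) * (if k = 0 then c / 2 else ?b k)
        + \<delta> * ((if k = 0 then \<Phi> else 0) + ((\<Sum>j<k. ?a j * ?b (k - j)) + ?b k * (3 * c / 2)))
        + 1 / (2 * c) * ((\<Sum>j\<in>{1..k}. ?a j * ?b (Suc k - j)) + ?b (Suc k) * (c / 2)))"
      using main[OF k] nn by (intro mult_left_mono) auto
    also have "\<dots> = 1/8 * (if k = 0 then c / 2 else lam ^ k * ?b k)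
      + lam * \<delta> * ((if k = 0 then \<Phi> else 0) + ((\<Sum>j<k. lam ^ k * (?a j * ?b (k - j))) + lam ^ k * ?b k * (3 * c / 2)))
      + 1 / (2 * c) * ((\<Sum>j\<in>{1..k}. lam ^ Suc k * (?a j * ?b (Suc k - j))) + lam ^ Suc k * ?b (Suc k) * (c / 2))"
      unfolding sum_distrib_left[symmetric] using nn by (cases "k = 0") (simp_all add: distrib_left mult_ac)
    also have "(\<Sum>j<k. lam ^ k * (?a j * ?b (k - j))) =
       (\<Sum>j<k. lam ^ j * ?a j * (lam ^ (k - j) * ?b (k - j)))"
      by (rule sum.cong[OF refl], rule pow) simp
    also have "(\<Sum>j\<in>{1..k}. lam ^ Suc k * (?a j * ?b (Suc k - j))) =
       (\<Sum>j\<in>{1..k}. lam ^ j * ?a j * (lam ^ (Suc k - j) * ?b (Suc k - j)))"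
      by (rule sum.cong[OF refl], rule pow) simp
    finally show "lam ^ Suc k * ?b (Suc k) \<le> 1/8 * (if k = 0 then c / 2 else lam ^ k * ?b k)
      + lam * \<delta> * ((if k = 0 then \<Phi> else 0) + ((\<Sum>j<k. lam ^ j * ?a j * (lam ^ (k - j) * ?b (k - j))) + lam ^ k * ?b k * (3 * c / 2)))
      + 1 / (2 * c) * ((\<Sum>j\<in>{1..k}. lam ^ j * ?a j * (lam ^ (Suc k - j) * ?b (Suc k - j))) + lam ^ Suc k * ?b (Suc k) * (c / 2))" .
  qed (use c nn small wnorm_nonneg x_bound in auto)
qed

end

section \<open>Resummation and termwise operations\<close>

lemma weighted_summable_0_iff: "weighted_summable 0 u \<longleftrightarrow> (\<lambda>\<nu>. norm (u \<nu>)) summable_on UNIV"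
  by (simp add: weighted_summable_def)

lemma wnorm_0: "wnorm 0 u = (\<Sum>\<^sub>\<infinity>\<nu>. norm (u \<nu>))"
  by (simp add: wnorm_def)

lemma weight_ge_1: "0 \<le> \<xi> \<Longrightarrow> weight \<xi> \<nu> \<ge> 1"
  by (simp add: weight_def)

lemma norm_le_wnorm': "0 \<le> \<xi> \<Longrightarrow> weighted_summable \<xi> u \<Longrightarrow> norm (u \<nu>) \<le> wnorm \<xi> u"
  using norm_le_wnorm[of \<xi> u \<nu>] mult_left_mono[OF weight_ge_1[of \<xi> \<nu>], of "norm (u \<nu>)"] by simp

context
  fixes y :: "nat \<Rightarrow> int \<Rightarrow> complex" and \<xi> :: real and b :: "nat \<Rightarrow> real"
  assumes \<xi>: "0 \<le> \<xi>" and ws: "\<And>k. weighted_summable \<xi> (y k)" and le: "\<And>k. wnorm \<xi> (y k) \<le> b k"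
    and b: "summable b"
begin

lemma resum_summable: "summable (\<lambda>k. norm (y k \<nu>))"
  by (rule summable_comparison_test'[OF b, of 0])
    (simp, rule order_trans[OF norm_le_wnorm'[OF \<xi> ws] le])

lemma resum_wnorm:
  shows "weighted_summable \<xi> (\<lambda>\<nu>. \<Sum>k. y k \<nu>)" "wnorm \<xi> (\<lambda>\<nu>. \<Sum>k. y k \<nu>) \<le> suminf b"
proof -
  have "(\<Sum>\<nu>\<in>X. norm (\<Sum>k. y k \<nu>) * weight \<xi> \<nu>) \<le> suminf b" if X: "finite X" for X
  proof -
    have sw: "summable (\<lambda>k. norm (y k \<nu>) * weight \<xi> \<nu>)" for \<nu> by (intro summable_mult2 resum_summable)
    have "(\<Sum>\<nu>\<in>X. norm (\<Sum>k. y k \<nu>) * weight \<xi> \<nu>) \<le> (\<Sum>\<nu>\<in>X. (\<Sum>k. norm (y k \<nu>)) * weight \<xi> \<nu>)"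
      by (intro sum_mono mult_right_mono summable_norm resum_summable) simp
    also have "\<dots> = (\<Sum>\<nu>\<in>X. \<Sum>k. norm (y k \<nu>) * weight \<xi> \<nu>)"
      by (intro sum.cong refl suminf_mult2 resum_summable)
    also have "\<dots> = (\<Sum>k. \<Sum>\<nu>\<in>X. norm (y k \<nu>) * weight \<xi> \<nu>)" by (rule suminf_sum[symmetric]) (rule sw)
    also have "\<dots> \<le> suminf b"
    proof (intro suminf_le summable_sum sw b)
      fix k
      have "(\<Sum>\<nu>\<in>X. norm (y k \<nu>) * weight \<xi> \<nu>) \<le> wnorm \<xi> (y k)"
        using ws[of k] X unfolding wnorm_def weighted_summable_def by (intro finite_sum_le_infsum) auto
      thus "(\<Sum>\<nu>\<in>X. norm (y k \<nu>) * weight \<xi> \<nu>) \<le> b k" using le[of k] by linarith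
    qed
    finally show ?thesis .
  qed
  from wnorm_le_finite_sums[OF this]
  show "weighted_summable \<xi> (\<lambda>\<nu>. \<Sum>k. y k \<nu>)" "wnorm \<xi> (\<lambda>\<nu>. \<Sum>k. y k \<nu>) \<le> suminf b" by blast+
qed

end

lemma norm_infsum_le_wnorm: "weighted_summable 0 u \<Longrightarrow> norm (infsum u UNIV) \<le> wnorm 0 u"
  by (simp add: weighted_summable_0_iff wnorm_0 norm_infsum_bound)

lemma weighted_summable_0_summable: "weighted_summable 0 u \<Longrightarrow> u summable_on UNIV"
  by (simp add: weighted_summable_0_iff abs_summable_summable)

text \<open>The two summations commute since the tail of the series in k has \<open>wnorm\<close> at
  most the tail of b.\<close>

lemma infsum_resum:
  assumes ws: "\<And>k. weighted_summable 0 (y k)" and le: "\<And>k. wnorm 0 (y k) \<le> b k" and b: "summable b"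
  shows "(\<lambda>k. infsum (y k) UNIV) sums infsum (\<lambda>\<nu>. \<Sum>k. y k \<nu>) UNIV"
proof -
  let ?Y = "\<lambda>\<nu>. \<Sum>k. y k \<nu>"
  note sm = resum_summable[OF order_refl ws le b] and rw = resum_wnorm[OF order_refl ws le b]
  have "(\<lambda>n. (\<Sum>k<n. infsum (y k) UNIV) - infsum ?Y UNIV) \<longlonglongrightarrow> 0"
  proof (rule Lim_null_comparison[OF always_eventually])
    show "\<forall>n. norm ((\<Sum>k<n. infsum (y k) UNIV) - infsum ?Y UNIV) \<le> (\<Sum>k. b (k + n))"
    proof
      fix n
      have t: "weighted_summable 0 (\<lambda>\<nu>. \<Sum>k. y (k + n) \<nu>)" "wnorm 0 (\<lambda>\<nu>. \<Sum>k. y (k + n) \<nu>) \<le> (\<Sum>k. b (k + n))"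
        using resum_wnorm[of 0 "\<lambda>k. y (k + n)" "\<lambda>k. b (k + n)"] ws le b summable_iff_shift[of b n] by auto
      have split: "?Y \<nu> = (\<Sum>k. y (k + n) \<nu>) + (\<Sum>k<n. y k \<nu>)" for \<nu>
        by (rule suminf_split_initial_segment[OF summable_norm_cancel[OF sm]])
      have "((\<lambda>\<nu>. (\<Sum>k. y (k + n) \<nu>) + (\<Sum>k<n. y k \<nu>)) has_sum
         (infsum (\<lambda>\<nu>. \<Sum>k. y (k + n) \<nu>) UNIV + (\<Sum>k<n. infsum (y k) UNIV))) UNIV"
        by (intro has_sum_add has_sum_sum_finite has_sum_infsum weighted_summable_0_summable ws t) auto
      hence "infsum ?Y UNIV = infsum (\<lambda>\<nu>. \<Sum>k. y (k + n) \<nu>) UNIV + (\<Sum>k<n. infsum (y k) UNIV)"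
        unfolding split by (rule infsumI)
      hence "norm ((\<Sum>k<n. infsum (y k) UNIV) - infsum ?Y UNIV) = norm (infsum (\<lambda>\<nu>. \<Sum>k. y (k + n) \<nu>) UNIV)" by simp
      also have "\<dots> \<le> (\<Sum>k. b (k + n))" using norm_infsum_le_wnorm[OF t(1)] t(2) by linarith
      finally show "norm ((\<Sum>k<n. infsum (y k) UNIV) - infsum ?Y UNIV) \<le> (\<Sum>k. b (k + n))" .
    qed
    show "(\<lambda>n. \<Sum>k. b (k + n)) \<longlonglongrightarrow> 0" by (rule suminf_exist_split2[OF b])
  qed
  thus ?thesis by (simp add: sums_def LIM_zero_iff)
qed

text \<open>The summands of the convolution at a fixed \<nu>, seen as a sequence in a, are bounded
  so that \<open>infsum_resum\<close> can be applied to them.\<close>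

lemma abs_conv_le:
  assumes \<xi>: "0 \<le> \<xi>" and u: "weighted_summable \<xi> u" and v: "weighted_summable \<xi> v"
  shows "weighted_summable 0 (\<lambda>a. u a * v (\<nu> - a))" "wnorm 0 (\<lambda>a. u a * v (\<nu> - a)) \<le> wnorm \<xi> u * wnorm \<xi> v"
proof -
  have hs: "((\<lambda>a. norm (u a) * weight \<xi> a * wnorm \<xi> v) has_sum wnorm \<xi> u * wnorm \<xi> v) UNIV"
    by (rule has_sum_cmult_left[OF has_sum_wnorm[OF u]])
  have "norm (u a * v (\<nu> - a)) * weight 0 a \<le> norm (u a) * weight \<xi> a * wnorm \<xi> v" for a
    using mult_mono[OF mult_left_mono[OF weight_ge_1[OF \<xi>, of a], of "norm (u a)"] norm_le_wnorm'[OF \<xi> v, of "\<nu> - a"]]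
    by (simp add: norm_mult)
  from wnorm_le_has_sum[OF hs this]
  show "weighted_summable 0 (\<lambda>a. u a * v (\<nu> - a))" "wnorm 0 (\<lambda>a. u a * v (\<nu> - a)) \<le> wnorm \<xi> u * wnorm \<xi> v"
    by blast+
qed

text \<open>For each convolution index a the Cauchy product of the two series in k is formed;
  \<open>infsum_resum\<close> then exchanges it with the sum over a.\<close>

lemma conv_resum:
  assumes \<xi>: "0 \<le> \<xi>" and ws: "\<And>k. weighted_summable \<xi> (y k)" and le: "\<And>k. wnorm \<xi> (y k) \<le> b k"
    and b: "summable b"
  shows "(\<lambda>n. \<Sum>j\<le>n. fourier_conv (y j) (y (n - j)) \<nu>) sums
    fourier_conv (\<lambda>\<nu>. \<Sum>k. y k \<nu>) (\<lambda>\<nu>. \<Sum>k. y k \<nu>) \<nu>"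
proof -
  let ?z = "\<lambda>n a. \<Sum>j\<le>n. y j a * y (n - j) (\<nu> - a)"
  have b0: "b k \<ge> 0" for k using le[of k] wnorm_nonneg[of \<xi> "y k"] by linarith
  have hs: "((\<lambda>a. \<Sum>j\<le>n. norm (y j a * y (n - j) (\<nu> - a)) * weight 0 a) has_sum
     (\<Sum>j\<le>n. wnorm 0 (\<lambda>a. y j a * y (n - j) (\<nu> - a)))) UNIV" for n
    by (intro has_sum_sum_finite has_sum_wnorm abs_conv_le[OF \<xi> ws ws]) auto
  have z: "weighted_summable 0 (?z n)" "wnorm 0 (?z n) \<le> (\<Sum>j\<le>n. wnorm 0 (\<lambda>a. y j a * y (n - j) (\<nu> - a)))" for n
    by (rule wnorm_le_has_sum[OF hs[of n]]; simp add: sum_distrib_right[symmetric] norm_sum)+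
  have z_le: "wnorm 0 (?z n) \<le> (\<Sum>j\<le>n. b j * b (n - j))" for n
    by (rule order_trans[OF z(2)], intro sum_mono order_trans[OF abs_conv_le(2)[OF \<xi> ws ws]] mult_mono le wnorm_nonneg b0)
  have "summable (\<lambda>n. \<Sum>j\<le>n. b j * b (n - j))"
    by (rule summable_Cauchy_product) (use b b0 in simp_all)
  from infsum_resum[OF z(1) z_le this]
  have "(\<lambda>n. infsum (?z n) UNIV) sums infsum (\<lambda>a. \<Sum>n. ?z n a) UNIV" .
  moreover have "(\<Sum>n. ?z n a) = (\<Sum>k. y k a) * (\<Sum>k. y k (\<nu> - a))" for a
    by (rule Cauchy_product[symmetric]) (rule resum_summable[OF \<xi> ws le b])+
  moreover have "infsum (?z n) UNIV = (\<Sum>j\<le>n. fourier_conv (y j) (y (n - j)) \<nu>)" for n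
  proof (rule infsumI)
    show "(?z n has_sum (\<Sum>j\<le>n. fourier_conv (y j) (y (n - j)) \<nu>)) UNIV"
      unfolding fourier_conv_def
      by (intro has_sum_sum_finite has_sum_infsum summable_on_conv[OF \<xi> ws ws]) auto
  qed
  ultimately show ?thesis by (simp add: fourier_conv_def)
qed

section \<open>Fourier series: products, derivatives and dependence on a parameter\<close>

definition phase :: "real \<Rightarrow> real \<Rightarrow> int \<Rightarrow> complex" where
  "phase \<omega> t \<nu> = exp (\<i> * of_int \<nu> * of_real \<omega> * of_real t)"

lemma norm_phase [simp]: "norm (phase \<omega> t \<nu>) = 1"
  by (simp add: phase_def norm_exp_eq_Re)

lemma phase_add: "phase \<omega> t (a + b) = phase \<omega> t a * phase \<omega> t b"
  by (simp add: phase_def exp_add[symmetric] algebra_simps)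

lemma phase_0 [simp]: "phase \<omega> t 0 = 1"
  by (simp add: phase_def)

lemma fourier_series_phase: "fourier_series \<omega> u t = infsum (\<lambda>\<nu>. phase \<omega> t \<nu> * u \<nu>) UNIV"
  by (simp add: fourier_series_def phase_def)

lemma weighted_summable_phase:
  "weighted_summable \<xi> (\<lambda>\<nu>. phase \<omega> t \<nu> * u \<nu>) = weighted_summable \<xi> u" "wnorm \<xi> (\<lambda>\<nu>. phase \<omega> t \<nu> * u \<nu>) = wnorm \<xi> u"
  by (simp_all add: weighted_summable_def wnorm_def norm_mult)

lemma has_sum_fourier_series:
  "weighted_summable 0 u \<Longrightarrow> ((\<lambda>\<nu>. phase \<omega> t \<nu> * u \<nu>) has_sum fourier_series \<omega> u t) UNIV"
  unfolding fourier_series_phase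
  by (intro has_sum_infsum weighted_summable_0_summable) (simp add: weighted_summable_phase)

lemma norm_fourier_series_le: "weighted_summable 0 u \<Longrightarrow> norm (fourier_series \<omega> u t) \<le> wnorm 0 u"
  unfolding fourier_series_phase
  using norm_infsum_le_wnorm[of "\<lambda>\<nu>. phase \<omega> t \<nu> * u \<nu>"] by (simp add: weighted_summable_phase)

lemma fourier_series_add:
  "weighted_summable 0 u \<Longrightarrow> weighted_summable 0 v \<Longrightarrow>
    fourier_series \<omega> (\<lambda>\<nu>. u \<nu> + v \<nu>) t = fourier_series \<omega> u t + fourier_series \<omega> v t"
  unfolding fourier_series_phase[of _ "\<lambda>\<nu>. u \<nu> + v \<nu>"] distrib_left
  by (intro infsumI has_sum_add has_sum_fourier_series)

lemma fourier_series_scale: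
  "fourier_series \<omega> (\<lambda>\<nu>. c * u \<nu>) t = c * fourier_series \<omega> u t"
  unfolding fourier_series_phase by (subst infsum_cmult_right'[symmetric]) (simp add: mult_ac)

lemma fourier_series_sum:
  "finite I \<Longrightarrow> (\<And>i. i \<in> I \<Longrightarrow> weighted_summable 0 (u i)) \<Longrightarrow>
    fourier_series \<omega> (\<lambda>\<nu>. \<Sum>i\<in>I. u i \<nu>) t = (\<Sum>i\<in>I. fourier_series \<omega> (u i) t)"
  unfolding fourier_series_phase[of _ "\<lambda>\<nu>. \<Sum>i\<in>I. u i \<nu>"] sum_distrib_left
  by (intro infsumI has_sum_sum_finite has_sum_fourier_series)

lemma fourier_series_resum:
  assumes "\<And>k. weighted_summable 0 (y k)" "\<And>k. wnorm 0 (y k) \<le> b k" "summable b"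
  shows "(\<lambda>k. fourier_series \<omega> (y k) t) sums fourier_series \<omega> (\<lambda>\<nu>. \<Sum>k. y k \<nu>) t"
proof -
  have "(\<lambda>k. infsum (\<lambda>\<nu>. phase \<omega> t \<nu> * y k \<nu>) UNIV) sums infsum (\<lambda>\<nu>. \<Sum>k. phase \<omega> t \<nu> * y k \<nu>) UNIV"
    by (rule infsum_resum[of "\<lambda>k \<nu>. phase \<omega> t \<nu> * y k \<nu>" b]) (simp_all add: weighted_summable_phase assms)
  moreover have "(\<Sum>k. phase \<omega> t \<nu> * y k \<nu>) = phase \<omega> t \<nu> * (\<Sum>k. y k \<nu>)" for \<nu>
    using resum_summable[OF order_refl assms] by (intro suminf_mult summable_norm_cancel[of "\<lambda>k. y k \<nu>"]) auto
  ultimately show ?thesis by (simp add: fourier_series_phase)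
qed

text \<open>The shear (a, \<nu>) to (a, \<nu> - a) reduces the double sum to a product of two
  absolutely convergent sums.\<close>

lemma fourier_series_conv:
  assumes u: "weighted_summable 0 u" and v: "weighted_summable 0 v"
  shows "fourier_series \<omega> (fourier_conv u v) t = fourier_series \<omega> u t * fourier_series \<omega> v t"
proof -
  let ?U = "\<lambda>a. phase \<omega> t a * u a" and ?V = "\<lambda>a. phase \<omega> t a * v a"
  have abs: "(\<lambda>x. norm (case x of (a, b) \<Rightarrow> ?U a * ?V b)) summable_on UNIV \<times> UNIV"
  proof (rule summable_on_SigmaI)
    show "((\<lambda>b. norm (case (a, b) of (a, b) \<Rightarrow> ?U a * ?V b)) has_sum norm (u a) * wnorm 0 v) UNIV" for a
      using has_sum_cmult_right[OF has_sum_wnorm[OF v], of "norm (u a)"] by (simp add: norm_mult)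
    show "(\<lambda>a. norm (u a) * wnorm 0 v) summable_on UNIV"
      using u by (intro summable_on_cmult_left) (simp add: weighted_summable_0_iff)
  qed simp
  have bij: "bij_betw (\<lambda>(a, \<nu>). (a, \<nu> - a)) (UNIV \<times> UNIV) (UNIV \<times> (UNIV :: int set))"
    by (rule bij_betwI[where g = "\<lambda>(a, b). (a, a + b)"]) auto
  have s: "(\<lambda>(a, \<nu>). ?U a * ?V (\<nu> - a)) summable_on UNIV \<times> UNIV"
    using summable_on_reindex_bij_betw[OF bij, of "\<lambda>(a, b). ?U a * ?V b"] abs_summable_summable[OF abs]
    by (simp add: case_prod_unfold)
  have "fourier_series \<omega> (fourier_conv u v) t = (\<Sum>\<^sub>\<infinity>\<nu>. \<Sum>\<^sub>\<infinity>a. ?U a * ?V (\<nu> - a))"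
  proof -
    have "phase \<omega> t \<nu> * fourier_conv u v \<nu> = (\<Sum>\<^sub>\<infinity>a. ?U a * ?V (\<nu> - a))" for \<nu>
    proof -
      have "?U a * ?V (\<nu> - a) = phase \<omega> t \<nu> * (u a * v (\<nu> - a))" for a
        using phase_add[of \<omega> t a "\<nu> - a"] by simp
      thus ?thesis unfolding fourier_conv_def by (simp only: infsum_cmult_right')
    qed
    thus ?thesis by (simp add: fourier_series_phase)
  qed
  also have "\<dots> = (\<Sum>\<^sub>\<infinity>a. \<Sum>\<^sub>\<infinity>\<nu>. ?U a * ?V (\<nu> - a))"
    by (rule infsum_swap_banach[symmetric]) (rule s)
  also have "\<dots> = (\<Sum>\<^sub>\<infinity>a. ?U a * fourier_series \<omega> v t)"
  proof (rule infsum_cong)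
    fix a
    have "(\<Sum>\<^sub>\<infinity>\<nu>. ?V (\<nu> - a)) = infsum ?V UNIV"
      by (rule infsum_reindex_bij_betw[where g = "\<lambda>\<nu>. \<nu> - a"]) (rule bij_betwI[where g = "\<lambda>b. b + a"], auto)
    thus "(\<Sum>\<^sub>\<infinity>\<nu>. ?U a * ?V (\<nu> - a)) = ?U a * fourier_series \<omega> v t"
      by (simp add: infsum_cmult_right' fourier_series_phase)
  qed
  also have "\<dots> = fourier_series \<omega> u t * fourier_series \<omega> v t"
    by (simp add: infsum_cmult_left' fourier_series_phase)
  finally show ?thesis .
qed

text \<open>For complex times within \<xi>/|\<omega>| of t the weight still dominates the terms, so
  the partial sums converge uniformly as holomorphic functions and may be differentiated
  termwise.\<close>

lemma fourier_series_has_vector_derivative: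
  assumes \<xi>: "\<xi> > 0" and u: "weighted_summable \<xi> u" and \<omega>: "\<omega> \<noteq> 0"
  shows "(fourier_series \<omega> u has_vector_derivative fourier_series \<omega> (\<lambda>\<nu>. \<i> * of_real \<omega> * of_int \<nu> * u \<nu>) t) (at t)"
proof -
  define r where "r = \<xi> / \<bar>\<omega>\<bar>"
  have r: "r > 0" using \<xi> \<omega> by (simp add: r_def)
  define e where "e = (\<lambda>\<nu> z. exp (\<i> * of_int \<nu> * of_real \<omega> * z) * u \<nu>)"
  define e' where "e' = (\<lambda>\<nu> z. exp (\<i> * of_int \<nu> * of_real \<omega> * z) * (\<i> * of_int \<nu> * of_real \<omega>) * u \<nu>)"
  have bound: "norm (e \<nu> z) \<le> norm (u \<nu>) * weight \<xi> \<nu>" if z: "z \<in> cball (of_real t) r" for \<nu> z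
  proof -
    have "\<bar>Im z\<bar> \<le> r" using z abs_Im_le_cmod[of "of_real t - z"] by (simp add: dist_norm)
    hence "\<bar>of_int \<nu>\<bar> * \<bar>\<omega>\<bar> * \<bar>Im z\<bar> \<le> \<bar>of_int \<nu>\<bar> * \<bar>\<omega>\<bar> * r" by (intro mult_left_mono) auto
    hence "- (of_int \<nu> * \<omega> * Im z) \<le> \<xi> * \<bar>of_int \<nu>\<bar>"
      using \<omega> abs_ge_minus_self[of "of_int \<nu> * \<omega> * Im z"] by (simp add: r_def abs_mult mult_ac)
    thus ?thesis
      by (simp add: e_def norm_mult norm_exp_eq_Re weight_def mult.commute[of "norm (u \<nu>)"] mult_right_mono)
  qed
  have ul: "uniform_limit (cball (of_real t) r) (\<lambda>X z. \<Sum>\<nu>\<in>X. e \<nu> z) (\<lambda>z. \<Sum>\<^sub>\<infinity>\<nu>. e \<nu> z) (finite_subsets_at_top UNIV)"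
    by (rule Weierstrass_m_test_general[OF bound]) (use u in \<open>auto simp: weighted_summable_def\<close>)
  have ev: "\<forall>\<^sub>F X in finite_subsets_at_top UNIV. continuous_on (cball (of_real t) r) (\<lambda>z. \<Sum>\<nu>\<in>X. e \<nu> z) \<and>
      (\<forall>w\<in>ball (of_real t) r. ((\<lambda>z. \<Sum>\<nu>\<in>X. e \<nu> z) has_field_derivative (\<Sum>\<nu>\<in>X. e' \<nu> w)) (at w))"
    unfolding e_def e'_def
    by (intro always_eventually allI conjI ballI continuous_intros DERIV_sum) (auto intro!: derivative_eq_intros)
  obtain g' where g': "\<And>w. w \<in> ball (of_real t) r \<Longrightarrow>
      ((\<lambda>z. \<Sum>\<^sub>\<infinity>\<nu>. e \<nu> z) has_field_derivative g' w) (at w) \<and>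
      ((\<lambda>X. \<Sum>\<nu>\<in>X. e' \<nu> w) \<longlongrightarrow> g' w) (finite_subsets_at_top UNIV)"
    using has_complex_derivative_uniform_limit[OF ev ul finite_subsets_at_top_neq_bot r] by blast
  have "((\<lambda>\<nu>. e' \<nu> (of_real t)) has_sum g' (of_real t)) UNIV"
    using g'[of "of_real t"] r by (simp add: has_sum_def)
  hence "g' (of_real t) = fourier_series \<omega> (\<lambda>\<nu>. \<i> * of_real \<omega> * of_int \<nu> * u \<nu>) t"
    by (simp add: fourier_series_def e'_def infsumI[symmetric] mult_ac)
  hence "((\<lambda>z. \<Sum>\<^sub>\<infinity>\<nu>. e \<nu> z) has_field_derivative fourier_series \<omega> (\<lambda>\<nu>. \<i> * of_real \<omega> * of_int \<nu> * u \<nu>) t) (at (of_real t))"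
    using g'[of "of_real t"] r by simp
  hence "((\<lambda>t. \<Sum>\<^sub>\<infinity>\<nu>. e \<nu> (of_real t)) has_vector_derivative fourier_series \<omega> (\<lambda>\<nu>. \<i> * of_real \<omega> * of_int \<nu> * u \<nu>) t) (at t)"
    by (rule has_vector_derivative_real_field)
  thus ?thesis by (simp add: e_def fourier_series_def[abs_def])
qed

lemma holomorphic_infsum:
  fixes f :: "'a \<Rightarrow> complex \<Rightarrow> complex"
  assumes "open S" and hol: "\<And>i. f i holomorphic_on S" and bound: "\<And>i z. z \<in> S \<Longrightarrow> norm (f i z) \<le> M i"
    and M: "M summable_on UNIV"
  shows "(\<lambda>z. \<Sum>\<^sub>\<infinity>i. f i z) holomorphic_on S"
  unfolding holomorphic_on_def
proof
  fix z assume z: "z \<in> S"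
  then obtain r where r: "r > 0" "cball z r \<subseteq> S" using assms(1) open_contains_cball by blast
  have ul: "uniform_limit (cball z r) (\<lambda>X z. \<Sum>i\<in>X. f i z) (\<lambda>z. \<Sum>\<^sub>\<infinity>i. f i z) (finite_subsets_at_top UNIV)"
    by (rule Weierstrass_m_test_general[OF bound M]) (use r in auto)
  have ev: "\<forall>\<^sub>F X in finite_subsets_at_top UNIV. continuous_on (cball z r) (\<lambda>z. \<Sum>i\<in>X. f i z) \<and> (\<lambda>z. \<Sum>i\<in>X. f i z) holomorphic_on ball z r"
  proof (rule always_eventually, intro allI conjI)
    fix X
    have h: "(\<lambda>z. \<Sum>i\<in>X. f i z) holomorphic_on cball z r"
      by (intro holomorphic_intros holomorphic_on_subset[OF hol r(2)])
    show "continuous_on (cball z r) (\<lambda>z. \<Sum>i\<in>X. f i z)" by (rule holomorphic_on_imp_continuous_on[OF h])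
    show "(\<lambda>z. \<Sum>i\<in>X. f i z) holomorphic_on ball z r" by (rule holomorphic_on_subset[OF h]) auto
  qed
  have "(\<lambda>z. \<Sum>\<^sub>\<infinity>i. f i z) holomorphic_on ball z r"
    using holomorphic_uniform_limit[OF ev ul finite_subsets_at_top_neq_bot] by blast
  thus "(\<lambda>z. \<Sum>\<^sub>\<infinity>i. f i z) field_differentiable at z within S"
    using r(1) by (metis centre_in_ball field_differentiable_at_within holomorphic_on_imp_differentiable_at open_ball)
qed

section \<open>Formal and resummed coefficients\<close>

lemma fourier_conv_linear_right:
  assumes "weighted_summable 0 u" "weighted_summable 0 v" "weighted_summable 0 w"
  shows "fourier_conv u (\<lambda>\<nu>. a * v \<nu> + b * w \<nu>) \<nu> = a * fourier_conv u v \<nu> + b * fourier_conv u w \<nu>"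
proof -
  have "((\<lambda>k. a * (u k * v (\<nu> - k)) + b * (u k * w (\<nu> - k))) has_sum a * fourier_conv u v \<nu> + b * fourier_conv u w \<nu>) UNIV"
    unfolding fourier_conv_def
    by (intro has_sum_add has_sum_cmult_right has_sum_infsum summable_on_conv[OF order_refl] assms)
  moreover have "a * (u k * v (\<nu> - k)) + b * (u k * w (\<nu> - k)) = u k * (a * v (\<nu> - k) + b * w (\<nu> - k))" for k
    by (simp add: algebra_simps)
  ultimately show ?thesis by (simp add: fourier_conv_def infsumI)
qed

lemma fourier_conv_linear_left:
  assumes "weighted_summable 0 u" "weighted_summable 0 v" "weighted_summable 0 w"
  shows "fourier_conv (\<lambda>\<nu>. a * v \<nu> + b * w \<nu>) u \<nu> = a * fourier_conv v u \<nu> + b * fourier_conv w u \<nu>"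
proof -
  have "((\<lambda>k. a * (v k * u (\<nu> - k)) + b * (w k * u (\<nu> - k))) has_sum a * fourier_conv v u \<nu> + b * fourier_conv w u \<nu>) UNIV"
    unfolding fourier_conv_def
    by (intro has_sum_add has_sum_cmult_right has_sum_infsum summable_on_conv[OF order_refl] assms)
  moreover have "a * (v k * u (\<nu> - k)) + b * (w k * u (\<nu> - k)) = (a * v k + b * w k) * u (\<nu> - k)" for k
    by (simp add: algebra_simps)
  ultimately show ?thesis by (simp add: fourier_conv_def infsumI)
qed

text \<open>Equivalently, the formal square of the series has zero mode \<open>c\<^sup>2\<close>.\<close>
lemma zero_mode_of_square:
  fixes z :: "nat \<Rightarrow> int \<Rightarrow> complex"
  assumes c: "c \<noteq> 0" and z0: "z 0 = (\<lambda>\<nu>. if \<nu> = 0 then c else 0)"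
    and zero: "z (Suc k) 0 = - (1 / (2 * c)) * (\<Sum>j\<in>{1..k}. fourier_conv (z (Suc k - j)) (z j) 0)"
  shows "(\<Sum>j\<le>Suc k. fourier_conv (z j) (z (Suc k - j)) 0) = 0"
proof -
  have "{..Suc k} = insert 0 (insert (Suc k) {1..k})" by auto
  hence "(\<Sum>j\<le>Suc k. fourier_conv (z j) (z (Suc k - j)) 0) = fourier_conv (z 0) (z (Suc k)) 0
     + (fourier_conv (z (Suc k)) (z 0) 0 + (\<Sum>j\<in>{1..k}. fourier_conv (z j) (z (Suc k - j)) 0))" by simp
  also have "(\<Sum>j\<in>{1..k}. fourier_conv (z j) (z (Suc k - j)) 0) = (\<Sum>j\<in>{1..k}. fourier_conv (z (Suc k - j)) (z j) 0)"
    by (rule sum.reindex_bij_witness[of _ "\<lambda>j. Suc k - j" "\<lambda>j. Suc k - j"]) auto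
  also have "\<dots> = - (2 * c) * z (Suc k) 0" unfolding zero using c by simp
  finally show ?thesis unfolding z0 fourier_conv_single_left fourier_conv_single_right by simp
qed

text \<open>Here c is the square root of \<alpha>; \<open>F_0\<close> then encodes the average
  \<alpha> of the forcing, and \<open>F_sym\<close> that the forcing is real.\<close>

locale forcing =
  fixes c \<omega> \<xi> :: real and F :: "int \<Rightarrow> complex"
  assumes c: "c > 0" and \<omega>: "\<omega> \<noteq> 0" and \<xi>: "\<xi> > 0"
    and F: "weighted_summable \<xi> F" and F_0: "F 0 = (of_real c)\<^sup>2" and F_sym: "\<And>\<nu>. F (- \<nu>) = cnj (F \<nu>)"
begin

definition K :: real where "K = wnorm \<xi> F + (3 * c / 2)\<^sup>2"

lemma K_pos: "K > 0"
  using wnorm_nonneg[of \<xi> F] c by (simp add: K_def add_nonneg_pos)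

text \<open>Chosen so that 2 (R0/|\<omega>|) K = c/8, the smallness condition of the majorant with
  lam = 2 and \<delta> = R0/|\<omega>|.\<close>

definition R0 :: real where "R0 = c * \<bar>\<omega>\<bar> / (16 * K)"

lemma R0_pos: "R0 > 0"
  using c \<omega> K_pos by (simp add: R0_def)

text \<open>Shared by the two discs and by a real interval around 0, so that one set of estimates
  serves the complex and the real statements.\<close>

definition admissible :: "complex \<Rightarrow> bool" where
  "admissible \<epsilon> \<longleftrightarrow> (\<forall>\<nu>::int. 1 + \<i> * \<epsilon> * of_real \<omega> * of_int \<nu> \<noteq> 0 \<and>
     norm (\<epsilon> / (1 + \<i> * \<epsilon> * of_real \<omega> * of_int \<nu>)) \<le> R0)"

text \<open>The real part of 1/\<epsilon> + i\<omega>\<nu> does not depend on \<nu>, which excludes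
  small denominators.\<close>

lemma admissibleI:
  assumes "\<epsilon> = 0 \<or> \<bar>Re (1 / \<epsilon>)\<bar> \<ge> 1 / R0" shows "admissible \<epsilon>"
proof (cases "\<epsilon> = 0")
  case True
  thus ?thesis using R0_pos by (simp add: admissible_def)
next
  case False
  show ?thesis unfolding admissible_def
  proof (intro allI)
    fix \<nu> :: int
    define w where "w = 1 / \<epsilon> + \<i> * of_real \<omega> * of_int \<nu>"
    have Rew: "Re w = Re (1 / \<epsilon>)" by (simp add: w_def)
    have "1 / R0 \<le> \<bar>Re w\<bar>" using assms False Rew by simp
    also have "\<dots> \<le> norm w" by (rule abs_Re_le_cmod)
    finally have nw: "1 / R0 \<le> norm w" .
    hence w0: "w \<noteq> 0" using R0_pos by auto
    have eq: "1 + \<i> * \<epsilon> * of_real \<omega> * of_int \<nu> = \<epsilon> * w"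
      using False by (simp add: w_def algebra_simps)
    have "norm (\<epsilon> / (\<epsilon> * w)) = 1 / norm w" using False by (simp add: norm_divide)
    also have "\<dots> \<le> R0" using nw R0_pos w0 by (simp add: field_simps)
    finally show "1 + \<i> * \<epsilon> * of_real \<omega> * of_int \<nu> \<noteq> 0 \<and> norm (\<epsilon> / (1 + \<i> * \<epsilon> * of_real \<omega> * of_int \<nu>)) \<le> R0"
      unfolding eq using False w0 by simp
  qed
qed

lemma two_discs_admissible: "\<epsilon> \<in> two_discs R \<Longrightarrow> 0 < R \<Longrightarrow> R \<le> R0 \<Longrightarrow> admissible \<epsilon>"
  by (rule admissibleI) (use divide_left_mono[of R R0 1] in \<open>simp add: two_discs_def\<close>)

lemma real_admissible: "\<bar>\<epsilon>\<bar> \<le> R0 \<Longrightarrow> admissible (of_real \<epsilon>)"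
proof (rule admissibleI)
  assume "\<bar>\<epsilon>\<bar> \<le> R0"
  hence "1 / R0 \<le> 1 / \<bar>\<epsilon>\<bar>" if "\<epsilon> \<noteq> 0" using that R0_pos by (intro divide_left_mono) auto
  moreover have "Re (1 / complex_of_real \<epsilon>) = 1 / \<epsilon>" by (metis Re_complex_of_real of_real_1 of_real_divide)
  ultimately show "complex_of_real \<epsilon> = 0 \<or> 1 / R0 \<le> \<bar>Re (1 / complex_of_real \<epsilon>)\<bar>" by auto
qed

section \<open>Resummed coefficients and the equation solved by their sum\<close>

abbreviation x :: "complex \<Rightarrow> nat \<Rightarrow> int \<Rightarrow> complex" where "x \<equiv> resummed_coeff c \<omega> F"
abbreviation y :: "nat \<Rightarrow> int \<Rightarrow> complex" where "y \<equiv> formal_coeff c \<omega> F"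

lemma x_Suc_0: "x \<epsilon> (Suc k) 0 = - (1 / (2 * of_real c)) * (\<Sum>j\<in>{1..k}. fourier_conv (x \<epsilon> (Suc k - j)) (x \<epsilon> j) 0)"
  by (cases k) simp_all

text \<open>One formula for all k: at k = 0 the convolution of \<open>x \<epsilon> 0\<close> with
  itself has no mode \<nu> \<noteq> 0, so only F \<nu> remains.\<close>

lemma x_Suc:
  assumes "\<nu> \<noteq> 0"
  shows "x \<epsilon> (Suc k) \<nu> = \<epsilon> / (\<i> * of_real \<omega> * of_int \<nu> * (1 + \<i> * \<epsilon> * of_real \<omega> * of_int \<nu>)) *
    ((if k = 0 then F \<nu> else 0) - (\<Sum>j\<le>k. fourier_conv (x \<epsilon> j) (x \<epsilon> (k - j)) \<nu>))"
proof (cases k)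
  case 0
  thus ?thesis using assms by (simp add: fourier_conv_single_left)
next
  case (Suc n)
  have "x \<epsilon> (Suc k) \<nu> = - (\<epsilon> / (\<i> * of_real \<omega> * of_int \<nu> * (1 + \<i> * \<epsilon> * of_real \<omega> * of_int \<nu>))) *
    (\<Sum>j\<le>k. fourier_conv (x \<epsilon> j) (x \<epsilon> (k - j)) \<nu>)"
    unfolding Suc resummed_coeff.simps(3) atLeast0AtMost using assms by (rule if_not_P)
  thus ?thesis by (simp add: Suc del: resummed_coeff.simps sum.atMost_Suc)
qed

lemma y_Suc_0: "y (Suc k) 0 = - (1 / (2 * of_real c)) * (\<Sum>j\<in>{1..k}. fourier_conv (y (Suc k - j)) (y j) 0)"
  by (cases k) simp_all

lemma y_Suc:
  assumes "\<nu> \<noteq> 0"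
  shows "y (Suc k) \<nu> = - (\<i> * of_real \<omega> * of_int \<nu>) * y k \<nu> + 1 / (\<i> * of_real \<omega> * of_int \<nu>) *
    ((if k = 0 then F \<nu> else 0) - (\<Sum>j\<le>k. fourier_conv (y j) (y (k - j)) \<nu>))"
proof (cases k)
  case 0
  thus ?thesis using assms by (simp add: fourier_conv_single_left)
next
  case (Suc n)
  have "y (Suc k) \<nu> = - (\<i> * of_real \<omega> * of_int \<nu>) * y k \<nu> - 1 / (\<i> * of_real \<omega> * of_int \<nu>) *
    (\<Sum>j\<le>k. fourier_conv (y j) (y (k - j)) \<nu>)"
    unfolding Suc formal_coeff.simps(3) atLeast0AtMost using assms by (rule if_not_P)
  thus ?thesis by (simp add: Suc del: formal_coeff.simps sum.atMost_Suc)
qed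

lemma abs_int_ge_1: "\<nu> \<noteq> 0 \<Longrightarrow> \<bar>real_of_int \<nu>\<bar> \<ge> 1"
  by simp

text \<open>No derivative occurs, so the width \<xi> is kept; lam = 2 yields geometric decay of the
  terms.\<close>

lemma x_majorant:
  assumes adm: "admissible \<epsilon>"
  shows "\<And>k. k \<le> N \<Longrightarrow> weighted_summable \<xi> (x \<epsilon> k)" "(\<Sum>k\<in>{1..N}. 2 ^ k * wnorm \<xi> (x \<epsilon> k)) \<le> c / 2"
proof -
  let ?\<delta> = "R0 / \<bar>\<omega>\<bar>"
  have small: "2 * ?\<delta> * (wnorm \<xi> F + (3 * c / 2)\<^sup>2) \<le> c / 8"
    unfolding K_def[symmetric] using K_pos \<omega> by (simp add: R0_def)
  have step: "norm (x \<epsilon> (Suc k) \<nu>) \<le> 0 * \<bar>of_int \<nu>\<bar> * norm (x \<epsilon> k \<nu>)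
      + ?\<delta> * norm ((if k = 0 then F \<nu> else 0) - (\<Sum>j\<le>k. fourier_conv (x \<epsilon> j) (x \<epsilon> (k - j)) \<nu>))" if \<nu>: "\<nu> \<noteq> 0" for k \<nu>
  proof -
    have "norm (\<epsilon> / (\<i> * of_real \<omega> * of_int \<nu> * (1 + \<i> * \<epsilon> * of_real \<omega> * of_int \<nu>))) =
        norm (\<epsilon> / (1 + \<i> * \<epsilon> * of_real \<omega> * of_int \<nu>)) / (\<bar>\<omega>\<bar> * \<bar>of_int \<nu>\<bar>)"
      by (simp add: norm_divide norm_mult)
    also have "\<dots> \<le> R0 / (\<bar>\<omega>\<bar> * 1)"
      using adm \<omega> R0_pos abs_int_ge_1[OF \<nu>] unfolding admissible_def
      by (intro frac_le mult_left_mono) auto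
    finally have "norm (\<epsilon> / (\<i> * of_real \<omega> * of_int \<nu> * (1 + \<i> * \<epsilon> * of_real \<omega> * of_int \<nu>))) \<le> ?\<delta>" by simp
    from mult_right_mono[OF this norm_ge_zero] show ?thesis
      unfolding x_Suc[OF \<nu>] norm_mult mult_zero_left add_0 .
  qed
  have "0 \<le> ?\<delta>" using R0_pos by simp
  note maj = recursion_majorant[where x = "x \<epsilon>" and \<xi> = "\<lambda>_. \<xi>" and F = F and D = 0 and \<delta> = ?\<delta> and lam = 2
      and \<Phi> = "wnorm \<xi> F" and c = c and N = N, OF c _ _ _ F order_refl order_refl this _ _ small _ step]
  show "weighted_summable \<xi> (x \<epsilon> k)" if "k \<le> N" for k
    by (rule maj(1)) (use \<xi> that x_Suc_0 in simp_all)
  show "(\<Sum>k\<in>{1..N}. 2 ^ k * wnorm \<xi> (x \<epsilon> k)) \<le> c / 2"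
    by (rule maj(2)) (use \<xi> x_Suc_0 in simp_all)
qed

lemma x_weighted_summable: "admissible \<epsilon> \<Longrightarrow> weighted_summable \<xi> (x \<epsilon> k)"
  using x_majorant(1)[of \<epsilon> k k] by simp

lemma wnorm_x_Suc_le:
  assumes "admissible \<epsilon>" shows "wnorm \<xi> (x \<epsilon> (Suc k)) \<le> c / 2 * (1/2) ^ Suc k"
proof -
  have "2 ^ Suc k * wnorm \<xi> (x \<epsilon> (Suc k)) \<le> (\<Sum>k\<in>{1..Suc k}. 2 ^ k * wnorm \<xi> (x \<epsilon> k))"
    by (rule member_le_sum) (auto intro!: mult_nonneg_nonneg wnorm_nonneg)
  also have "\<dots> \<le> c / 2" by (rule x_majorant(2)[OF assms])
  finally show ?thesis by (simp add: field_simps)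
qed

lemma wnorm_x_le:
  assumes "admissible \<epsilon>" shows "wnorm \<xi> (x \<epsilon> k) \<le> c * (1/2) ^ k"
proof (cases k)
  case 0
  thus ?thesis using c by (simp add: wnorm_single)
next
  case (Suc n)
  have "wnorm \<xi> (x \<epsilon> k) \<le> c / 2 * (1/2) ^ k" unfolding Suc by (rule wnorm_x_Suc_le[OF assms])
  also have "\<dots> \<le> c * (1/2) ^ k" using c by (intro mult_right_mono) auto
  finally show ?thesis .
qed

lemma summable_geom: "summable (\<lambda>k. c * (1/2::real) ^ k)"
  by (intro summable_mult summable_geometric) simp

definition X :: "complex \<Rightarrow> int \<Rightarrow> complex" where "X \<epsilon> \<nu> = (\<Sum>k. x \<epsilon> k \<nu>)"

lemma x_sums:
  assumes "admissible \<epsilon>" shows "(\<lambda>k. x \<epsilon> k \<nu>) sums X \<epsilon> \<nu>"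
  unfolding X_def
  by (rule summable_sums, rule summable_norm_cancel,
     rule resum_summable[OF less_imp_le[OF \<xi>] x_weighted_summable[OF assms] wnorm_x_le[OF assms] summable_geom])

lemma X_weighted_summable:
  assumes "admissible \<epsilon>" shows "weighted_summable \<xi> (X \<epsilon>)"
  using resum_wnorm(1)[OF less_imp_le[OF \<xi>] x_weighted_summable[OF assms] wnorm_x_le[OF assms] summable_geom]
  by (simp add: X_def[abs_def])

text \<open>The terms with k \<ge> 1 are at most (c/2) 2^(-k), with sum c/2. This closeness to the
  constant c is what the zero-mode equation of the remainders needs.\<close>

lemma X_minus:
  assumes "admissible \<epsilon>"
  shows "weighted_summable \<xi> (\<lambda>\<nu>. X \<epsilon> \<nu> - y 0 \<nu>)" "wnorm \<xi> (\<lambda>\<nu>. X \<epsilon> \<nu> - y 0 \<nu>) \<le> c / 2"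
proof -
  have s: "(\<lambda>k. c / 2 * (1/2::real) ^ Suc k) sums (c / 2 * 1)"
    using sums_mult[OF power_half_series, of "c/2"] .
  have "(\<lambda>k. x \<epsilon> (Suc k) \<nu>) sums (X \<epsilon> \<nu> - y 0 \<nu>)" for \<nu>
    using x_sums[OF assms, of \<nu>] by (subst sums_Suc_iff) simp
  hence "(\<lambda>\<nu>. \<Sum>k. x \<epsilon> (Suc k) \<nu>) = (\<lambda>\<nu>. X \<epsilon> \<nu> - y 0 \<nu>)" by (auto simp: sums_iff)
  thus "weighted_summable \<xi> (\<lambda>\<nu>. X \<epsilon> \<nu> - y 0 \<nu>)" "wnorm \<xi> (\<lambda>\<nu>. X \<epsilon> \<nu> - y 0 \<nu>) \<le> c / 2"
    using resum_wnorm[OF less_imp_le[OF \<xi>] x_weighted_summable[OF assms] wnorm_x_Suc_le[OF assms] sums_summable[OF s]]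
    unfolding sums_unique[OF s, symmetric] by (simp_all only: mult_1_right)
qed

lemma conv_x_sums:
  assumes "admissible \<epsilon>"
  shows "(\<lambda>n. \<Sum>j\<le>n. fourier_conv (x \<epsilon> j) (x \<epsilon> (n - j)) \<nu>) sums fourier_conv (X \<epsilon>) (X \<epsilon>) \<nu>"
  using conv_resum[OF less_imp_le[OF \<xi>] x_weighted_summable[OF assms] wnorm_x_le[OF assms] summable_geom]
  by (simp add: X_def[abs_def])

text \<open>The zero-mode recursion is arranged so that every order k \<ge> 1 of the square has zero
  mode 0; only c^2 survives. Since F 0 = c^2, this is the mode \<nu> = 0 of the differential
  equation.\<close>

lemma X_square_zero_mode:
  assumes "admissible \<epsilon>" shows "fourier_conv (X \<epsilon>) (X \<epsilon>) 0 = (of_real c)\<^sup>2"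
proof -
  let ?q = "\<lambda>n. \<Sum>j\<le>n. fourier_conv (x \<epsilon> j) (x \<epsilon> (n - j)) 0"
  have "?q (Suc k) = 0" for k
    by (rule zero_mode_of_square[OF _ _ x_Suc_0]) (use c in auto)
  hence "?q sums (\<Sum>n\<in>{0}. ?q n)" by (intro sums_finite) (auto simp: gr0_conv_Suc)
  from sums_unique2[OF conv_x_sums[OF assms, of 0] this]
  have "fourier_conv (X \<epsilon>) (X \<epsilon>) 0 = (\<Sum>n\<in>{0}. ?q n)" .
  also have "(\<Sum>n\<in>{0}. ?q n) = (of_real c)\<^sup>2"
    by (simp add: fourier_conv_single_left power2_eq_square)
  finally show ?thesis .
qed

lemma X_equation:
  assumes "admissible \<epsilon>" "\<nu> \<noteq> 0"
  shows "(\<i> * of_real \<omega> * of_int \<nu>) * (1 + \<i> * \<epsilon> * of_real \<omega> * of_int \<nu>) * X \<epsilon> \<nu> = \<epsilon> * (F \<nu> - fourier_conv (X \<epsilon>) (X \<epsilon>) \<nu>)"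
proof -
  let ?d = "(\<i> * of_real \<omega> * of_int \<nu>) * (1 + \<i> * \<epsilon> * of_real \<omega> * of_int \<nu>)"
  have d: "?d \<noteq> 0" using assms \<omega> unfolding admissible_def by simp
  have "(\<lambda>k. x \<epsilon> (Suc k) \<nu>) sums (X \<epsilon> \<nu> - 0)"
    using x_sums[OF assms(1), of \<nu>] assms(2) by (subst sums_Suc_iff) simp
  moreover have "(\<lambda>k. \<epsilon> / ?d * ((if k = 0 then F \<nu> else 0) - (\<Sum>j\<le>k. fourier_conv (x \<epsilon> j) (x \<epsilon> (k - j)) \<nu>)))
      sums (\<epsilon> / ?d * (F \<nu> - fourier_conv (X \<epsilon>) (X \<epsilon>) \<nu>))"
    by (intro sums_mult sums_diff conv_x_sums[OF assms(1)] sums_single[of 0 "\<lambda>_. F \<nu>"])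
  ultimately have "X \<epsilon> \<nu> = \<epsilon> / ?d * (F \<nu> - fourier_conv (X \<epsilon>) (X \<epsilon>) \<nu>)"
    unfolding x_Suc[OF assms(2)] diff_zero by (rule sums_unique2)
  thus ?thesis using d by (simp add: field_simps)
qed

text \<open>Two demands on lam = L/N: the first entry serves \<open>level_deriv\<close>, the second
  \<open>level_small\<close>.\<close>

definition L :: real where "L = min (\<xi> / (8 * \<bar>\<omega>\<bar>)) (c * \<bar>\<omega>\<bar> / (8 * K))"

lemma L_pos: "L > 0"
  using \<xi> \<omega> c K_pos by (simp add: L_def)

text \<open>Width 0 is reached exactly at k = N, where the plain sum of moduli is all that the final
  remainder bound requires.\<close>

definition level :: "nat \<Rightarrow> nat \<Rightarrow> real" where "level N k = \<xi> * (1 - real k / real N)"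

section \<open>Formal coefficients and remainders under loss of analyticity\<close>

context
  fixes N :: nat
  assumes N: "N > 0"
begin

lemma level_props:
  shows "level N (Suc k) \<le> level N k" "k \<le> N \<Longrightarrow> 0 \<le> level N k" "level N 0 = \<xi>" "level N N = 0"
proof -
  show "level N (Suc k) \<le> level N k" unfolding level_def
    using \<xi> by (intro mult_left_mono diff_left_mono divide_right_mono) auto
  show "0 \<le> level N k" if "k \<le> N" unfolding level_def
    using \<xi> that N by (intro mult_nonneg_nonneg) auto
qed (use N in \<open>simp_all add: level_def\<close>)

text \<open>u \<le> exp u with u = \<xi>|\<nu>|/N: a loss of \<xi>/N in width pays for one factor
  |\<nu>| at the price N/\<xi>.\<close>

lemma level_deriv: "L / real N * (\<bar>\<omega>\<bar> * \<bar>of_int \<nu>\<bar>) * weight (level N (Suc k)) \<nu> \<le> 1/8 * weight (level N k) \<nu>"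
proof -
  define u where "u = \<xi> * \<bar>of_int \<nu>\<bar> / real N"
  have "level N k = level N (Suc k) + \<xi> / real N" by (simp add: level_def algebra_simps add_divide_distrib)
  hence w: "weight (level N k) \<nu> = weight (level N (Suc k)) \<nu> * exp u"
    by (simp add: weight_def u_def exp_add[symmetric] algebra_simps)
  have "L * (\<bar>\<omega>\<bar> * \<bar>of_int \<nu>\<bar>) \<le> \<xi> / (8 * \<bar>\<omega>\<bar>) * (\<bar>\<omega>\<bar> * \<bar>of_int \<nu>\<bar>)"
    by (intro mult_right_mono) (auto simp: L_def)
  hence "L / real N * (\<bar>\<omega>\<bar> * \<bar>of_int \<nu>\<bar>) \<le> 1/8 * u" using \<omega> N by (simp add: u_def field_simps)
  also have "\<dots> \<le> 1/8 * exp u" using exp_ge_add_one_self[of u] by linarith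
  finally have "L / real N * (\<bar>\<omega>\<bar> * \<bar>of_int \<nu>\<bar>) * weight (level N (Suc k)) \<nu> \<le> 1/8 * exp u * weight (level N (Suc k)) \<nu>"
    by (rule mult_right_mono) simp
  thus ?thesis by (simp add: w mult_ac)
qed

lemma level_small: "L / real N * (1 / \<bar>\<omega>\<bar>) * (wnorm \<xi> F + (3 * c / 2)\<^sup>2) \<le> c / 8"
proof -
  have "L / real N \<le> L / 1" using L_pos N by (intro divide_left_mono) auto
  also have "\<dots> \<le> c * \<bar>\<omega>\<bar> / (8 * K)" by (simp add: L_def)
  finally have "L / real N * (1 / \<bar>\<omega>\<bar>) * K \<le> c * \<bar>\<omega>\<bar> / (8 * K) * (1 / \<bar>\<omega>\<bar>) * K"
    using K_pos by (intro mult_right_mono) auto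
  also have "\<dots> = c / 8" using K_pos \<omega> by simp
  finally show ?thesis unfolding K_def .
qed

lemma y_majorant:
  shows "\<And>k. k \<le> N \<Longrightarrow> weighted_summable (level N k) (y k)"
    and "(\<Sum>k\<in>{1..N}. (L / real N) ^ k * wnorm (level N k) (y k)) \<le> c / 2"
proof -
  have step: "norm (y (Suc k) \<nu>) \<le> \<bar>\<omega>\<bar> * \<bar>of_int \<nu>\<bar> * norm (y k \<nu>)
      + 1 / \<bar>\<omega>\<bar> * norm ((if k = 0 then F \<nu> else 0) - (\<Sum>j\<le>k. fourier_conv (y j) (y (k - j)) \<nu>))" if \<nu>: "\<nu> \<noteq> 0" for k \<nu>
  proof -
    let ?b = "(if k = 0 then F \<nu> else 0) - (\<Sum>j\<le>k. fourier_conv (y j) (y (k - j)) \<nu>)"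
    have "norm (y (Suc k) \<nu>) \<le> norm (- (\<i> * of_real \<omega> * of_int \<nu>) * y k \<nu>) + norm (1 / (\<i> * of_real \<omega> * of_int \<nu>) * ?b)"
      unfolding y_Suc[OF \<nu>] by (rule norm_triangle_ineq)
    also have "\<dots> = \<bar>\<omega>\<bar> * \<bar>of_int \<nu>\<bar> * norm (y k \<nu>) + 1 / (\<bar>\<omega>\<bar> * \<bar>of_int \<nu>\<bar>) * norm ?b"
      by (simp add: norm_mult norm_divide)
    also have "\<dots> \<le> \<bar>\<omega>\<bar> * \<bar>of_int \<nu>\<bar> * norm (y k \<nu>) + 1 / (\<bar>\<omega>\<bar> * 1) * norm ?b"
      using \<omega> abs_int_ge_1[OF \<nu>] by (intro add_left_mono mult_right_mono divide_left_mono mult_left_mono) auto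
    finally show ?thesis by simp
  qed
  have F': "weighted_summable (level N 0) F" "wnorm (level N 0) F \<le> wnorm \<xi> F" using F by (simp_all add: level_props)
  have pos: "0 \<le> \<bar>\<omega>\<bar>" "0 \<le> 1 / \<bar>\<omega>\<bar>" "0 < L / real N" using L_pos N by auto
  note maj = recursion_majorant[where x = y and \<xi> = "level N" and F = F and D = "\<bar>\<omega>\<bar>" and \<delta> = "1 / \<bar>\<omega>\<bar>" and lam = "L / real N"
      and \<Phi> = "wnorm \<xi> F" and c = c and N = N, OF c formal_coeff.simps(1) level_props(1,2) F' pos level_deriv level_small y_Suc_0 step]
  show "weighted_summable (level N k) (y k)" if "k \<le> N" for k by (rule maj(1)) (use that in auto)
  show "(\<Sum>k\<in>{1..N}. (L / real N) ^ k * wnorm (level N k) (y k)) \<le> c / 2" by (rule maj(2)) auto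
qed

end

lemma y_weighted_summable: "weighted_summable 0 (y k)"
  using wnorm_mono(1)[OF level_props(2)[of "Suc k" k] y_majorant(1)[of "Suc k" k]] by simp

definition \<rho> :: "complex \<Rightarrow> nat \<Rightarrow> int \<Rightarrow> complex" where
  "\<rho> \<epsilon> k \<nu> = (X \<epsilon> \<nu> - (\<Sum>j<k. \<epsilon> ^ j * y j \<nu>)) / \<epsilon> ^ k"

lemma \<rho>_0: "\<rho> \<epsilon> 0 = X \<epsilon>"
  by (simp add: \<rho>_def fun_eq_iff)

lemma \<rho>_Suc: "\<epsilon> \<noteq> 0 \<Longrightarrow> \<rho> \<epsilon> (Suc k) \<nu> = (1 / \<epsilon>) * \<rho> \<epsilon> k \<nu> + (- 1 / \<epsilon>) * y k \<nu>"
  by (simp add: \<rho>_def field_simps)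

lemma \<rho>_weighted_summable:
  assumes adm: "admissible \<epsilon>" and k: "k \<le> N" "N > 0"
  shows "weighted_summable (level N k) (\<rho> \<epsilon> k)"
proof -
  have "weighted_summable (level N k) (X \<epsilon>)"
    using wnorm_mono(1)[OF _ X_weighted_summable[OF adm]] decreasing_up_to[of N "level N" 0 k] level_props[OF k(2)] k by simp
  moreover have "weighted_summable (level N k) (y j)" if "j < k" for j
    using wnorm_mono(1)[OF decreasing_up_to[of N "level N" j k] y_majorant(1)[OF k(2), of j]] level_props[OF k(2)] that k by simp
  ultimately have "weighted_summable (level N k) (\<lambda>\<nu>. X \<epsilon> \<nu> - (\<Sum>j<k. \<epsilon> ^ j * y j \<nu>))"
    by (intro weighted_summable_diff weighted_summable_sum wnorm_scale) auto
  from wnorm_scale(1)[OF this, of "1 / \<epsilon> ^ k"] show ?thesis by (simp add: \<rho>_def[abs_def])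
qed

lemma \<rho>_weighted_summable_0: "admissible \<epsilon> \<Longrightarrow> weighted_summable 0 (\<rho> \<epsilon> k)"
  using wnorm_mono(1)[OF level_props(2)[of "Suc k" k] \<rho>_weighted_summable[of \<epsilon> k "Suc k"]] by simp

text \<open>Telescoped so that each product pairs one remainder with a formal coefficient or with X;
  no product of two remainders of positive order arises, which keeps the estimate linear.\<close>

definition Q :: "complex \<Rightarrow> nat \<Rightarrow> int \<Rightarrow> complex" where
  "Q \<epsilon> k \<nu> = (\<Sum>j<k. fourier_conv (y j) (\<rho> \<epsilon> (k - j)) \<nu>) + fourier_conv (\<rho> \<epsilon> k) (X \<epsilon>) \<nu>"

text \<open>\<open>Q \<epsilon> k\<close> is the remainder of order \<open>k\<close> of the expansion of the square, divided by \<open>\<epsilon>\<^sup>k\<close>.\<close>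
lemma Q_Suc:
  assumes adm: "admissible \<epsilon>" and \<epsilon>: "\<epsilon> \<noteq> 0"
  shows "Q \<epsilon> (Suc k) \<nu> = (1 / \<epsilon>) * (Q \<epsilon> k \<nu> - (\<Sum>j\<le>k. fourier_conv (y j) (y (k - j)) \<nu>))"
proof -
  note ws = y_weighted_summable \<rho>_weighted_summable_0[OF adm]
  have wX: "weighted_summable 0 (X \<epsilon>)" using ws(2)[of 0] by (simp add: \<rho>_0)
  have \<rho>_Suc': "\<rho> \<epsilon> (Suc k) = (\<lambda>\<nu>. (1 / \<epsilon>) * \<rho> \<epsilon> k \<nu> + (- 1 / \<epsilon>) * y k \<nu>)" for k
    using \<rho>_Suc[OF \<epsilon>] by (simp add: fun_eq_iff)
  have 1: "fourier_conv (y j) (\<rho> \<epsilon> (Suc k - j)) \<nu> = (1 / \<epsilon>) * fourier_conv (y j) (\<rho> \<epsilon> (k - j)) \<nu> + (- 1 / \<epsilon>) * fourier_conv (y j) (y (k - j)) \<nu>" if "j \<le> k" for j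
    unfolding Suc_diff_le[OF that] \<rho>_Suc' by (intro fourier_conv_linear_right ws)
  have 2: "fourier_conv (\<rho> \<epsilon> (Suc k)) (X \<epsilon>) \<nu> = (1 / \<epsilon>) * fourier_conv (\<rho> \<epsilon> k) (X \<epsilon>) \<nu> + (- 1 / \<epsilon>) * fourier_conv (y k) (X \<epsilon>) \<nu>"
    unfolding \<rho>_Suc' by (intro fourier_conv_linear_left ws wX)
  have "(\<Sum>j\<le>k. fourier_conv (y j) (\<rho> \<epsilon> (Suc k - j)) \<nu>) =
     (1 / \<epsilon>) * (\<Sum>j\<le>k. fourier_conv (y j) (\<rho> \<epsilon> (k - j)) \<nu>) + (- 1 / \<epsilon>) * (\<Sum>j\<le>k. fourier_conv (y j) (y (k - j)) \<nu>)"
    unfolding sum_distrib_left sum.distrib[symmetric] by (rule sum.cong[OF refl], rule 1) simp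
  also have "(\<Sum>j\<le>k. fourier_conv (y j) (\<rho> \<epsilon> (k - j)) \<nu>) = (\<Sum>j<k. fourier_conv (y j) (\<rho> \<epsilon> (k - j)) \<nu>) + fourier_conv (y k) (X \<epsilon>) \<nu>"
    by (simp add: lessThan_Suc_atMost[symmetric] \<rho>_0)
  finally show ?thesis unfolding Q_def lessThan_Suc_atMost 2 by (simp add: algebra_simps)
qed

text \<open>At k = 0 this is the mode equation divided by i\<omega>\<nu>\<epsilon>, with 1 +
  i\<epsilon>\<omega>\<nu> multiplied out so that it becomes a derivative and not a denominator.
  Each further step subtracts the recursion of y and divides by \<epsilon>.\<close>

lemma \<rho>_step:
  assumes adm: "admissible \<epsilon>" and \<epsilon>: "\<epsilon> \<noteq> 0" and \<nu>: "\<nu> \<noteq> 0"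
  shows "\<rho> \<epsilon> (Suc k) \<nu> = - (\<i> * of_real \<omega> * of_int \<nu>) * \<rho> \<epsilon> k \<nu>
    + 1 / (\<i> * of_real \<omega> * of_int \<nu>) * ((if k = 0 then F \<nu> else 0) - Q \<epsilon> k \<nu>)"
proof (induction k)
  case 0
  let ?i = "\<i> * of_real \<omega> * of_int \<nu>"
  have i: "?i \<noteq> 0" using \<omega> \<nu> by simp
  have "?i * (1 + \<epsilon> * ?i) * X \<epsilon> \<nu> = \<epsilon> * (F \<nu> - fourier_conv (X \<epsilon>) (X \<epsilon>) \<nu>)"
    using X_equation[OF adm \<nu>] by (simp add: mult_ac)
  hence "X \<epsilon> \<nu> / \<epsilon> = - ?i * X \<epsilon> \<nu> + 1 / ?i * (F \<nu> - fourier_conv (X \<epsilon>) (X \<epsilon>) \<nu>)"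
    using i \<epsilon> by (simp add: divide_eq_eq eq_divide_eq) (simp add: field_simps)
  thus ?case using \<rho>_Suc[OF \<epsilon>, of 0 \<nu>] \<nu> by (simp add: Q_def \<rho>_0)
next
  case (Suc k)
  let ?i = "\<i> * of_real \<omega> * of_int \<nu>"
  let ?S = "\<Sum>j\<le>k. fourier_conv (y j) (y (k - j)) \<nu>"
  have "\<rho> \<epsilon> (Suc (Suc k)) \<nu> = (1 / \<epsilon>) * (\<rho> \<epsilon> (Suc k) \<nu> - y (Suc k) \<nu>)"
    by (simp add: \<rho>_Suc[OF \<epsilon>] algebra_simps)
  also have "\<rho> \<epsilon> (Suc k) \<nu> - y (Suc k) \<nu> = - ?i * (\<rho> \<epsilon> k \<nu> - y k \<nu>) - 1 / ?i * (Q \<epsilon> k \<nu> - ?S)"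
    unfolding Suc y_Suc[OF \<nu>] by (simp add: algebra_simps)
  also have "(1 / \<epsilon>) * (- ?i * (\<rho> \<epsilon> k \<nu> - y k \<nu>) - 1 / ?i * (Q \<epsilon> k \<nu> - ?S)) =
     - ?i * ((1 / \<epsilon>) * \<rho> \<epsilon> k \<nu> + (- 1 / \<epsilon>) * y k \<nu>) + 1 / ?i * (0 - (1 / \<epsilon>) * (Q \<epsilon> k \<nu> - ?S))"
    by (simp add: algebra_simps)
  also have "\<dots> = - ?i * \<rho> \<epsilon> (Suc k) \<nu> + 1 / ?i * (0 - Q \<epsilon> (Suc k) \<nu>)"
    by (simp only: \<rho>_Suc[OF \<epsilon>, of k] Q_Suc[OF adm \<epsilon>])
  finally show ?case by simp
qed

lemma Q_zero_mode:
  assumes adm: "admissible \<epsilon>" and \<epsilon>: "\<epsilon> \<noteq> 0"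
  shows "Q \<epsilon> (Suc k) 0 = 0"
proof (induction k)
  case 0
  have "Q \<epsilon> 0 0 = (of_real c)\<^sup>2" by (simp add: Q_def \<rho>_0 X_square_zero_mode[OF adm])
  thus ?case unfolding Q_Suc[OF adm \<epsilon>, of 0] by (simp add: fourier_conv_single_left power2_eq_square)
next
  case (Suc k)
  have "(\<Sum>j\<le>Suc k. fourier_conv (y j) (y (Suc k - j)) 0) = 0"
    by (rule zero_mode_of_square[OF _ formal_coeff.simps(1) y_Suc_0]) (use c in simp)
  thus ?case unfolding Q_Suc[OF adm \<epsilon>, of "Suc k"] Suc by simp
qed

text \<open>In the vanishing zero mode of \<open>Q \<epsilon> (Suc k)\<close>, the product with
  \<open>y 0\<close> on the left and the part \<open>y 0\<close> of X on the right each contribute c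
  times \<rho> (k+1); solving for these leaves X - y 0 as the last factor.\<close>

lemma \<rho>_zero_mode:
  assumes adm: "admissible \<epsilon>" and \<epsilon>: "\<epsilon> \<noteq> 0"
  shows "\<rho> \<epsilon> (Suc k) 0 = - (1 / (2 * of_real c)) * ((\<Sum>j\<in>{1..k}. fourier_conv (y j) (\<rho> \<epsilon> (Suc k - j)) 0)
     + fourier_conv (\<rho> \<epsilon> (Suc k)) (\<lambda>\<nu>. X \<epsilon> \<nu> - y 0 \<nu>) 0)"
proof -
  note ws = y_weighted_summable \<rho>_weighted_summable_0[OF adm]
  have wX: "weighted_summable 0 (X \<epsilon>)" using ws(2)[of 0] by (simp add: \<rho>_0)
  have "fourier_conv (\<rho> \<epsilon> (Suc k)) (\<lambda>\<nu>. 1 * X \<epsilon> \<nu> + (-1) * y 0 \<nu>) 0 = 1 * fourier_conv (\<rho> \<epsilon> (Suc k)) (X \<epsilon>) 0 + (-1) * fourier_conv (\<rho> \<epsilon> (Suc k)) (y 0) 0"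
    by (intro fourier_conv_linear_right ws wX)
  hence 1: "fourier_conv (\<rho> \<epsilon> (Suc k)) (\<lambda>\<nu>. X \<epsilon> \<nu> - y 0 \<nu>) 0 = fourier_conv (\<rho> \<epsilon> (Suc k)) (X \<epsilon>) 0 - \<rho> \<epsilon> (Suc k) 0 * of_real c"
    by (simp add: fourier_conv_single_right)
  have "{..<Suc k} = insert 0 {1..k}" by auto
  hence "Q \<epsilon> (Suc k) 0 = fourier_conv (y 0) (\<rho> \<epsilon> (Suc k)) 0 + (\<Sum>j\<in>{1..k}. fourier_conv (y j) (\<rho> \<epsilon> (Suc k - j)) 0) + fourier_conv (\<rho> \<epsilon> (Suc k)) (X \<epsilon>) 0"
    by (simp add: Q_def)
  hence "2 * of_real c * \<rho> \<epsilon> (Suc k) 0 = - ((\<Sum>j\<in>{1..k}. fourier_conv (y j) (\<rho> \<epsilon> (Suc k - j)) 0) + fourier_conv (\<rho> \<epsilon> (Suc k)) (\<lambda>\<nu>. X \<epsilon> \<nu> - y 0 \<nu>) 0)"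
    unfolding Q_zero_mode[OF adm \<epsilon>] 1 by (simp add: fourier_conv_single_left algebra_simps)
  thus ?thesis using c by (simp add: field_simps)
qed

text \<open>The last term k = N of the summed bound, where the level has dropped to 0.\<close>

lemma wnorm_\<rho>_le:
  assumes adm: "admissible \<epsilon>" and \<epsilon>: "\<epsilon> \<noteq> 0" and N: "N > 0"
  shows "wnorm 0 (\<rho> \<epsilon> N) \<le> c * (real N / L) ^ N"
proof -
  have lam: "0 < L / real N" using L_pos N by simp
  have "(\<Sum>k\<in>{1..N}. (L / real N) ^ k * wnorm (level N k) (\<rho> \<epsilon> k)) \<le> c"
  proof (rule remainder_majorant[where x = y and \<xi> = "level N" and F = F and D = "\<bar>\<omega>\<bar>" and \<delta> = "1 / \<bar>\<omega>\<bar>"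
        and \<Phi> = "wnorm \<xi> F"])
    show "weighted_summable (level N 0) (\<lambda>\<nu>. \<rho> \<epsilon> 0 \<nu> - y 0 \<nu>)" "wnorm (level N 0) (\<lambda>\<nu>. \<rho> \<epsilon> 0 \<nu> - y 0 \<nu>) \<le> c / 2"
      using X_minus[OF adm] by (simp_all only: \<rho>_0 level_props(3)[OF N])
    show "norm (\<rho> \<epsilon> (Suc k) 0) \<le> 1 / (2 * c) * norm ((\<Sum>j\<in>{1..k}. fourier_conv (y j) (\<rho> \<epsilon> (Suc k - j)) 0)
        + fourier_conv (\<rho> \<epsilon> (Suc k)) (\<lambda>\<nu>. \<rho> \<epsilon> 0 \<nu> - y 0 \<nu>) 0)" for k
      unfolding \<rho>_zero_mode[OF adm \<epsilon>] \<rho>_0 using c by (simp only: norm_mult norm_minus_cancel) (simp add: norm_divide)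
    fix k \<nu> assume \<nu>: "\<nu> \<noteq> (0::int)"
    let ?b = "(if k = 0 then F \<nu> else 0) - ((\<Sum>j<k. fourier_conv (y j) (\<rho> \<epsilon> (k - j)) \<nu>) + fourier_conv (\<rho> \<epsilon> k) (\<rho> \<epsilon> 0) \<nu>)"
    have "norm (\<rho> \<epsilon> (Suc k) \<nu>) \<le> norm (- (\<i> * of_real \<omega> * of_int \<nu>) * \<rho> \<epsilon> k \<nu>) + norm (1 / (\<i> * of_real \<omega> * of_int \<nu>) * ?b)"
      unfolding \<rho>_step[OF adm \<epsilon> \<nu>] Q_def \<rho>_0 by (rule norm_triangle_ineq)
    also have "\<dots> = \<bar>\<omega>\<bar> * \<bar>of_int \<nu>\<bar> * norm (\<rho> \<epsilon> k \<nu>) + 1 / (\<bar>\<omega>\<bar> * \<bar>of_int \<nu>\<bar>) * norm ?b"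
      by (simp add: norm_mult norm_divide)
    also have "\<dots> \<le> \<bar>\<omega>\<bar> * \<bar>of_int \<nu>\<bar> * norm (\<rho> \<epsilon> k \<nu>) + 1 / (\<bar>\<omega>\<bar> * 1) * norm ?b"
      using \<omega> abs_int_ge_1[OF \<nu>] by (intro add_left_mono mult_right_mono divide_left_mono mult_left_mono) auto
    finally show "norm (\<rho> \<epsilon> (Suc k) \<nu>) \<le> \<bar>\<omega>\<bar> * \<bar>of_int \<nu>\<bar> * norm (\<rho> \<epsilon> k \<nu>) + 1 / \<bar>\<omega>\<bar> * norm ?b" by simp
  qed (use c N lam F level_props[OF N] level_deriv[OF N] level_small[OF N] y_majorant[OF N] \<rho>_weighted_summable[OF adm] in simp_all)
  moreover have "(L / real N) ^ N * wnorm (level N N) (\<rho> \<epsilon> N) \<le> (\<Sum>k\<in>{1..N}. (L / real N) ^ k * wnorm (level N k) (\<rho> \<epsilon> k))"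
    using N lam by (intro member_le_sum) (auto intro: mult_nonneg_nonneg wnorm_nonneg)
  ultimately have "(L / real N) ^ N * wnorm 0 (\<rho> \<epsilon> N) \<le> c" by (simp add: level_props(4)[OF N])
  thus ?thesis using lam N L_pos by (simp add: power_divide field_simps)
qed

end

section \<open>Gevrey bounds, holomorphy and the differential equation\<close>

text \<open>N^N / N! is one term of the exponential series at N.\<close>

lemma power_self_le: "real N ^ N \<le> exp 1 ^ N * fact N"
proof -
  have s: "(\<lambda>n. real N ^ n /\<^sub>R fact n) sums exp (real N)" by (rule exp_converges)
  have "(\<Sum>n\<in>{N}. real N ^ n /\<^sub>R fact n) \<le> (\<Sum>n. real N ^ n /\<^sub>R fact n)"
    by (rule sum_le_suminf[OF sums_summable[OF s]]) auto
  hence "real N ^ N / fact N \<le> exp (real N)" using sums_unique[OF s] by (simp add: divide_inverse mult.commute)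
  moreover have "exp (real N) = exp 1 ^ N" by (simp add: exp_of_nat_mult[symmetric])
  ultimately show ?thesis by (simp add: divide_le_eq)
qed

lemma two_discs_iff:
  assumes "R > 0"
  shows "\<epsilon> \<in> two_discs R \<longleftrightarrow> \<epsilon> \<in> ball (of_real (R/2)) (R/2) \<or> - \<epsilon> \<in> ball (of_real (R/2)) (R/2)"
proof -
  have "Re (1 / (- \<epsilon>)) = - Re (1 / \<epsilon>)" by (metis minus_divide_right uminus_complex.sel(1))
  thus ?thesis unfolding Re_inverse_gt_iff[OF assms, symmetric] two_discs_def by auto
qed

lemma open_two_discs: "open (two_discs R)" if R: "R > 0"
proof -
  have eq: "two_discs R = ball (of_real (R/2)) (R/2) \<union> uminus ` ball (of_real (R/2)) (R/2)"
  proof (rule set_eqI)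
    fix \<epsilon> :: complex
    have "- \<epsilon> \<in> B \<longleftrightarrow> \<epsilon> \<in> uminus ` B" for B by (metis image_iff minus_minus)
    thus "\<epsilon> \<in> two_discs R \<longleftrightarrow> \<epsilon> \<in> ball (of_real (R/2)) (R/2) \<union> uminus ` ball (of_real (R/2)) (R/2)"
      unfolding two_discs_iff[OF R] Un_iff by blast
  qed
  show ?thesis unfolding eq by (intro open_Un open_ball open_negations)
qed

lemma fourier_conv_symmetric:
  assumes "\<And>a. u (- a) = cnj (u a)" "\<And>a. v (- a) = cnj (v a)"
  shows "fourier_conv u v (- \<nu>) = cnj (fourier_conv u v \<nu>)"
proof -
  have "fourier_conv u v (- \<nu>) = (\<Sum>\<^sub>\<infinity>a. u (- a) * v (- \<nu> - (- a)))"
    unfolding fourier_conv_def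
    by (rule infsum_reindex_bij_betw[symmetric]) (rule bij_betwI[where g = uminus], auto)
  also have "\<dots> = (\<Sum>\<^sub>\<infinity>a. cnj (u a * v (\<nu> - a)))"
  proof (rule infsum_cong)
    fix a
    have "- \<nu> - (- a) = - (\<nu> - a)" by simp
    thus "u (- a) * v (- \<nu> - (- a)) = cnj (u a * v (\<nu> - a))" by (simp only: assms complex_cnj_mult)
  qed
  finally show ?thesis by (simp only: fourier_conv_def infsum_cnj)
qed

lemma fourier_series_real:
  assumes "\<And>a. u (- a) = cnj (u a)" shows "fourier_series \<omega> u t \<in> \<real>"
proof -
  have "fourier_series \<omega> u t = (\<Sum>\<^sub>\<infinity>\<nu>. phase \<omega> t (- \<nu>) * u (- \<nu>))"
    unfolding fourier_series_phase
    by (rule infsum_reindex_bij_betw[symmetric]) (rule bij_betwI[where g = uminus], auto)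
  also have "\<dots> = (\<Sum>\<^sub>\<infinity>\<nu>. cnj (phase \<omega> t \<nu> * u \<nu>))"
    by (rule infsum_cong) (simp add: assms phase_def exp_cnj)
  also have "\<dots> = cnj (fourier_series \<omega> u t)" by (simp only: infsum_cnj fourier_series_phase)
  finally have "fourier_series \<omega> u t = cnj (fourier_series \<omega> u t)" .
  thus ?thesis by (metis Reals_cnj_iff)
qed

lemma fourier_series_periodic:
  assumes "\<omega> \<noteq> 0" shows "fourier_series \<omega> u (t + 2 * pi / \<omega>) = fourier_series \<omega> u t"
proof -
  have "phase \<omega> (t + 2 * pi / \<omega>) \<nu> = phase \<omega> t \<nu>" for \<nu>
  proof -
    have "\<i> * of_int \<nu> * of_real \<omega> * of_real (t + 2 * pi / \<omega>) =
       \<i> * of_int \<nu> * of_real \<omega> * of_real t + of_int \<nu> * of_real 2 * of_real pi * \<i>"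
      using assms by (simp add: field_simps)
    moreover have "exp (of_int \<nu> * of_real 2 * of_real pi * \<i>) = (1::complex)"
      using exp_integer_2pi[of "of_int \<nu>"] by (simp add: mult_ac)
    ultimately show ?thesis by (simp only: phase_def exp_add mult_1_right)
  qed
  thus ?thesis by (simp add: fourier_series_phase)
qed

text \<open>Any loss d of width absorbs the factor |\<nu>|, by d|\<nu>| \<le> exp(d|\<nu>|).\<close>

lemma weighted_summable_deriv:
  assumes "weighted_summable \<xi> u" "\<eta> < \<xi>"
  shows "weighted_summable \<eta> (\<lambda>\<nu>. \<i> * of_real \<omega> * of_int \<nu> * u \<nu>)"
proof (rule wnorm_dominated(1)[OF assms(1)])
  fix \<nu> :: int
  define d where "d = \<xi> - \<eta>"
  have d: "d > 0" using assms by (simp add: d_def)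
  have "d * \<bar>of_int \<nu>\<bar> \<le> exp (d * \<bar>of_int \<nu>\<bar>)" using exp_ge_add_one_self[of "d * \<bar>of_int \<nu>\<bar>"] by linarith
  hence "\<bar>of_int \<nu>\<bar> \<le> 1 / d * exp (d * \<bar>of_int \<nu>\<bar>)" using d by (simp add: field_simps)
  hence "\<bar>\<omega>\<bar> * \<bar>of_int \<nu>\<bar> * (norm (u \<nu>) * weight \<eta> \<nu>) \<le> \<bar>\<omega>\<bar> * (1 / d * exp (d * \<bar>of_int \<nu>\<bar>)) * (norm (u \<nu>) * weight \<eta> \<nu>)"
    by (intro mult_right_mono mult_left_mono) auto
  also have "weight \<eta> \<nu> * exp (d * \<bar>of_int \<nu>\<bar>) = weight \<xi> \<nu>"
    by (simp add: weight_def d_def exp_add[symmetric] algebra_simps)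
  hence "\<bar>\<omega>\<bar> * (1 / d * exp (d * \<bar>of_int \<nu>\<bar>)) * (norm (u \<nu>) * weight \<eta> \<nu>) = \<bar>\<omega>\<bar> / d * (norm (u \<nu>) * weight \<xi> \<nu>)"
    by (simp add: field_simps)
  finally show "norm (\<i> * of_real \<omega> * of_int \<nu> * u \<nu>) * weight \<eta> \<nu> \<le> \<bar>\<omega>\<bar> / d * (norm (u \<nu>) * weight \<xi> \<nu>)"
    by (simp add: norm_mult mult_ac)
qed

section \<open>The resummed solution: Gevrey bound, reality, holomorphy, equation\<close>

context forcing begin

lemma fourier_series_x_sums:
  assumes "admissible \<epsilon>" shows "(\<lambda>k. fourier_series \<omega> (x \<epsilon> k) t) sums fourier_series \<omega> (X \<epsilon>) t"
  unfolding X_def[abs_def]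
proof (rule fourier_series_resum[OF _ _ summable_geom])
  show "weighted_summable 0 (x \<epsilon> k)" for k
    by (rule wnorm_mono(1)[OF less_imp_le[OF \<xi>] x_weighted_summable[OF assms]])
  show "wnorm 0 (x \<epsilon> k) \<le> c * (1/2) ^ k" for k
    by (rule order_trans[OF wnorm_mono(2)[OF less_imp_le[OF \<xi>] x_weighted_summable[OF assms]] wnorm_x_le[OF assms]])
qed

text \<open>N = 0 is treated apart because \<open>level\<close> divides by N. It is also the origin
  of the constant 3c/2, the bound for the solution itself; the other cases give c.\<close>

lemma gevrey_remainder:
  assumes adm: "admissible \<epsilon>" and \<epsilon>: "\<epsilon> \<noteq> 0"
  shows "norm (fourier_series \<omega> (X \<epsilon>) t - (\<Sum>k<N. \<epsilon> ^ k * fourier_series \<omega> (y k) t))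
    \<le> 3 * c / 2 * (exp 1 / L) ^ N * fact N * norm \<epsilon> ^ N"
proof (cases "N = 0")
  case True
  have w: "weighted_summable 0 (\<lambda>\<nu>. X \<epsilon> \<nu> - y 0 \<nu>)" "wnorm 0 (\<lambda>\<nu>. X \<epsilon> \<nu> - y 0 \<nu>) \<le> c / 2"
    using wnorm_mono[OF less_imp_le[OF \<xi>] X_minus(1)[OF adm]] X_minus(2)[OF adm] by auto
  have "norm (fourier_series \<omega> (X \<epsilon>) t) \<le> wnorm 0 (\<lambda>\<nu>. (X \<epsilon> \<nu> - y 0 \<nu>) + y 0 \<nu>)"
    using norm_fourier_series_le[OF \<rho>_weighted_summable_0[OF adm, of 0]] by (simp add: \<rho>_0)
  also have "\<dots> \<le> wnorm 0 (\<lambda>\<nu>. X \<epsilon> \<nu> - y 0 \<nu>) + wnorm 0 (y 0)"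
    by (intro wnorm_add w y_weighted_summable)
  also have "\<dots> \<le> c / 2 + c" using w(2) c by (simp add: wnorm_single)
  finally show ?thesis using True by simp
next
  case False
  hence N: "N > 0" by simp
  have "X \<epsilon> \<nu> = \<epsilon> ^ N * \<rho> \<epsilon> N \<nu> + (\<Sum>k<N. \<epsilon> ^ k * y k \<nu>)" for \<nu>
    using \<epsilon> by (simp add: \<rho>_def)
  hence "fourier_series \<omega> (X \<epsilon>) t = fourier_series \<omega> (\<lambda>\<nu>. \<epsilon> ^ N * \<rho> \<epsilon> N \<nu> + (\<Sum>k<N. \<epsilon> ^ k * y k \<nu>)) t" by metis
  also have "\<dots> = fourier_series \<omega> (\<lambda>\<nu>. \<epsilon> ^ N * \<rho> \<epsilon> N \<nu>) t + fourier_series \<omega> (\<lambda>\<nu>. \<Sum>k<N. \<epsilon> ^ k * y k \<nu>) t"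
    by (intro fourier_series_add weighted_summable_sum wnorm_scale \<rho>_weighted_summable_0 adm y_weighted_summable) auto
  also have "fourier_series \<omega> (\<lambda>\<nu>. \<Sum>k<N. \<epsilon> ^ k * y k \<nu>) t = (\<Sum>k<N. fourier_series \<omega> (\<lambda>\<nu>. \<epsilon> ^ k * y k \<nu>) t)"
    by (intro fourier_series_sum wnorm_scale y_weighted_summable) auto
  finally have "norm (fourier_series \<omega> (X \<epsilon>) t - (\<Sum>k<N. \<epsilon> ^ k * fourier_series \<omega> (y k) t)) = norm \<epsilon> ^ N * norm (fourier_series \<omega> (\<rho> \<epsilon> N) t)"
    by (simp add: fourier_series_scale norm_mult norm_power)
  also have "\<dots> \<le> norm \<epsilon> ^ N * (c * (real N / L) ^ N)"
    by (intro mult_left_mono order_trans[OF norm_fourier_series_le[OF \<rho>_weighted_summable_0[OF adm]] wnorm_\<rho>_le[OF adm \<epsilon> N]]) simp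
  also have "\<dots> \<le> norm \<epsilon> ^ N * (3 * c / 2 * ((exp 1 ^ N * fact N) / L ^ N))"
    unfolding power_divide using c L_pos
    by (intro mult_left_mono mult_mono divide_right_mono power_self_le) auto
  also have "\<dots> = 3 * c / 2 * (exp 1 / L) ^ N * fact N * norm \<epsilon> ^ N" by (simp add: power_divide)
  finally show ?thesis .
qed

lemma x_symmetric: "x (of_real \<epsilon>) k (- \<nu>) = cnj (x (of_real \<epsilon>) k \<nu>)"
proof (induction k arbitrary: \<nu> rule: less_induct)
  case (less k)
  show ?case
  proof (cases k)
    case (Suc m)
    have conv: "fourier_conv (x (of_real \<epsilon>) i) (x (of_real \<epsilon>) j) (- \<nu>) = cnj (fourier_conv (x (of_real \<epsilon>) i) (x (of_real \<epsilon>) j) \<nu>)"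
      if "i < k" "j < k" for i j \<nu>
      by (rule fourier_conv_symmetric) (use less that in auto)
    show ?thesis
    proof (cases "\<nu> = 0")
      case True
      have "cnj (x (of_real \<epsilon>) (Suc m) 0) = - (1 / (2 * of_real c)) * (\<Sum>j\<in>{1..m}. cnj (fourier_conv (x (of_real \<epsilon>) (Suc m - j)) (x (of_real \<epsilon>) j) 0))"
        unfolding x_Suc_0 by simp
      also have "\<dots> = x (of_real \<epsilon>) (Suc m) 0"
        unfolding x_Suc_0 using Suc conv[where \<nu> = 0] by (intro arg_cong2[of _ _ _ _ times] sum.cong refl) auto
      finally show ?thesis using True Suc by simp
    next
      case False
      have S: "(\<Sum>j\<le>m. fourier_conv (x (of_real \<epsilon>) j) (x (of_real \<epsilon>) (m - j)) (- \<nu>)) = cnj (\<Sum>j\<le>m. fourier_conv (x (of_real \<epsilon>) j) (x (of_real \<epsilon>) (m - j)) \<nu>)"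
        unfolding cnj_sum using Suc by (intro sum.cong refl conv) auto
      have "- \<nu> \<noteq> 0" using False by simp
      thus ?thesis unfolding Suc x_Suc[OF \<open>- \<nu> \<noteq> 0\<close>] x_Suc[OF False] S by (simp add: F_sym)
    qed
  qed simp
qed

lemma norm_x_le:
  assumes "admissible \<epsilon>" shows "norm (x \<epsilon> k \<nu>) \<le> c * weight (- \<xi>) \<nu>" "norm (x \<epsilon> k \<nu>) \<le> c"
proof -
  have inv: "weight \<xi> \<nu> * weight (- \<xi>) \<nu> = 1" by (simp add: weight_def exp_add[symmetric])
  have "norm (x \<epsilon> k \<nu>) * weight \<xi> \<nu> \<le> c * (1/2) ^ k"
    using norm_le_wnorm[OF x_weighted_summable[OF assms]] wnorm_x_le[OF assms] order_trans by blast
  also have "\<dots> \<le> c * 1" using c by (intro mult_left_mono power_le_one) auto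
  finally have "norm (x \<epsilon> k \<nu>) * weight \<xi> \<nu> * weight (- \<xi>) \<nu> \<le> c * 1 * weight (- \<xi>) \<nu>"
    by (rule mult_right_mono) simp
  thus 1: "norm (x \<epsilon> k \<nu>) \<le> c * weight (- \<xi>) \<nu>" by (simp only: mult.assoc inv mult_1_right)
  have "weight (- \<xi>) \<nu> \<le> 1" using \<xi> by (simp add: weight_def)
  hence "c * weight (- \<xi>) \<nu> \<le> c * 1" using c by (intro mult_left_mono) auto
  thus "norm (x \<epsilon> k \<nu>) \<le> c" using 1 by simp
qed

lemma summable_weight: "(\<lambda>\<nu>. c * weight (- \<xi>) \<nu>) summable_on UNIV"
  unfolding weight_def by (intro summable_on_cmult_right summable_on_exp_abs \<xi>)

lemma adm_R0: "\<epsilon> \<in> two_discs R0 \<Longrightarrow> admissible \<epsilon>"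
  by (rule two_discs_admissible[OF _ R0_pos order_refl])

text \<open>By induction on k. The convolutions are dominated, uniformly in \<epsilon>, by the decay
  of one factor and the boundedness of the other.\<close>

lemma x_holomorphic: "(\<lambda>\<epsilon>. x \<epsilon> k \<nu>) holomorphic_on two_discs R0"
proof (induction k arbitrary: \<nu> rule: less_induct)
  case (less k)
  have conv: "(\<lambda>\<epsilon>. fourier_conv (x \<epsilon> i) (x \<epsilon> j) \<nu>) holomorphic_on two_discs R0" if "i < k" "j < k" for i j \<nu>
    unfolding fourier_conv_def
  proof (rule holomorphic_infsum[OF open_two_discs[OF R0_pos]])
    show "(\<lambda>a. c * weight (- \<xi>) a * c) summable_on UNIV" by (intro summable_on_cmult_left summable_weight)
    show "(\<lambda>\<epsilon>. x \<epsilon> i a * x \<epsilon> j (\<nu> - a)) holomorphic_on two_discs R0" for a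
      using less that by (intro holomorphic_intros) auto
    show "norm (x \<epsilon> i a * x \<epsilon> j (\<nu> - a)) \<le> c * weight (- \<xi>) a * c" if "\<epsilon> \<in> two_discs R0" for a \<epsilon>
      unfolding norm_mult using c by (intro mult_mono norm_x_le adm_R0[OF that]) auto
  qed
  show ?case
  proof (cases k)
    case 0
    thus ?thesis by simp
  next
    case (Suc m)
    show ?thesis
    proof (cases "\<nu> = 0")
      case True
      show ?thesis unfolding Suc True x_Suc_0
        by (intro holomorphic_intros conv) (use Suc in auto)
    next
      case False
      have "\<i> * of_real \<omega> * of_int \<nu> * (1 + \<i> * \<epsilon> * of_real \<omega> * of_int \<nu>) \<noteq> 0" if "\<epsilon> \<in> two_discs R0" for \<epsilon>
        using adm_R0[OF that] \<omega> False unfolding admissible_def by simp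
      thus ?thesis unfolding Suc x_Suc[OF False]
        by (intro holomorphic_intros conv) (use Suc in auto)
    qed
  qed
qed

lemma resummed_holomorphic: "(\<lambda>\<epsilon>. fourier_series \<omega> (X \<epsilon>) t) holomorphic_on two_discs R0"
proof -
  have bound: "norm (fourier_series \<omega> (x \<epsilon> k) t) \<le> c * (1/2) ^ k" if "\<epsilon> \<in> two_discs R0" for \<epsilon> k
  proof -
    note w = wnorm_mono[OF less_imp_le[OF \<xi>] x_weighted_summable[OF adm_R0[OF that]]]
    show ?thesis using norm_fourier_series_le[OF w(1)] w(2) wnorm_x_le[OF adm_R0[OF that]] order_trans by meson
  qed
  have hol: "(\<lambda>\<epsilon>. fourier_series \<omega> (x \<epsilon> k) t) holomorphic_on two_discs R0" for k
    unfolding fourier_series_phase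
  proof (rule holomorphic_infsum[OF open_two_discs[OF R0_pos] _ _ summable_weight])
    show "(\<lambda>\<epsilon>. phase \<omega> t \<nu> * x \<epsilon> k \<nu>) holomorphic_on two_discs R0" for \<nu>
      by (intro holomorphic_intros x_holomorphic)
    show "norm (phase \<omega> t \<nu> * x \<epsilon> k \<nu>) \<le> c * weight (- \<xi>) \<nu>" if "\<epsilon> \<in> two_discs R0" for \<nu> \<epsilon>
      using norm_x_le(1)[OF adm_R0[OF that]] by (simp add: norm_mult)
  qed
  have s: "(\<lambda>k. c * (1/2::real) ^ k) summable_on UNIV"
    using summable_geom c by (intro summable_nonneg_imp_summable_on) auto
  have "(\<lambda>\<epsilon>. \<Sum>\<^sub>\<infinity>k. fourier_series \<omega> (x \<epsilon> k) t) holomorphic_on two_discs R0"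
    by (rule holomorphic_infsum[OF open_two_discs[OF R0_pos] hol bound s])
  moreover have "(\<Sum>\<^sub>\<infinity>k. fourier_series \<omega> (x \<epsilon> k) t) = fourier_series \<omega> (X \<epsilon>) t" if "\<epsilon> \<in> two_discs R0" for \<epsilon>
  proof (rule infsumI, rule norm_summable_imp_has_sum[OF _ fourier_series_x_sums[OF adm_R0[OF that]]])
    show "summable (\<lambda>k. norm (fourier_series \<omega> (x \<epsilon> k) t))"
      by (rule summable_comparison_test'[OF summable_geom, of 0]) (use bound[OF that] in simp)
  qed
  ultimately show ?thesis by (rule holomorphic_transform)
qed

text \<open>Differentiation costs width, hence \<xi>/2 and \<xi>/4 for the two derivatives. The
  equation is checked mode by mode; at \<nu> = 0 it reduces to
  \<open>X_square_zero_mode\<close>.\<close>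

lemma resummed_ode:
  assumes adm: "admissible \<epsilon>"
  obtains z' z'' where "\<And>t. (fourier_series \<omega> (X \<epsilon>) has_vector_derivative z' t) (at t)"
    "\<And>t. (z' has_vector_derivative z'' t) (at t)"
    "\<And>t. \<epsilon> * z'' t + z' t + \<epsilon> * (fourier_series \<omega> (X \<epsilon>) t)\<^sup>2 = \<epsilon> * fourier_series \<omega> F t"
proof -
  define d where "d = (\<lambda>u \<nu>. \<i> * of_real \<omega> * of_int \<nu> * u \<nu> :: complex)"
  note wX = X_weighted_summable[OF adm]
  have w1: "weighted_summable (\<xi>/2) (d (X \<epsilon>))" unfolding d_def by (rule weighted_summable_deriv[OF wX]) (use \<xi> in simp)
  have w2: "weighted_summable (\<xi>/4) (d (d (X \<epsilon>)))" unfolding d_def by (rule weighted_summable_deriv[OF w1[unfolded d_def]]) (use \<xi> in simp)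
  have w0: "weighted_summable 0 (X \<epsilon>)" "weighted_summable 0 (d (X \<epsilon>))" "weighted_summable 0 (d (d (X \<epsilon>)))" "weighted_summable 0 F"
    using wnorm_mono(1)[OF _ wX] wnorm_mono(1)[OF _ w1] wnorm_mono(1)[OF _ w2] wnorm_mono(1)[OF _ F] \<xi> by auto
  have wc: "weighted_summable 0 (fourier_conv (X \<epsilon>) (X \<epsilon>))" by (intro weighted_summable_conv w0) simp
  show thesis
  proof (rule that)
    show "(fourier_series \<omega> (X \<epsilon>) has_vector_derivative fourier_series \<omega> (d (X \<epsilon>)) t) (at t)" for t
      unfolding d_def by (rule fourier_series_has_vector_derivative[OF \<xi> wX \<omega>])
    show "(fourier_series \<omega> (d (X \<epsilon>)) has_vector_derivative fourier_series \<omega> (d (d (X \<epsilon>))) t) (at t)" for t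
      unfolding d_def by (rule fourier_series_has_vector_derivative[OF _ w1[unfolded d_def] \<omega>]) (use \<xi> in simp)
    fix t
    have pt: "(\<epsilon> * d (d (X \<epsilon>)) \<nu> + d (X \<epsilon>) \<nu>) + \<epsilon> * fourier_conv (X \<epsilon>) (X \<epsilon>) \<nu> = \<epsilon> * F \<nu>" for \<nu>
    proof (cases "\<nu> = 0")
      case True
      thus ?thesis by (simp add: d_def X_square_zero_mode[OF adm] F_0)
    next
      case False
      thus ?thesis using X_equation[OF adm False] by (simp add: d_def algebra_simps)
    qed
    have "\<epsilon> * fourier_series \<omega> F t = fourier_series \<omega> (\<lambda>\<nu>. (\<epsilon> * d (d (X \<epsilon>)) \<nu> + d (X \<epsilon>) \<nu>) + \<epsilon> * fourier_conv (X \<epsilon>) (X \<epsilon>) \<nu>) t"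
      unfolding pt fourier_series_scale ..
    also have "\<dots> = (fourier_series \<omega> (\<lambda>\<nu>. \<epsilon> * d (d (X \<epsilon>)) \<nu>) t + fourier_series \<omega> (d (X \<epsilon>)) t) + fourier_series \<omega> (\<lambda>\<nu>. \<epsilon> * fourier_conv (X \<epsilon>) (X \<epsilon>) \<nu>) t"
      by (simp only: fourier_series_add wnorm_add(1) wnorm_scale(1) w0 wc)
    also have "\<dots> = \<epsilon> * fourier_series \<omega> (d (d (X \<epsilon>))) t + fourier_series \<omega> (d (X \<epsilon>)) t + \<epsilon> * (fourier_series \<omega> (X \<epsilon>) t)\<^sup>2"
      by (simp only: fourier_series_scale fourier_series_conv[OF w0(1) w0(1)] power2_eq_square)
    finally show "\<epsilon> * fourier_series \<omega> (d (d (X \<epsilon>))) t + fourier_series \<omega> (d (X \<epsilon>)) t + \<epsilon> * (fourier_series \<omega> (X \<epsilon>) t)\<^sup>2 = \<epsilon> * fourier_series \<omega> F t" by simp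
  qed
qed

end

section \<open>Nevanlinna--Sokal theorem on both discs\<close>

text \<open>The half-strip and its mirror image thus overlap only inside the disc of convergence,
  where the two continuations are given by the same power series.\<close>

lemma half_strip_Int_uminus:
  assumes "z \<in> half_strip \<rho>" "- z \<in> half_strip \<rho>" shows "norm z < \<rho>"
  using assms unfolding mem_half_strip_iff by (cases "Re z \<ge> 0") (auto simp: max_def)

text \<open>Bundled into one predicate so that a function can be chosen for each t. The bound
  carries the explicit constant built from \<open>Kterm\<close>, which depends on neither t nor g;
  this provides a K uniform in t.\<close>

definition is_borel_sum :: "real \<Rightarrow> real \<Rightarrow> real \<Rightarrow> (nat \<Rightarrow> complex) \<Rightarrow> (complex \<Rightarrow> complex) \<Rightarrow> (complex \<Rightarrow> complex) \<Rightarrow> bool" where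
  "is_borel_sum R A \<sigma> a F g \<longleftrightarrow>
     (\<forall>z. norm z < 1 / \<sigma> \<longrightarrow> g z = (\<Sum>k. 1 / fact k * z ^ k * a k)) \<and>
     g holomorphic_on half_strip (1 / \<sigma>) \<and>
     (\<forall>\<rho> z. \<rho> < 1 / \<sigma> \<longrightarrow> z \<in> half_strip \<rho> \<longrightarrow>
        norm (g z) \<le> (\<Sum>m. gevrey_expansion.Kterm R A \<sigma> \<rho> m) * exp (norm z / R)) \<and>
     (\<forall>\<epsilon>\<in>ball (of_real (R/2)) (R/2).
        (\<lambda>s. exp (- (of_real s / \<epsilon>)) * g (of_real s)) absolutely_integrable_on {0..} \<and>
        F \<epsilon> = 1 / \<epsilon> * integral {0..} (\<lambda>s. exp (- (of_real s / \<epsilon>)) * g (of_real s)))"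

lemma (in gevrey_expansion) ex_borel_sum: "\<exists>g. is_borel_sum R A \<sigma> a F g"
  unfolding is_borel_sum_def by (rule nevanlinna_sokal, rule exI, intro conjI allI impI ballI)

text \<open>The left-hand disc is the right-hand one for X(-\<epsilon>), whose expansion has the
  coefficients (-1)^k a_k; the two continuations are glued along the disc of convergence.\<close>

theorem nevanlinna_sokal_two_discs:
  assumes R: "R > 0" and A: "A > 0" and B: "B > 0" and gb: "gevrey_bound R A B a X"
    and hol: "\<And>t. (\<lambda>\<epsilon>. X \<epsilon> t) holomorphic_on two_discs R"
  shows "borel_representation R B a X"
proof -
  let ?D = "ball (complex_of_real (R/2)) (R/2)"
  have sub: "\<epsilon> \<in> two_discs R" "- \<epsilon> \<in> two_discs R" if "\<epsilon> \<in> ?D" for \<epsilon>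
    using that unfolding two_discs_iff[OF R] by auto
  have plus: "gevrey_expansion R A B (\<lambda>k. a k t) (\<lambda>\<epsilon>. X \<epsilon> t)" for t
  proof unfold_locales
    show "(\<lambda>\<epsilon>. X \<epsilon> t) holomorphic_on ?D"
      by (rule holomorphic_on_subset[OF hol]) (use sub in blast)
    show "norm (X \<epsilon> t - (\<Sum>k<N. \<epsilon> ^ k * a k t)) \<le> A * B ^ N * fact N * norm \<epsilon> ^ N" if "\<epsilon> \<in> ?D" for N \<epsilon>
      using gb sub(1)[OF that] unfolding gevrey_bound_def by blast
  qed (use R A B in auto)
  have minus: "gevrey_expansion R A B (\<lambda>k. (-1) ^ k * a k t) (\<lambda>\<epsilon>. X (- \<epsilon>) t)" for t
  proof unfold_locales
    have "uminus holomorphic_on ?D" by (intro holomorphic_intros)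
    moreover have "uminus ` ?D \<subseteq> two_discs R" using sub(2) by blast
    ultimately show "(\<lambda>\<epsilon>. X (- \<epsilon>) t) holomorphic_on ?D"
      by (rule holomorphic_on_compose_gen[OF _ hol, unfolded o_def])
    show "norm (X (- \<epsilon>) t - (\<Sum>k<N. \<epsilon> ^ k * ((-1) ^ k * a k t))) \<le> A * B ^ N * fact N * norm \<epsilon> ^ N" if "\<epsilon> \<in> ?D" for N \<epsilon>
    proof -
      have "norm (X (- \<epsilon>) t - (\<Sum>k<N. (- \<epsilon>) ^ k * a k t)) \<le> A * B ^ N * fact N * norm (- \<epsilon>) ^ N"
        using gb sub(2)[OF that] unfolding gevrey_bound_def by blast
      moreover have "(- \<epsilon>) ^ k = \<epsilon> ^ k * (-1) ^ k" for k by (simp add: power_minus[of \<epsilon>])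
      ultimately show ?thesis by (simp add: mult.assoc)
    qed
  qed (use R A B in auto)
  have "\<forall>t. \<exists>g. is_borel_sum R A B (\<lambda>k. a k t) (\<lambda>\<epsilon>. X \<epsilon> t) g"
    using gevrey_expansion.ex_borel_sum[OF plus] by blast
  from choice[OF this] obtain gp where gp: "\<And>t. is_borel_sum R A B (\<lambda>k. a k t) (\<lambda>\<epsilon>. X \<epsilon> t) (gp t)" by blast
  have "\<forall>t. \<exists>g. is_borel_sum R A B (\<lambda>k. (-1) ^ k * a k t) (\<lambda>\<epsilon>. X (- \<epsilon>) t) g"
    using gevrey_expansion.ex_borel_sum[OF minus] by blast
  from choice[OF this] obtain gm where gm: "\<And>t. is_borel_sum R A B (\<lambda>k. (-1) ^ k * a k t) (\<lambda>\<epsilon>. X (- \<epsilon>) t) (gm t)" by blast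
  define G where "G = (\<lambda>t z. if z \<in> half_strip (1 / B) then gp t z else gm t (- z))"
  have G_plus: "G t z = gp t z" if "z \<in> half_strip (1 / B)" for t z using that by (simp add: G_def)
  have G_minus: "G t z = gm t (- z)" if z: "- z \<in> half_strip (1 / B)" for t z
  proof (cases "z \<in> half_strip (1 / B)")
    case True
    hence n: "norm z < 1 / B" using half_strip_Int_uminus z by blast
    hence "gp t z = (\<Sum>k. 1 / fact k * z ^ k * a k t)" using gp[of t] unfolding is_borel_sum_def by blast
    moreover have "gm t (- z) = (\<Sum>k. 1 / fact k * (- z) ^ k * ((-1) ^ k * a k t))"
      using gm[of t] n unfolding is_borel_sum_def by (metis norm_minus_cancel)
    moreover have "1 / fact k * (- z) ^ k * ((-1) ^ k * a k t) = 1 / fact k * z ^ k * a k t" for k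
    proof -
      have "(- z) ^ k * (-1) ^ k = z ^ k" unfolding power_mult_distrib[symmetric] by simp
      moreover have "1 / fact k * (- z) ^ k * ((-1) ^ k * a k t) = 1 / fact k * ((- z) ^ k * (-1) ^ k) * a k t"
        by (simp only: mult.assoc)
      ultimately show ?thesis by simp
    qed
    ultimately show ?thesis using True by (simp only: G_def if_True)
  qed (simp add: G_def)
  have half_mono: "half_strip \<rho> \<subseteq> half_strip \<rho>'" if "\<rho> \<le> \<rho>'" for \<rho> \<rho>' using that by (auto simp: half_strip_def)
  have um: "z \<in> uminus ` half_strip \<rho> \<longleftrightarrow> - z \<in> half_strip \<rho>" for z \<rho> by (metis image_iff minus_minus)
  have nonneg: "of_real s \<in> half_strip (1 / B)" if "s \<ge> 0" for s
    using that B by (simp add: mem_half_strip_iff)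
  show ?thesis unfolding borel_representation_def
  proof (intro conjI exI[of _ G] allI impI)
    show "summable (\<lambda>k. 1 / fact k * \<epsilon> ^ k * a k t)" if "norm \<epsilon> < 1 / B" for t \<epsilon>
      by (rule gevrey_expansion.summable_borel[OF plus that])
    show "G t \<epsilon> = (\<Sum>k. 1 / fact k * \<epsilon> ^ k * a k t)" if "norm \<epsilon> < 1 / B" for t \<epsilon>
    proof -
      have "\<epsilon> \<in> half_strip (1 / B)" by (rule subsetD[OF ball_subset_half_strip]) (use that in simp)
      thus ?thesis using G_plus gp[of t] that unfolding is_borel_sum_def by simp
    qed
    show "G t holomorphic_on half_strip (1 / B) \<union> uminus ` half_strip (1 / B)" for t
    proof (rule holomorphic_on_Un)
      have "gp t holomorphic_on half_strip (1 / B)" using gp[of t] unfolding is_borel_sum_def by blast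
      thus "G t holomorphic_on half_strip (1 / B)" by (rule holomorphic_transform) (simp add: G_plus)
      have h: "gm t holomorphic_on half_strip (1 / B)" using gm[of t] unfolding is_borel_sum_def by blast
      have "uminus holomorphic_on uminus ` half_strip (1 / B)" by (intro holomorphic_intros)
      moreover have "uminus ` uminus ` half_strip (1 / B) \<subseteq> half_strip (1 / B)" by (auto simp: image_image)
      ultimately have "(\<lambda>z. gm t (- z)) holomorphic_on uminus ` half_strip (1 / B)"
        by (rule holomorphic_on_compose_gen[OF _ h, unfolded o_def])
      thus "G t holomorphic_on uminus ` half_strip (1 / B)"
        by (rule holomorphic_transform) (simp add: um G_minus)
    qed (auto intro: open_half_strip open_negations)
    show "\<exists>K. \<forall>t. \<forall>\<epsilon>\<in>half_strip B' \<union> uminus ` half_strip B'. norm (G t \<epsilon>) \<le> K * exp (norm \<epsilon> / R)" if B': "B' < 1 / B" for B'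
    proof (intro exI[of _ "\<Sum>m. gevrey_expansion.Kterm R A B B' m"] allI ballI)
      fix t \<epsilon> assume "\<epsilon> \<in> half_strip B' \<union> uminus ` half_strip B'"
      thus "norm (G t \<epsilon>) \<le> (\<Sum>m. gevrey_expansion.Kterm R A B B' m) * exp (norm \<epsilon> / R)"
      proof
        assume e: "\<epsilon> \<in> half_strip B'"
        hence "G t \<epsilon> = gp t \<epsilon>" using half_mono[OF less_imp_le[OF B']] G_plus by blast
        thus ?thesis using gp[of t] B' e unfolding is_borel_sum_def by simp
      next
        assume "\<epsilon> \<in> uminus ` half_strip B'"
        hence e: "- \<epsilon> \<in> half_strip B'" by (simp add: um)
        hence "G t \<epsilon> = gm t (- \<epsilon>)" using half_mono[OF less_imp_le[OF B']] G_minus by blast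
        moreover have "norm (gm t (- \<epsilon>)) \<le> (\<Sum>m. gevrey_expansion.Kterm R A B B' m) * exp (norm (- \<epsilon>) / R)"
          using gm[of t] B' e unfolding is_borel_sum_def by blast
        ultimately show ?thesis by simp
      qed
    qed
    show "\<forall>\<epsilon>\<in>two_discs R. 0 < Re \<epsilon> \<longrightarrow>
           (\<lambda>s. exp (- (of_real s / \<epsilon>)) * G t (of_real s)) absolutely_integrable_on {0..} \<and>
           X \<epsilon> t = 1 / \<epsilon> * integral {0..} (\<lambda>s. exp (- (of_real s / \<epsilon>)) * G t (of_real s))" for t
    proof (intro ballI impI)
      fix \<epsilon> assume e: "\<epsilon> \<in> two_discs R" "0 < Re \<epsilon>"
      have "- \<epsilon> \<notin> ?D" unfolding mem_tangent_ball_iff[OF R] using e(2) R by (auto simp: not_less intro: order_trans[of _ 0])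
      hence "\<epsilon> \<in> ?D" using e(1) two_discs_iff[OF R] by blast
      hence L: "(\<lambda>s. exp (- (of_real s / \<epsilon>)) * gp t (of_real s)) absolutely_integrable_on {0..}"
        "X \<epsilon> t = 1 / \<epsilon> * integral {0..} (\<lambda>s. exp (- (of_real s / \<epsilon>)) * gp t (of_real s))"
        using gp[of t] unfolding is_borel_sum_def by blast+
      have eq: "exp (- (of_real s / \<epsilon>)) * G t (of_real s) = exp (- (of_real s / \<epsilon>)) * gp t (of_real s)" if "s \<in> {0..}" for s
        using that by (simp add: G_plus nonneg)
      show "(\<lambda>s. exp (- (of_real s / \<epsilon>)) * G t (of_real s)) absolutely_integrable_on {0..} \<and>
           X \<epsilon> t = 1 / \<epsilon> * integral {0..} (\<lambda>s. exp (- (of_real s / \<epsilon>)) * G t (of_real s))"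
      proof -
        have "((\<lambda>s. exp (- (of_real s / \<epsilon>)) * G t (of_real s)) absolutely_integrable_on {0..}) = ((\<lambda>s. exp (- (of_real s / \<epsilon>)) * gp t (of_real s)) absolutely_integrable_on {0..})"
          by (rule set_integrable_cong[OF refl refl]) (rule eq)
        moreover have "integral {0..} (\<lambda>s. exp (- (of_real s / \<epsilon>)) * G t (of_real s)) = integral {0..} (\<lambda>s. exp (- (of_real s / \<epsilon>)) * gp t (of_real s))"
          by (rule integral_cong) (rule eq)
        ultimately show ?thesis using L by simp
      qed
    qed
    show "\<forall>\<epsilon>\<in>two_discs R. Re \<epsilon> < 0 \<longrightarrow>
           (\<lambda>s. exp (of_real s / \<epsilon>) * G t (- of_real s)) absolutely_integrable_on {0..} \<and>
           X \<epsilon> t = - (1 / \<epsilon>) * integral {0..} (\<lambda>s. exp (of_real s / \<epsilon>) * G t (- of_real s))" for t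
    proof (intro ballI impI)
      fix \<epsilon> assume e: "\<epsilon> \<in> two_discs R" "Re \<epsilon> < 0"
      have "\<epsilon> \<notin> ?D" unfolding mem_tangent_ball_iff[OF R] using mult_pos_neg[OF R e(2)] zero_le_power2[of "norm \<epsilon>"] by linarith
      hence "- \<epsilon> \<in> ?D" using e(1) two_discs_iff[OF R] by blast
      hence L: "(\<lambda>s. exp (- (of_real s / (- \<epsilon>))) * gm t (of_real s)) absolutely_integrable_on {0..}"
        "X (- (- \<epsilon>)) t = 1 / (- \<epsilon>) * integral {0..} (\<lambda>s. exp (- (of_real s / (- \<epsilon>))) * gm t (of_real s))"
        using gm[of t] unfolding is_borel_sum_def by blast+
      have eq: "exp (of_real s / \<epsilon>) * G t (- of_real s) = exp (- (of_real s / (- \<epsilon>))) * gm t (of_real s)" if "s \<in> {0..}" for s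
        using that G_minus[of "- of_real s" t] by (simp add: nonneg)
      show "(\<lambda>s. exp (of_real s / \<epsilon>) * G t (- of_real s)) absolutely_integrable_on {0..} \<and>
           X \<epsilon> t = - (1 / \<epsilon>) * integral {0..} (\<lambda>s. exp (of_real s / \<epsilon>) * G t (- of_real s))"
      proof -
        have "((\<lambda>s. exp (of_real s / \<epsilon>) * G t (- of_real s)) absolutely_integrable_on {0..}) = ((\<lambda>s. exp (- (of_real s / (- \<epsilon>))) * gm t (of_real s)) absolutely_integrable_on {0..})"
          by (rule set_integrable_cong[OF refl refl]) (rule eq)
        moreover have "integral {0..} (\<lambda>s. exp (of_real s / \<epsilon>) * G t (- of_real s)) = integral {0..} (\<lambda>s. exp (- (of_real s / (- \<epsilon>))) * gm t (of_real s))"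
          by (rule integral_cong) (rule eq)
        ultimately show ?thesis using L by simp
      qed
    qed
  qed
qed

lemma fourier_coeff_uminus: "fourier_coeff f (- \<nu>) = cnj (fourier_coeff f \<nu>)"
  by (simp add: fourier_coeff_def Henstock_Kurzweil_Integration.integral_cnj exp_cnj)

section \<open>Uniqueness of the expandable solution\<close>

text \<open>The energy \<open>d'\<^sup>2 / 2 + c d\<^sup>2\<close>, corrected by the cross term \<open>(c / a) d d'\<close>, decays exponentially
  along solutions; being bounded on the whole line it vanishes.\<close>
lemma bounded_damped_solution_zero:
  fixes d d1 d2 p :: "real \<Rightarrow> real"
  assumes D: "\<And>t. (d has_real_derivative d1 t) (at t)" "\<And>t. (d1 has_real_derivative d2 t) (at t)"
    and ode: "\<And>t. d2 t + a * d1 t + p t * d t = 0"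
    and a: "a > 0" "a\<^sup>2 \<ge> 4 * c" and c: "c > 0" and p: "\<And>t. \<bar>p t - 2 * c\<bar> \<le> c / 10"
    and bound: "\<And>t. \<bar>d t\<bar> \<le> M" "\<And>t. \<bar>d1 t\<bar> \<le> M"
  shows "d t = 0"
proof -
  \<comment> \<open>The weight of the cross term. From a^2 \<ge> 4c follow k \<le> a/4 and k^2 \<le>
    c/4, so that the cross term stays below half of the energy.\<close>
  define k where "k = c / a"
  have k: "k > 0" "k * a = c" using a c by (auto simp: k_def)
  have ka: "k \<le> a / 4" using a c by (simp add: k_def field_simps power2_eq_square)
  have kk: "k\<^sup>2 \<le> c / 4"
  proof -
    have "k * k \<le> k * (a / 4)" using k ka by (intro mult_left_mono) auto
    thus ?thesis using k by (simp add: power2_eq_square)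
  qed
  define V where "V = (\<lambda>t. (d1 t)\<^sup>2 / 2 + c * (d t)\<^sup>2 + k * (d t * d1 t))"
  define V' where "V' = (\<lambda>t. d1 t * d2 t + 2 * c * (d t * d1 t) + k * ((d1 t)\<^sup>2 + d t * d2 t))"
  have DV: "(V has_real_derivative V' t) (at t)" for t
    unfolding V_def V'_def by (auto intro!: derivative_eq_intros D simp: power2_eq_square algebra_simps)
  have cross: "\<bar>k * (u * v)\<bar> \<le> c * u\<^sup>2 / 4 + v\<^sup>2 / 4" for u v
  proof -
    have "0 \<le> (2 * k * u - v)\<^sup>2" "0 \<le> (2 * k * u + v)\<^sup>2" by simp_all
    hence "\<bar>4 * k * (u * v)\<bar> \<le> 4 * k\<^sup>2 * u\<^sup>2 + v\<^sup>2"
      by (auto simp: power2_eq_square abs_if algebra_simps)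
    also have "4 * k\<^sup>2 * u\<^sup>2 \<le> c * u\<^sup>2" using mult_right_mono[OF kk, of "u\<^sup>2"] by simp
    finally show ?thesis by (simp add: abs_mult)
  qed
  have V_lower: "c * (d t)\<^sup>2 / 2 \<le> V t" for t
  proof -
    have "0 \<le> c * (d t)\<^sup>2" "0 \<le> (d1 t)\<^sup>2" using c by auto
    thus ?thesis using cross[of "d t" "d1 t"] unfolding V_def by linarith
  qed
  have V_upper: "V t \<le> 3/4 * (d1 t)\<^sup>2 + 5/4 * (c * (d t)\<^sup>2)" for t
    using cross[of "d t" "d1 t"] unfolding V_def by linarith
  \<comment> \<open>The deviation of p from 2c gives the factors 19/10 and 11/10; completing the
    square with the latter costs 605/1000 = (11/10)^2 / 2. What is left is -1295/1000 on k c d^2,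
    where -5/4 is needed, and -(3/4 - 1/2) = -1/4 on a d'^2, where -3/16 is needed.\<close>
  have V'_le: "V' t \<le> - k * V t" for t
  proof -
    have d2: "d2 t = - a * d1 t - p t * d t" using ode[of t] by simp
    define q where "q = p t - 2 * c"
    have q: "\<bar>q\<bar> \<le> c / 10" using p by (simp add: q_def)
    have eq: "V' t = - (a - k) * (d1 t)\<^sup>2 - (q + k * a) * (d t * d1 t) - k * (2 * c + q) * (d t)\<^sup>2"
      unfolding V'_def d2 by (simp add: q_def power2_eq_square algebra_simps)
    have t1: "- (a - k) * (d1 t)\<^sup>2 \<le> - (3/4 * a) * (d1 t)\<^sup>2" using ka by (intro mult_right_mono) auto
    have t3: "- k * (2 * c + q) * (d t)\<^sup>2 \<le> - (19/10) * (k * c * (d t)\<^sup>2)"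
    proof -
      have "k * (19/10 * c) * (d t)\<^sup>2 \<le> k * (2 * c + q) * (d t)\<^sup>2"
        using q k by (intro mult_right_mono mult_left_mono) auto
      thus ?thesis by (simp add: mult_ac)
    qed
    have t2: "- (q + k * a) * (d t * d1 t) \<le> a / 2 * (d1 t)\<^sup>2 + 605/1000 * (k * c * (d t)\<^sup>2)"
    proof -
      have "- (q + k * a) * (d t * d1 t) \<le> \<bar>q + k * a\<bar> * \<bar>d t * d1 t\<bar>"
        by (metis abs_ge_self abs_minus_cancel abs_mult)
      also have "\<dots> \<le> (11/10 * c) * \<bar>d t * d1 t\<bar>"
        using q k c by (intro mult_right_mono) auto
      also have "\<dots> \<le> a / 2 * (d1 t)\<^sup>2 + 605/1000 * (k * c * (d t)\<^sup>2)"
      proof -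
        have gen: "22/10 * (u * v) \<le> u\<^sup>2 + 121/100 * v\<^sup>2" for u v :: real
        proof -
          have "(u - 11/10 * v)\<^sup>2 = u\<^sup>2 - 22/10 * (u * v) + 121/100 * v\<^sup>2"
            by (simp add: power2_eq_square algebra_simps)
          thus ?thesis using zero_le_power2[of "u - 11/10 * v"] by linarith
        qed
        have "22/10 * (a * c * (\<bar>d t\<bar> * \<bar>d1 t\<bar>)) \<le> a\<^sup>2 * \<bar>d1 t\<bar>\<^sup>2 + 121/100 * (c\<^sup>2 * \<bar>d t\<bar>\<^sup>2)"
          using gen[of "a * \<bar>d1 t\<bar>" "c * \<bar>d t\<bar>"] unfolding power_mult_distrib by (simp only: mult_ac)
        moreover have "a * (605/1000 * (k * c * (d t)\<^sup>2)) = 605/1000 * (c\<^sup>2 * (d t)\<^sup>2)"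
        proof -
          have "a * (605/1000 * (k * c * (d t)\<^sup>2)) = 605/1000 * ((k * a) * c * (d t)\<^sup>2)" by simp
          thus ?thesis unfolding k(2) by (simp add: power2_eq_square)
        qed
        moreover have "a * (a / 2 * (d1 t)\<^sup>2) = a\<^sup>2 * (d1 t)\<^sup>2 / 2" by (simp add: power2_eq_square)
        moreover have "a * (11/10 * c * (\<bar>d t\<bar> * \<bar>d1 t\<bar>)) = 11/10 * (a * c * (\<bar>d t\<bar> * \<bar>d1 t\<bar>))" by simp
        ultimately have "a * (11/10 * c * (\<bar>d t\<bar> * \<bar>d1 t\<bar>)) \<le> a * (a / 2 * (d1 t)\<^sup>2 + 605/1000 * (k * c * (d t)\<^sup>2))"
          unfolding distrib_left power2_abs by linarith
        thus ?thesis using a by (simp add: abs_mult)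
      qed
      finally show ?thesis .
    qed
    have t4: "k * (3/4 * (d1 t)\<^sup>2) \<le> a / 4 * (3/4 * (d1 t)\<^sup>2)" using ka by (intro mult_right_mono) auto
    have "k * V t \<le> k * (3/4 * (d1 t)\<^sup>2 + 5/4 * (c * (d t)\<^sup>2))" using k by (intro mult_left_mono V_upper) auto
    hence "k * V t \<le> 3/16 * (a * (d1 t)\<^sup>2) + 5/4 * (k * c * (d t)\<^sup>2)" using t4 by (simp add: algebra_simps)
    moreover have "V' t \<le> - (1/4) * (a * (d1 t)\<^sup>2) - 1295/1000 * (k * c * (d t)\<^sup>2)"
      unfolding eq using t1 t2 t3 by (simp add: algebra_simps)
    moreover have "a * (d1 t)\<^sup>2 \<ge> 0" "k * c * (d t)\<^sup>2 \<ge> 0" using a k c by auto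
    ultimately show ?thesis by linarith
  qed
  have dec: "exp (k * t) * V t \<le> exp (k * s) * V s" if "s \<le> t" for s t
  proof (rule DERIV_nonpos_imp_nonincreasing[OF that])
    fix r
    have "((\<lambda>t. exp (k * t) * V t) has_real_derivative exp (k * r) * (k * V r + V' r)) (at r)"
      by (auto intro!: derivative_eq_intros DV simp: algebra_simps)
    moreover have "exp (k * r) * (k * V r + V' r) \<le> 0" using V'_le[of r] by (simp add: mult_le_0_iff)
    ultimately show "\<exists>y. ((\<lambda>t. exp (k * t) * V t) has_real_derivative y) (at r) \<and> y \<le> 0" by blast
  qed
  define W where "W = 3/4 * M\<^sup>2 + 5/4 * (c * M\<^sup>2)"
  have VW: "V s \<le> W" for s
  proof -
    have "(d s)\<^sup>2 \<le> M\<^sup>2" "(d1 s)\<^sup>2 \<le> M\<^sup>2" using bound[of s] by (auto simp: abs_le_square_iff[symmetric])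
    thus ?thesis using V_upper[of s] c mult_left_mono[of "(d s)\<^sup>2" "M\<^sup>2" c] unfolding W_def by linarith
  qed
  \<comment> \<open>The nonincreasing function exp(k s) V s is at most exp(k s) W, which tends to 0
    as s goes to minus infinity.\<close>
  have "exp (k * t) * V t \<le> 0"
  proof (rule tendsto_lowerbound)
    have "((\<lambda>s. exp (k * s)) \<longlongrightarrow> 0) at_bot"
      using k by (intro filterlim_compose[OF exp_at_bot] filterlim_tendsto_pos_mult_at_bot[OF tendsto_const] filterlim_ident) auto
    from tendsto_mult_right[OF this, of W] show "((\<lambda>s. exp (k * s) * W) \<longlongrightarrow> 0) at_bot" by simp
    show "\<forall>\<^sub>F s in at_bot. exp (k * t) * V t \<le> exp (k * s) * W"
      using eventually_le_at_bot[of t]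
    proof eventually_elim
      case (elim s)
      have "exp (k * t) * V t \<le> exp (k * s) * V s" by (rule dec[OF elim])
      also have "\<dots> \<le> exp (k * s) * W" by (intro mult_left_mono VW) auto
      finally show ?case .
    qed
  qed simp
  hence "V t \<le> 0" by (simp add: mult_le_0_iff)
  hence "c * (d t)\<^sup>2 / 2 \<le> 0" using V_lower[of t] by linarith
  thus "d t = 0" using c by (simp add: mult_le_0_iff)
qed

text \<open>The derivative inherits the period, and a continuous function is bounded on one period.
  This supplies the velocity bound for the energy argument.\<close>

lemma periodic_derivative_bounded:
  fixes y y' :: "real \<Rightarrow> real"
  assumes D: "\<And>t. (y has_real_derivative y' t) (at t)" and cont: "\<And>t. isCont y' t"
    and P: "P > 0" "\<And>t. y (t + P) = y t"
  shows "\<exists>M. \<forall>t. \<bar>y' t\<bar> \<le> M"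
proof -
  have per: "y' (t + P) = y' t" for t
  proof -
    have "((\<lambda>s. y (s + P)) has_real_derivative y' (t + P) * 1) (at t)"
      by (rule DERIV_chain2[where g = "\<lambda>s. s + P", OF D]) (auto intro!: derivative_eq_intros)
    hence "(y has_real_derivative y' (t + P)) (at t)" using P(2) by simp
    thus ?thesis using D DERIV_unique by blast
  qed
  have "continuous_on {0..P} y'" using cont continuous_at_imp_continuous_on by blast
  then obtain M where M: "\<And>t. t \<in> {0..P} \<Longrightarrow> \<bar>y' t\<bar> \<le> M"
    using compact_imp_bounded[OF compact_continuous_image[OF _ compact_Icc]] by (fastforce simp: bounded_iff)
  have "\<bar>y' t\<bar> \<le> M" for t
  proof -
    define n where "n = \<lfloor>t / P\<rfloor>"
    have "of_int n \<le> t / P" "t / P < of_int n + 1" by (auto simp: n_def)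
    hence "t + of_int (- n) * P \<in> {0..P}" using P(1) by (auto simp: field_simps)
    moreover have "y' (t + of_int (- n) * P) = y' t" by (rule periodic_int_shift[of y' P, OF per])
    ultimately show ?thesis using M by metis
  qed
  thus ?thesis by blast
qed

text \<open>Negative damping, which corresponds to negative \<epsilon>, is reduced to positive
  damping by reversing time.\<close>

lemma bounded_damped_solution_zero':
  fixes d d1 d2 p :: "real \<Rightarrow> real"
  assumes D: "\<And>t. (d has_real_derivative d1 t) (at t)" "\<And>t. (d1 has_real_derivative d2 t) (at t)"
    and ode: "\<And>t. d2 t + a * d1 t + p t * d t = 0"
    and a: "a \<noteq> 0" "a\<^sup>2 \<ge> 4 * c" and c: "c > 0" and p: "\<And>t. \<bar>p t - 2 * c\<bar> \<le> c / 10"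
    and bound: "\<And>t. \<bar>d t\<bar> \<le> M" "\<And>t. \<bar>d1 t\<bar> \<le> M"
  shows "d t = 0"
proof (cases "a > 0")
  case True
  show ?thesis by (rule bounded_damped_solution_zero[OF D ode True a(2) c p bound])
next
  case False
  have D1: "((\<lambda>t. d (- t)) has_real_derivative - d1 (- t)) (at t)" for t
    using D(1)[of "- t"] DERIV_mirror by blast
  have D2: "((\<lambda>t. - d1 (- t)) has_real_derivative d2 (- t)) (at t)" for t
    using DERIV_minus[OF DERIV_mirror[THEN iffD1, OF D(2)[of "- t"]]] by simp
  have "d (- (- t)) = 0"
  proof (rule bounded_damped_solution_zero[of "\<lambda>t. d (- t)" "\<lambda>t. - d1 (- t)" "\<lambda>t. d2 (- t)" "- a" "\<lambda>t. p (- t)" c M])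
    show "d2 (- t) + - a * - d1 (- t) + p (- t) * d (- t) = 0" for t using ode[of "- t"] by simp
  qed (use D1 D2 False a c p bound in auto)
  thus ?thesis by simp
qed

lemma has_vector_derivative_Re:
  assumes "(z has_vector_derivative z') (at t)" shows "((\<lambda>t. Re (z t)) has_real_derivative Re z') (at t)"
  using bounded_linear.has_vector_derivative[OF bounded_linear_Re assms]
  by (simp add: has_real_derivative_iff_has_vector_derivative)

text \<open>The expansion with N = 1 puts both solutions within O(\<epsilon>) of c, uniformly in t.
  Since y^2 - x^2 = (y + x)(y - x), their difference obeys an oscillator equation with damping
  1/\<epsilon> and stiffness x + y close to 2c.\<close>

lemma expandable_solutions_agree:
  assumes c: "sqrt \<alpha> > 0"
    and x: "expandable_periodic_solution \<alpha> \<omega> f x" and y: "expandable_periodic_solution \<alpha> \<omega> f y"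
  shows "\<exists>\<epsilon>0>0. \<forall>\<epsilon>. \<epsilon> \<noteq> 0 \<and> \<bar>\<epsilon>\<bar> < \<epsilon>0 \<longrightarrow> y \<epsilon> = x \<epsilon>"
proof -
  define c where "c = sqrt \<alpha>"
  have c0: "c > 0" using assms by (simp add: c_def)
  have term_0: "formal_term \<alpha> \<omega> f 0 t = of_real c" for t
  proof -
    have "((\<lambda>\<nu>. phase \<omega> t \<nu> * (if \<nu> = 0 then of_real c else 0)) has_sum of_real c) UNIV"
      by (rule has_sum_finite_neutralI[of "{0}"]) auto
    from infsumI[OF this] show ?thesis
      unfolding formal_term_def fourier_series_phase formal_coeff.simps(1) c_def .
  qed
  have near: "\<exists>C \<epsilon>0. \<epsilon>0 > 0 \<and> (\<forall>\<epsilon>. \<epsilon> \<noteq> 0 \<and> \<bar>\<epsilon>\<bar> < \<epsilon>0 \<longrightarrow>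
      (\<forall>t. \<bar>u \<epsilon> t - c\<bar> \<le> C * \<bar>\<epsilon>\<bar>) \<and> solves_ode \<omega> f \<epsilon> (u \<epsilon>) \<and> (\<exists>P>0. \<forall>t. u \<epsilon> (t + P) = u \<epsilon> t))"
    if u: "expandable_periodic_solution \<alpha> \<omega> f u" for u
  proof -
    from u obtain \<epsilon>1 where e1: "\<epsilon>1 > 0" "\<And>\<epsilon>. \<epsilon> \<noteq> 0 \<and> \<bar>\<epsilon>\<bar> < \<epsilon>1 \<Longrightarrow> solves_ode \<omega> f \<epsilon> (u \<epsilon>) \<and> (\<exists>P>0. \<forall>t. u \<epsilon> (t + P) = u \<epsilon> t)"
      unfolding expandable_periodic_solution_def by blast
    from u obtain C \<epsilon>2 where e2: "\<epsilon>2 > 0" "\<And>\<epsilon> t. \<epsilon> \<noteq> 0 \<and> \<bar>\<epsilon>\<bar> < \<epsilon>2 \<Longrightarrow>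
        cmod (of_real (u \<epsilon> t) - (\<Sum>k<1. of_real \<epsilon> ^ k * formal_term \<alpha> \<omega> f k t)) \<le> C * \<bar>\<epsilon>\<bar> ^ 1"
      unfolding expandable_periodic_solution_def by metis
    have "\<bar>u \<epsilon> t - c\<bar> \<le> C * \<bar>\<epsilon>\<bar>" if "\<epsilon> \<noteq> 0 \<and> \<bar>\<epsilon>\<bar> < \<epsilon>2" for \<epsilon> t
      using e2(2)[OF that, of t] by (simp add: term_0 flip: of_real_diff)
    thus ?thesis using e1 e2(1) by (intro exI[of _ C] exI[of _ "min \<epsilon>1 \<epsilon>2"]) auto
  qed
  obtain Cx ex where X: "ex > 0" "\<And>\<epsilon>. \<epsilon> \<noteq> 0 \<and> \<bar>\<epsilon>\<bar> < ex \<Longrightarrow>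
      (\<forall>t. \<bar>x \<epsilon> t - c\<bar> \<le> Cx * \<bar>\<epsilon>\<bar>) \<and> solves_ode \<omega> f \<epsilon> (x \<epsilon>) \<and> (\<exists>P>0. \<forall>t. x \<epsilon> (t + P) = x \<epsilon> t)"
    using near[OF x] by blast
  obtain Cy ey where Y: "ey > 0" "\<And>\<epsilon>. \<epsilon> \<noteq> 0 \<and> \<bar>\<epsilon>\<bar> < ey \<Longrightarrow>
      (\<forall>t. \<bar>y \<epsilon> t - c\<bar> \<le> Cy * \<bar>\<epsilon>\<bar>) \<and> solves_ode \<omega> f \<epsilon> (y \<epsilon>) \<and> (\<exists>P>0. \<forall>t. y \<epsilon> (t + P) = y \<epsilon> t)"
    using near[OF y] by blast
  define C where "C = \<bar>Cx\<bar> + \<bar>Cy\<bar> + 1"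
  have C: "C > 0" by (simp add: C_def)
  \<comment> \<open>The entry c/(10 C) keeps x + y within c/10 of 2c; the entry 1/(2 sqrt c) ensures
    (1/\<epsilon>)^2 \<ge> 4c.\<close>
  define e where "e = min (min ex ey) (min (c / (10 * C)) (1 / (2 * sqrt c)))"
  have e0: "e > 0" using X(1) Y(1) c0 C by (simp add: e_def)
  have "y \<epsilon> = x \<epsilon>" if \<epsilon>: "\<epsilon> \<noteq> 0 \<and> \<bar>\<epsilon>\<bar> < e" for \<epsilon>
  proof -
    have small: "C * \<bar>\<epsilon>\<bar> \<le> c / 10" using \<epsilon> C by (simp add: e_def field_simps)
    have a2: "(1 / \<epsilon>)\<^sup>2 \<ge> 4 * c"
    proof -
      have "2 * sqrt c * \<bar>\<epsilon>\<bar> \<le> 1" using \<epsilon> c0 by (simp add: e_def field_simps)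
      hence "(2 * sqrt c * \<bar>\<epsilon>\<bar>)\<^sup>2 \<le> 1" using c0 by (intro power_le_one) auto
      hence "4 * c * \<epsilon>\<^sup>2 \<le> 1" using c0 by (simp add: power_mult_distrib)
      thus ?thesis using \<epsilon> by (simp add: power_divide field_simps)
    qed
    have "\<epsilon> \<noteq> 0 \<and> \<bar>\<epsilon>\<bar> < ex" "\<epsilon> \<noteq> 0 \<and> \<bar>\<epsilon>\<bar> < ey" using \<epsilon> by (auto simp: e_def)
    note X' = X(2)[OF this(1)] and Y' = Y(2)[OF this(2)]
    have bx: "\<bar>x \<epsilon> t - c\<bar> \<le> \<bar>Cx\<bar> * \<bar>\<epsilon>\<bar>" and bdy: "\<bar>y \<epsilon> t - c\<bar> \<le> \<bar>Cy\<bar> * \<bar>\<epsilon>\<bar>" for t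
      using X' Y' by (meson abs_ge_self abs_ge_zero mult_right_mono order_trans)+
    have CC: "\<bar>Cx\<bar> * \<bar>\<epsilon>\<bar> + \<bar>Cy\<bar> * \<bar>\<epsilon>\<bar> \<le> c / 10"
      using small by (simp add: C_def algebra_simps)
    obtain x1 x2 where x: "\<And>t. (x \<epsilon> has_real_derivative x1 t) (at t)" "\<And>t. (x1 has_real_derivative x2 t) (at t)"
      "\<And>t. \<epsilon> * x2 t + x1 t + \<epsilon> * (x \<epsilon> t)\<^sup>2 = \<epsilon> * f (\<omega> * t)" using X' unfolding solves_ode_def by blast
    obtain y1 y2 where y: "\<And>t. (y \<epsilon> has_real_derivative y1 t) (at t)" "\<And>t. (y1 has_real_derivative y2 t) (at t)"
      "\<And>t. \<epsilon> * y2 t + y1 t + \<epsilon> * (y \<epsilon> t)\<^sup>2 = \<epsilon> * f (\<omega> * t)" using Y' unfolding solves_ode_def by blast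
    obtain Mx where Mx: "\<And>t. \<bar>x1 t\<bar> \<le> Mx"
      using periodic_derivative_bounded[OF x(1) DERIV_isCont[OF x(2)]] X' by metis
    obtain My where My: "\<And>t. \<bar>y1 t\<bar> \<le> My"
      using periodic_derivative_bounded[OF y(1) DERIV_isCont[OF y(2)]] Y' by metis
    have "y \<epsilon> t - x \<epsilon> t = 0" for t
    proof (rule bounded_damped_solution_zero'[where d = "\<lambda>t. y \<epsilon> t - x \<epsilon> t" and ?d1.0 = "\<lambda>t. y1 t - x1 t" and ?d2.0 = "\<lambda>t. y2 t - x2 t" and c = c and a = "1 / \<epsilon>" and p = "\<lambda>t. y \<epsilon> t + x \<epsilon> t" and M = "max (c/10) (Mx + My)"])
      show "((\<lambda>t. y \<epsilon> t - x \<epsilon> t) has_real_derivative y1 t - x1 t) (at t)"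
        "((\<lambda>t. y1 t - x1 t) has_real_derivative y2 t - x2 t) (at t)" for t
        by (intro DERIV_diff x y)+
      show "y2 t - x2 t + 1 / \<epsilon> * (y1 t - x1 t) + (y \<epsilon> t + x \<epsilon> t) * (y \<epsilon> t - x \<epsilon> t) = 0" for t
      proof -
        have "\<epsilon> * (y2 t - x2 t + 1 / \<epsilon> * (y1 t - x1 t) + (y \<epsilon> t + x \<epsilon> t) * (y \<epsilon> t - x \<epsilon> t)) =
          (\<epsilon> * y2 t + y1 t + \<epsilon> * (y \<epsilon> t)\<^sup>2) - (\<epsilon> * x2 t + x1 t + \<epsilon> * (x \<epsilon> t)\<^sup>2)"
          using \<epsilon> by (simp add: algebra_simps power2_eq_square)
        also have "\<dots> = 0" by (simp add: x(3) y(3))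
        finally show ?thesis using \<epsilon> by simp
      qed
      show "\<bar>y \<epsilon> t + x \<epsilon> t - 2 * c\<bar> \<le> c / 10" for t using bx[of t] bdy[of t] CC by linarith
      show "\<bar>y \<epsilon> t - x \<epsilon> t\<bar> \<le> max (c/10) (Mx + My)" for t
        using bx[of t] bdy[of t] CC by linarith
      show "\<bar>y1 t - x1 t\<bar> \<le> max (c/10) (Mx + My)" for t using Mx[of t] My[of t] by linarith
    qed (use \<epsilon> a2 c0 in auto)
    thus ?thesis by (simp add: fun_eq_iff)
  qed
  thus ?thesis using e0 by blast
qed

theorem theorem2:
  fixes f :: "real \<Rightarrow> real" and \<omega> \<alpha> :: real
  assumes "\<omega> \<noteq> 0"
    and "real_analytic f"
    and "\<And>\<psi>. f (\<psi> + 2 * pi) = f \<psi>"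
    and "fourier_coeff f 0 = of_real \<alpha>"
    and "\<alpha> > 0"
  shows "only_expandable_periodic_solution \<alpha> \<omega> f
           (\<lambda>\<epsilon> t. Re (resummed_solution \<alpha> \<omega> f (of_real \<epsilon>) t)) \<and>
         (\<exists>\<epsilon>0>0. \<forall>\<epsilon> t. \<bar>\<epsilon>\<bar> < \<epsilon>0 \<longrightarrow>
            resummed_solution \<alpha> \<omega> f (of_real \<epsilon>) t \<in> \<real> \<and>
            resummed_solution \<alpha> \<omega> f (of_real \<epsilon>) (t + 2 * pi / \<omega>)
              = resummed_solution \<alpha> \<omega> f (of_real \<epsilon>) t) \<and>
         (\<exists>R0>0. \<forall>R. 0 < R \<and> R \<le> R0 \<longrightarrow>
            (\<forall>\<epsilon>\<in>two_discs R. \<forall>t. summable (\<lambda>k. resummed_term \<alpha> \<omega> f \<epsilon> k t)) \<and>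
            (\<exists>A>0. \<exists>B>0. gevrey_bound R A B (formal_term \<alpha> \<omega> f) (resummed_solution \<alpha> \<omega> f)) \<and>
            (\<forall>A>0. \<forall>B>0. gevrey_bound R A B (formal_term \<alpha> \<omega> f) (resummed_solution \<alpha> \<omega> f) \<longrightarrow>
               borel_representation R B (formal_term \<alpha> \<omega> f) (resummed_solution \<alpha> \<omega> f)))"
proof -
  define F where "F = fourier_coeff f"
  obtain \<xi>' M where \<xi>': "\<xi>' > 0" and decay: "\<And>\<nu>. norm (F \<nu>) \<le> M * exp (- \<xi>' * \<bar>of_int \<nu>\<bar>)"
    and inversion: "\<And>\<psi>. ((\<lambda>\<nu>. exp (\<i> * of_int \<nu> * of_real \<psi>) * F \<nu>) has_sum of_real (f \<psi>)) UNIV"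
    using real_analytic_fourier[OF assms(2,3)] unfolding F_def by blast
  \<comment> \<open>Half of the decay rate is given up to make the weighted sum converge.\<close>
  have F_ws: "weighted_summable (\<xi>'/2) F"
    unfolding weighted_summable_def
  proof (rule summable_on_comparison_test)
    show "(\<lambda>\<nu>. M * exp (- (\<xi>'/2) * \<bar>real_of_int \<nu>\<bar>)) summable_on UNIV"
      using \<xi>' by (intro summable_on_cmult_right summable_on_exp_abs) simp
    fix \<nu> :: int
    have "norm (F \<nu>) * weight (\<xi>'/2) \<nu> \<le> M * exp (- \<xi>' * \<bar>of_int \<nu>\<bar>) * weight (\<xi>'/2) \<nu>"
      by (intro mult_right_mono decay) simp
    also have "\<dots> = M * exp (- (\<xi>'/2) * \<bar>of_int \<nu>\<bar>)"
      by (simp add: weight_def exp_add[symmetric] mult.assoc)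
    finally show "norm (F \<nu>) * weight (\<xi>'/2) \<nu> \<le> M * exp (- (\<xi>'/2) * \<bar>of_int \<nu>\<bar>)" .
  qed simp
  define c where "c = sqrt \<alpha>"
  have c: "c > 0" "c\<^sup>2 = \<alpha>" using assms(5) by (auto simp: c_def)
  interpret forcing c \<omega> "\<xi>'/2" F
  proof
    show "F 0 = (of_real c)\<^sup>2" using assms(4) c(2) by (simp add: F_def flip: of_real_power)
    show "F (- \<nu>) = cnj (F \<nu>)" for \<nu> unfolding F_def by (rule fourier_coeff_uminus)
  qed (use assms(1) \<xi>' c F_ws in auto)
  let ?sol = "resummed_solution \<alpha> \<omega> f" and ?a = "formal_term \<alpha> \<omega> f"
  have terms: "resummed_term \<alpha> \<omega> f \<epsilon> k t = fourier_series \<omega> (x \<epsilon> k) t" "?a k t = fourier_series \<omega> (y k) t" for \<epsilon> k t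
    by (simp_all add: resummed_term_def formal_term_def c_def F_def)
  have sol: "?sol \<epsilon> t = fourier_series \<omega> (X \<epsilon>) t" if "admissible \<epsilon>" for \<epsilon> t
    unfolding resummed_solution_def terms by (rule sums_unique[OF fourier_series_x_sums[OF that], symmetric])
  have F_series: "fourier_series \<omega> F t = of_real (f (\<omega> * t))" for t
    unfolding fourier_series_def using inversion[of "\<omega> * t"] by (simp add: infsumI mult.assoc)
  have real: "?sol (of_real \<epsilon>) t \<in> \<real>" if "\<bar>\<epsilon>\<bar> \<le> R0" for \<epsilon> t
  proof -
    note adm = real_admissible[OF that]
    have "X (of_real \<epsilon>) (- \<nu>) = cnj (X (of_real \<epsilon>) \<nu>)" for \<nu>
    proof -
      have "(\<lambda>k. cnj (x (of_real \<epsilon>) k \<nu>)) sums cnj (X (of_real \<epsilon>) \<nu>)" using x_sums[OF adm] by (simp add: sums_cnj)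
      thus ?thesis using x_sums[OF adm, of "- \<nu>"] unfolding x_symmetric by (rule sums_unique2[rotated])
    qed
    thus ?thesis unfolding sol[OF adm] by (rule fourier_series_real)
  qed
  have periodic: "?sol \<epsilon> (t + 2 * pi / \<omega>) = ?sol \<epsilon> t" for \<epsilon> t
    unfolding resummed_solution_def terms fourier_series_periodic[OF assms(1)] ..
  have remainder: "norm (?sol \<epsilon> t - (\<Sum>k<N. \<epsilon> ^ k * ?a k t)) \<le> 3 * c / 2 * (exp 1 / L) ^ N * fact N * norm \<epsilon> ^ N"
    if "admissible \<epsilon>" "\<epsilon> \<noteq> 0" for \<epsilon> t N
    unfolding terms sol[OF that(1)] by (rule gevrey_remainder[OF that])
  have ode: "solves_ode \<omega> f \<epsilon> (\<lambda>t. Re (?sol (of_real \<epsilon>) t))" if e: "\<bar>\<epsilon>\<bar> \<le> R0" for \<epsilon>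
  proof -
    note adm = real_admissible[OF e]
    obtain z' z'' where z: "\<And>t. (fourier_series \<omega> (X (of_real \<epsilon>)) has_vector_derivative z' t) (at t)"
      "\<And>t. (z' has_vector_derivative z'' t) (at t)"
      "\<And>t. of_real \<epsilon> * z'' t + z' t + of_real \<epsilon> * (fourier_series \<omega> (X (of_real \<epsilon>)) t)\<^sup>2 = of_real \<epsilon> * fourier_series \<omega> F t"
      using resummed_ode[OF adm] by blast
    have "\<epsilon> * Re (z'' t) + Re (z' t) + \<epsilon> * (Re (?sol (of_real \<epsilon>) t))\<^sup>2 = \<epsilon> * f (\<omega> * t)" for t
    proof -
      have "fourier_series \<omega> (X (of_real \<epsilon>)) t = of_real (Re (?sol (of_real \<epsilon>) t))"
        using real[OF e, of t] by (simp add: sol[OF adm])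
      hence "of_real \<epsilon> * z'' t + z' t + of_real (\<epsilon> * (Re (?sol (of_real \<epsilon>) t))\<^sup>2) = of_real (\<epsilon> * f (\<omega> * t))"
        using z(3)[of t] by (simp add: F_series)
      from arg_cong[OF this, of Re] show ?thesis by simp
    qed
    thus ?thesis unfolding solves_ode_def
      by (intro exI[of _ "\<lambda>t. Re (z' t)"] exI[of _ "\<lambda>t. Re (z'' t)"])
         (use has_vector_derivative_Re[OF z(1)] has_vector_derivative_Re[OF z(2)] in \<open>auto simp: sol[OF adm]\<close>)
  qed
  have expandable: "expandable_periodic_solution \<alpha> \<omega> f (\<lambda>\<epsilon> t. Re (?sol (of_real \<epsilon>) t))"
    unfolding expandable_periodic_solution_def
  proof (rule conjI, rule exI[of _ R0], intro conjI[OF R0_pos] allI impI)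
    fix \<epsilon> assume e: "\<epsilon> \<noteq> 0 \<and> \<bar>\<epsilon>\<bar> < R0"
    have "solves_ode \<omega> f \<epsilon> (\<lambda>t. Re (?sol (of_real \<epsilon>) t))" using ode e by simp
    \<comment> \<open>The modulus makes the period positive for either sign of \<omega>.\<close>
    moreover have "?sol (of_real \<epsilon>) (t + 2 * pi / \<bar>\<omega>\<bar>) = ?sol (of_real \<epsilon>) t" for t
      using periodic[of "of_real \<epsilon>" t] periodic[of "of_real \<epsilon>" "t + 2 * pi / \<bar>\<omega>\<bar>"] by (cases "\<omega> > 0") auto
    hence "\<exists>P>0. \<forall>t. Re (?sol (of_real \<epsilon>) (t + P)) = Re (?sol (of_real \<epsilon>) t)"
      using assms(1) by (intro exI[of _ "2 * pi / \<bar>\<omega>\<bar>"]) auto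
    ultimately show "solves_ode \<omega> f \<epsilon> (\<lambda>t. Re (?sol (of_real \<epsilon>) t)) \<and>
        (\<exists>P>0. \<forall>t. Re (?sol (of_real \<epsilon>) (t + P)) = Re (?sol (of_real \<epsilon>) t))" ..
  next
    show "\<forall>N. \<exists>C. \<exists>\<epsilon>0>0. \<forall>\<epsilon> t. \<epsilon> \<noteq> 0 \<and> \<bar>\<epsilon>\<bar> < \<epsilon>0 \<longrightarrow>
        cmod (of_real (Re (?sol (of_real \<epsilon>) t)) - (\<Sum>k<N. of_real \<epsilon> ^ k * ?a k t)) \<le> C * \<bar>\<epsilon>\<bar> ^ N"
    proof (rule allI, rule_tac x = "3 * c / 2 * (exp 1 / L) ^ N * fact N" in exI, rule exI[of _ R0], intro conjI[OF R0_pos] allI impI)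
      fix N \<epsilon> t assume e: "\<epsilon> \<noteq> 0 \<and> \<bar>\<epsilon>\<bar> < R0"
      hence "of_real (Re (?sol (of_real \<epsilon>) t)) = ?sol (of_real \<epsilon>) t" using real[of \<epsilon> t] by simp
      thus "cmod (of_real (Re (?sol (of_real \<epsilon>) t)) - (\<Sum>k<N. of_real \<epsilon> ^ k * ?a k t)) \<le> 3 * c / 2 * (exp 1 / L) ^ N * fact N * \<bar>\<epsilon>\<bar> ^ N"
        using remainder[OF real_admissible, of \<epsilon> t N] e by simp
    qed
  qed
  have "only_expandable_periodic_solution \<alpha> \<omega> f (\<lambda>\<epsilon> t. Re (?sol (of_real \<epsilon>) t))"
    unfolding only_expandable_periodic_solution_def
    using expandable expandable_solutions_agree[OF _ expandable] assms(5) by simp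
  moreover have "\<exists>\<epsilon>0>0. \<forall>\<epsilon> t. \<bar>\<epsilon>\<bar> < \<epsilon>0 \<longrightarrow> ?sol (of_real \<epsilon>) t \<in> \<real> \<and> ?sol (of_real \<epsilon>) (t + 2 * pi / \<omega>) = ?sol (of_real \<epsilon>) t"
    using R0_pos real periodic by (intro exI[of _ R0]) auto
  moreover have "\<exists>R0>0. \<forall>R. 0 < R \<and> R \<le> R0 \<longrightarrow>
            (\<forall>\<epsilon>\<in>two_discs R. \<forall>t. summable (\<lambda>k. resummed_term \<alpha> \<omega> f \<epsilon> k t)) \<and>
            (\<exists>A>0. \<exists>B>0. gevrey_bound R A B ?a ?sol) \<and>
            (\<forall>A>0. \<forall>B>0. gevrey_bound R A B ?a ?sol \<longrightarrow> borel_representation R B ?a ?sol)"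
  proof (rule exI[of _ R0], intro conjI[OF R0_pos] allI impI)
    fix R assume R: "0 < R \<and> R \<le> R0"
    hence adm: "admissible \<epsilon>" if "\<epsilon> \<in> two_discs R" for \<epsilon> using two_discs_admissible that by blast
    have nz: "\<epsilon> \<noteq> 0" if "\<epsilon> \<in> two_discs R" for \<epsilon> using that R by (auto simp: two_discs_def)
    show "(\<forall>\<epsilon>\<in>two_discs R. \<forall>t. summable (\<lambda>k. resummed_term \<alpha> \<omega> f \<epsilon> k t)) \<and>
            (\<exists>A>0. \<exists>B>0. gevrey_bound R A B ?a ?sol) \<and>
            (\<forall>A>0. \<forall>B>0. gevrey_bound R A B ?a ?sol \<longrightarrow> borel_representation R B ?a ?sol)"
    proof (intro conjI ballI allI impI)
      show "summable (\<lambda>k. resummed_term \<alpha> \<omega> f \<epsilon> k t)" if "\<epsilon> \<in> two_discs R" for \<epsilon> t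
        unfolding terms by (rule sums_summable[OF fourier_series_x_sums[OF adm[OF that]]])
      have "gevrey_bound R (3 * c / 2) (exp 1 / L) ?a ?sol"
        unfolding gevrey_bound_def by (intro allI ballI remainder adm nz)
      thus "\<exists>A>0. \<exists>B>0. gevrey_bound R A B ?a ?sol"
        using c L_pos by (intro exI[of _ "3 * c / 2"] conjI exI[of _ "exp 1 / L"]) auto
      \<comment> \<open>A and B are arbitrary here, not just the pair found above; the assumed bound
        and holomorphy on the discs are what \<open>nevanlinna_sokal_two_discs\<close> takes as
        input.\<close>
      fix A B :: real assume "0 < A" "0 < B" "gevrey_bound R A B ?a ?sol"
      moreover have "(\<lambda>\<epsilon>. ?sol \<epsilon> t) holomorphic_on two_discs R" for t
      proof -
        have "two_discs R \<subseteq> two_discs R0" using R divide_left_mono[of R R0 1] by (auto simp: two_discs_def)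
        from holomorphic_on_subset[OF resummed_holomorphic this]
        show ?thesis by (rule holomorphic_transform) (simp add: sol adm)
      qed
      ultimately show "borel_representation R B ?a ?sol" using R by (intro nevanlinna_sokal_two_discs) auto
    qed
  qed
  ultimately show ?thesis by blast
qed

end
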